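(* Let $m\ge 2$ be a natural number, let $T_m$ be the $m$-adic tree and let $G\le\mathrm{Aut}\,T_m$ be a finitely generated regular branch group, with closure $\overline G$ in $\mathrm{Aut}\,T_m$. Then there exists a natural number $b\ge 2$ such that $$\mathrm{hspec}_{b}^{\mathcal S}(\overline G)=\mathrm{hspec}_{\mathrm{fg}}^{\mathcal S}(\overline G)=\mathrm{hspec}^{\mathcal S}(\overline G)=[0,1].$$ Furthermore, if $G$ is also just infinite, then for any nice filtration $\mathcal N$ of $\overline G$ (and this $b$) $$\mathrm{hspec}_{b}^{\mathcal N}(\overline G)=\mathrm{hspec}_{\mathrm{fg}}^{\mathcal N}(\overline G)=\mathrm{hspec}^{\mathcal N}(\overline G)=[0,1].$$
   Context: $T_m$ is the infinite rooted tree in which every vertex has exactly $m$ immediate descendants; vertices are identified with finite words over an alphabet of $m$ letters, and $\mathcal L_n$ is the set of words of length $n$ ($n$th level). $\mathrm{Aut}\,T_m$ (automorphisms fixing the root, acting on the right) carries the congruence topology given by the level stabilizers $\mathrm{St}(n)$ (pointwise stabilizers of $\mathcal L_n$); closures are taken in it. For $G\le \mathrm{Aut}\,T_m$, $\mathrm{St}_G(n)=\mathrm{St}(n)\cap G$. The section of $g$ at $v$ is the automorphism $g|_v$ of $T_m$ (the subtree below $v$ being identified with $T_m$) with $(vu)g=(v)g\,(u)g|_v$ for all words $u$; $\psi:\mathrm{St}(1)\to \mathrm{Aut}\,T_m\times\overset{m}{\cdots}\times\mathrm{Aut}\,T_m$ sends $g$ to the tuple of its sections at the first-level vertices. $G$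 is self-similar if $g|_v\in G$ for all $g\in G$ and all vertices $v$; level-transitive if transitive on every level. $K\le G$ is a branching subgroup if $\psi(\mathrm{St}_K(1))\ge K\times\overset{m}{\cdots}\times K$. $G$ is regular branch if it is self-similar, level-transitive and contains a finite-index branching subgroup. An infinite discrete group is just infinite if all its proper quotients are finite. For a closed subgroup $\Gamma\le \mathrm{Aut}\,T_m$, a filtration is a descending chain $\{\Gamma_i\}_{i\ge0}$ of open normal subgroups of $\Gamma$, $\Gamma_0=\Gamma$, with trivial intersection. For closed $H\le\Gamma$, $$\mathrm{hdim}_\Gamma^{\{\Gamma_i\}}(H)=\liminf_{i\to\infty}\frac{\log|H\Gamma_i:\Gamma_i|}{\log|\Gamma:\Gamma_i|}.$$ $\mathrm{hspec}$, $\mathrm{hspec}_{\mathrm{fg}}$ and $\mathrm{hspec}_{b}$ denote the sets of values of $\mathrm{hdim}_\Gamma(H)$ as $H$ ranges over all closed subgroups, over all topologically finitely generated closed subgroups, and over all closed subgroups topologically generated by at most $b$ elements, respectively; the superscript is the filtration. $\mathcal S=\{\mathrm{St}_\Gamma(n)\}_{n\ge1}$ is the level-stabilizer filtration. For a vertex $v$, $\mathrm{rist}_\Gamma(v)$ is the subgroup of elements of $\Gamma$ fixing $v$ and acting non-trivially only on the subtree rooted at $v$, and $\mathrm{Rist}_\Gamma(k)$ is the product of the $\mathrm{rist}_\Gamma(v)$, $v\in\mathcal L_k$. A filtration $\{\Gamma_i\}$ is nice if for every $k\ge1$ there is an isomorphism $\mathrm{Rist}_\Gamma(k)\Gamma_i/\Gamma_i\cong\prod_{v\in\mathcal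 L_k}\mathrm{rist}_\Gamma(v)\Gamma_i/\Gamma_i$ for all but finitely many $i$. *)

theory Defs
  imports
    "HOL-Analysis.Abstract_Topology"
    "HOL-Library.Cardinality"
    "HOL-Library.Extended_Real"
    "HOL-Library.Sublist"
    "HOL-Algebra.Product_Groups"
    "HOL-Algebra.Generated_Groups"
begin

text \<open>
  The letters of the alphabet are the elements of a finite type \<open>'a\<close>, so that \<open>m = CARD('a)\<close>.
  The vertices of the tree are the words \<open>'a list\<close>, the root is the empty word.
\<close>

definition adjacent :: "'a list \<Rightarrow> 'a list \<Rightarrow> bool" where
  "adjacent u v \<longleftrightarrow> (\<exists>x. v = u @ [x] \<or> u = v @ [x])"

definition level :: "nat \<Rightarrow> 'a list set" where
  "level n = {v. length v = n}"

text \<open>Automorphisms act on the right, so the product of \<open>g\<close> and \<open>h\<close> is ``first \<open>g\<close>, then \<open>h\<close>''.\<close>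

definition Aut_tree :: "('a list \<Rightarrow> 'a list) monoid" where
  "Aut_tree =
     \<lparr>carrier = {g. bij g \<and> g [] = [] \<and> (\<forall>u v. adjacent (g u) (g v) \<longleftrightarrow> adjacent u v)},
      monoid.mult = (\<lambda>g h. h \<circ> g), one = id\<rparr>"

abbreviation as_group :: "('a list \<Rightarrow> 'a list) set \<Rightarrow> ('a list \<Rightarrow> 'a list) monoid" where
  "as_group H \<equiv> Aut_tree\<lparr>carrier := H\<rparr>"

definition St :: "nat \<Rightarrow> ('a list \<Rightarrow> 'a list) set" where
  "St n = {g \<in> carrier Aut_tree. \<forall>v\<in>level n. g v = v}"

definition St_in :: "('a list \<Rightarrow> 'a list) set \<Rightarrow> nat \<Rightarrow> ('a list \<Rightarrow> 'a list) set" where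
  "St_in G n = St n \<inter> G"

text \<open>Automorphisms preserve prefixes and lengths, so dropping the image of \<open>v\<close> from the
  image of \<open>v @ u\<close> gives the section; see \<open>section_append\<close> below.\<close>

definition section_at :: "('a list \<Rightarrow> 'a list) \<Rightarrow> 'a list \<Rightarrow> ('a list \<Rightarrow> 'a list)" where
  "section_at g v = (\<lambda>u. drop (length v) (g (v @ u)))"

definition \<psi> :: "('a list \<Rightarrow> 'a list) \<Rightarrow> ('a \<Rightarrow> 'a list \<Rightarrow> 'a list)" where
  "\<psi> g = (\<lambda>x. section_at g [x])"

lemma Aut_tree_simps [simp]:
  "g \<in> carrier Aut_tree \<longleftrightarrow>
     bij g \<and> g [] = [] \<and> (\<forall>u v. adjacent (g u) (g v) \<longleftrightarrow> adjacent u v)"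
  "g \<otimes>\<^bsub>Aut_tree\<^esub> h = h \<circ> g"
  "\<one>\<^bsub>Aut_tree\<^esub> = id"
  by (simp_all add: Aut_tree_def)

lemma group_Aut_tree: "group Aut_tree"
proof (rule groupI)
  fix g :: "'a list \<Rightarrow> 'a list" assume g: "g \<in> carrier Aut_tree"
  then have b: "bij g" by simp
  have "inv_into UNIV g \<in> carrier Aut_tree"
  proof -
    have "inv_into UNIV g [] = []" using g b by (metis Aut_tree_simps(1) bij_inv_eq_iff)
    moreover have "adjacent (inv_into UNIV g u) (inv_into UNIV g v) \<longleftrightarrow> adjacent u v" for u v
      using g b by (metis Aut_tree_simps(1) bij_inv_eq_iff)
    ultimately show ?thesis using b by (simp add: bij_imp_bij_inv)
  qed
  moreover have "inv_into UNIV g \<otimes>\<^bsub>Aut_tree\<^esub> g = \<one>\<^bsub>Aut_tree\<^esub>"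
    using b by (simp add: fun_eq_iff bij_is_surj surj_f_inv_f)
  ultimately show "\<exists>h\<in>carrier Aut_tree. h \<otimes>\<^bsub>Aut_tree\<^esub> g = \<one>\<^bsub>Aut_tree\<^esub>" by blast
qed (auto simp: bij_comp comp_assoc)

lemma Aut_tree_child:
  assumes "g \<in> carrier Aut_tree"
  shows "\<exists>y. g (v @ [x]) = g v @ [y]"
proof (induction v arbitrary: x rule: rev_induct)
  case Nil
  have "adjacent [] [x]" by (simp add: adjacent_def)
  then have "adjacent (g []) (g [x])" using assms unfolding Aut_tree_simps by blast
  then show ?case using assms by (auto simp: adjacent_def)
next
  case (snoc z v)
  obtain y where y: "g (v @ [z]) = g v @ [y]" using snoc by blast
  have "adjacent (v @ [z]) ((v @ [z]) @ [x])" by (simp add: adjacent_def)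
  then have "adjacent (g (v @ [z])) (g ((v @ [z]) @ [x]))"
    using assms unfolding Aut_tree_simps by blast
  moreover have "g ((v @ [z]) @ [x]) \<noteq> g v"
    using assms by (auto simp: bij_def inj_def)
  ultimately show ?case using y by (auto simp: adjacent_def)
qed

lemma length_Aut_tree:
  assumes "g \<in> carrier Aut_tree"
  shows "length (g v) = length v"
proof (induction v rule: rev_induct)
  case (snoc x v)
  then show ?case using Aut_tree_child[OF assms, of v x] by auto
qed (use assms in simp)

lemma section_append:
  assumes "g \<in> carrier Aut_tree"
  shows "g (v @ u) = g v @ section_at g v u"
proof -
  have "\<exists>w. g (v @ u) = g v @ w"
  proof (induction u rule: rev_induct)
    case (snoc x u)
    then show ?case using Aut_tree_child[OF assms, of "v @ u" x] by auto
  qed simp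
  then show ?thesis using length_Aut_tree[OF assms, of v] by (auto simp: section_at_def)
qed

definition congruence_topology :: "('a list \<Rightarrow> 'a list) topology" where
  "congruence_topology =
     topology_generated_by {St n #>\<^bsub>Aut_tree\<^esub> g | n g. g \<in> carrier Aut_tree}"

definition closed_subgroup :: "('a list \<Rightarrow> 'a list) set \<Rightarrow> bool" where
  "closed_subgroup H \<longleftrightarrow> subgroup H Aut_tree \<and> closedin congruence_topology H"

definition top_generated_by :: "('a list \<Rightarrow> 'a list) set \<Rightarrow> ('a list \<Rightarrow> 'a list) set \<Rightarrow> bool" where
  "top_generated_by H S \<longleftrightarrow>
     S \<subseteq> H \<and> H = congruence_topology closure_of (generate Aut_tree S)"

definition finitely_generated :: "('a list \<Rightarrow> 'a list) set \<Rightarrow> bool" where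
  "finitely_generated G \<longleftrightarrow>
     (\<exists>S. finite S \<and> S \<subseteq> carrier Aut_tree \<and> G = generate Aut_tree S)"

definition self_similar :: "('a list \<Rightarrow> 'a list) set \<Rightarrow> bool" where
  "self_similar G \<longleftrightarrow> (\<forall>g\<in>G. \<forall>v. section_at g v \<in> G)"

definition level_transitive :: "('a list \<Rightarrow> 'a list) set \<Rightarrow> bool" where
  "level_transitive G \<longleftrightarrow> (\<forall>n. \<forall>u\<in>level n. \<forall>w\<in>level n. \<exists>g\<in>G. g u = w)"

definition branching_subgroup ::
    "('a list \<Rightarrow> 'a list) set \<Rightarrow> ('a list \<Rightarrow> 'a list) set \<Rightarrow> bool" where
  "branching_subgroup G K \<longleftrightarrow>
     subgroup K Aut_tree \<and> K \<subseteq> G \<and> (UNIV \<rightarrow> K) \<subseteq> \<psi> ` St_in K 1"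

definition regular_branch :: "('a list \<Rightarrow> 'a list) set \<Rightarrow> bool" where
  "regular_branch G \<longleftrightarrow>
     subgroup G Aut_tree \<and> self_similar G \<and> level_transitive G \<and>
     (\<exists>K. branching_subgroup G K \<and> finite (rcosets\<^bsub>as_group G\<^esub> K))"

definition just_infinite :: "('a list \<Rightarrow> 'a list) set \<Rightarrow> bool" where
  "just_infinite G \<longleftrightarrow>
     infinite G \<and>
     (\<forall>N. N \<lhd> as_group G \<and> N \<noteq> {\<one>\<^bsub>Aut_tree\<^esub>} \<longrightarrow> finite (carrier (as_group G Mod N)))"

text \<open>The level-stabilizer filtration of \<open>\<Gamma>\<close> is \<open>St_in \<Gamma>\<close>, whose term of index \<open>0\<close> is \<open>\<Gamma>\<close>.\<close>

definition filtration ::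
    "('a list \<Rightarrow> 'a list) set \<Rightarrow> (nat \<Rightarrow> ('a list \<Rightarrow> 'a list) set) \<Rightarrow> bool" where
  "filtration \<Gamma> N \<longleftrightarrow>
     N 0 = \<Gamma> \<and> decseq N \<and>
     (\<forall>i. N i \<lhd> as_group \<Gamma> \<and> openin (subtopology congruence_topology \<Gamma>) (N i)) \<and>
     (\<Inter>i. N i) = {\<one>\<^bsub>Aut_tree\<^esub>}"

definition subgroup_index :: "('a list \<Rightarrow> 'a list) set \<Rightarrow> ('a list \<Rightarrow> 'a list) set \<Rightarrow> nat" where
  "subgroup_index A B = card (rcosets\<^bsub>as_group A\<^esub> B)"

text \<open>Closed subgroups of \<open>Aut_tree\<close> are compact, so the terms of a filtration have finite index
  and the cardinalities below are the actual indices. Quotients with \<open>ln 1 = 0\<close> in the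
  denominator only occur for initial terms of the filtration (or trivial \<open>\<Gamma>\<close>).\<close>

definition hdim ::
    "('a list \<Rightarrow> 'a list) set \<Rightarrow> (nat \<Rightarrow> ('a list \<Rightarrow> 'a list) set) \<Rightarrow>
     ('a list \<Rightarrow> 'a list) set \<Rightarrow> ereal" where
  "hdim \<Gamma> N H =
     liminf (\<lambda>i. ereal (ln (real (subgroup_index (H <#>\<^bsub>Aut_tree\<^esub> N i) (N i))) /
                        ln (real (subgroup_index \<Gamma> (N i)))))"

definition hspec ::
    "('a list \<Rightarrow> 'a list) set \<Rightarrow> (nat \<Rightarrow> ('a list \<Rightarrow> 'a list) set) \<Rightarrow> ereal set" where
  "hspec \<Gamma> N = {hdim \<Gamma> N H | H. closed_subgroup H \<and> H \<subseteq> \<Gamma>}"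

definition hspec_fg ::
    "('a list \<Rightarrow> 'a list) set \<Rightarrow> (nat \<Rightarrow> ('a list \<Rightarrow> 'a list) set) \<Rightarrow> ereal set" where
  "hspec_fg \<Gamma> N =
     {hdim \<Gamma> N H | H. closed_subgroup H \<and> H \<subseteq> \<Gamma> \<and> (\<exists>S. finite S \<and> top_generated_by H S)}"

definition hspec_gen ::
    "nat \<Rightarrow> ('a list \<Rightarrow> 'a list) set \<Rightarrow> (nat \<Rightarrow> ('a list \<Rightarrow> 'a list) set) \<Rightarrow> ereal set" where
  "hspec_gen b \<Gamma> N =
     {hdim \<Gamma> N H | H. closed_subgroup H \<and> H \<subseteq> \<Gamma> \<and>
        (\<exists>S. finite S \<and> card S \<le> b \<and> top_generated_by H S)}"

definition rist :: "('a list \<Rightarrow> 'a list) set \<Rightarrow> 'a list \<Rightarrow> ('a list \<Rightarrow> 'a list) set" where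
  "rist \<Gamma> v = {g \<in> \<Gamma>. g v = v \<and> (\<forall>u. \<not> prefix v u \<longrightarrow> g u = u)}"

text \<open>The factors of the product commute elementwise (\<open>rist_commute\<close>), so their internal
  product is the subgroup they generate.\<close>

definition Rist :: "('a list \<Rightarrow> 'a list) set \<Rightarrow> nat \<Rightarrow> ('a list \<Rightarrow> 'a list) set" where
  "Rist \<Gamma> k = generate Aut_tree (\<Union>v\<in>level k. rist \<Gamma> v)"

lemma rist_commute:
  assumes "\<Gamma> \<subseteq> carrier Aut_tree" "v \<in> level k" "w \<in> level k" "v \<noteq> w"
    and g: "g \<in> rist \<Gamma> v" and h: "h \<in> rist \<Gamma> w"
  shows "g \<otimes>\<^bsub>Aut_tree\<^esub> h = h \<otimes>\<^bsub>Aut_tree\<^esub> g"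
proof -
  have len: "length v = length w" using assms by (simp add: level_def)
  have ga: "g \<in> carrier Aut_tree" and ha: "h \<in> carrier Aut_tree"
    using assms by (auto simp: rist_def)
  have disj: "\<not> (prefix v u \<and> prefix w u)" for u
    using len \<open>v \<noteq> w\<close> by (auto simp: prefix_def append_eq_append_conv)
  have gp: "prefix v (g u)" if "prefix v u" for u
    using that g section_append[OF ga] by (auto simp: prefix_def rist_def)
  have hp: "prefix w (h u)" if "prefix w u" for u
    using that h section_append[OF ha] by (auto simp: prefix_def rist_def)
  have gf: "g u = u" if "\<not> prefix v u" for u using g that by (auto simp: rist_def)
  have hf: "h u = u" if "\<not> prefix w u" for u using h that by (auto simp: rist_def)
  have "h (g u) = g (h u)" for u
    by (metis disj gp hp gf hf)
  then show ?thesis by (auto simp: fun_eq_iff)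
qed

definition nice_filtration ::
    "('a list \<Rightarrow> 'a list) set \<Rightarrow> (nat \<Rightarrow> ('a list \<Rightarrow> 'a list) set) \<Rightarrow> bool" where
  "nice_filtration \<Gamma> N \<longleftrightarrow>
     filtration \<Gamma> N \<and>
     (\<forall>k\<ge>1. \<forall>\<^sub>F i in sequentially.
        as_group (Rist \<Gamma> k <#>\<^bsub>Aut_tree\<^esub> N i) Mod N i \<cong>
        product_group (level k) (\<lambda>v. as_group (rist \<Gamma> v <#>\<^bsub>Aut_tree\<^esub> N i) Mod N i))"

end

theory Submission
  imports Defs
begin

text \<open>
  Write \<open>m\<close> for the number of letters and \<open>\<Gamma>\<close> for the closure of \<open>G\<close>. The group contains a normal branching
  subgroup \<open>C\<close> of finite index which is finitely generated, by Schreier's lemma. For every vertex \<open>v\<close> there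
  is a copy of \<open>C\<close> inside \<open>C\<close> that acts only below \<open>v\<close>; the \<open>m ^ k\<close> copies at level \<open>k\<close> are conjugate, commute,
  and together have finite index in \<open>G\<close>. One of them therefore has dimension \<open>m ^ (- k)\<close>, and the product of
  the copies over an antichain \<open>V\<close> has dimension \<open>\<Sum>v\<in>V. m ^ (- length v)\<close>. Antichains hanging off a single
  ray realize every number in \<open>[0, 1]\<close> as such a sum, by expansion in base \<open>m\<close>
  (\<open>base_expansion\<close>, \<open>weight_comb\<close>).

  Such an infinite product of copies of \<open>C\<close> need not be topologically finitely generated. It contains,
  however, a subgroup with a bounded number of generators that contains a product of copies of the derived
  subgroup \<open>D\<close> of \<open>C\<close>, over all vertices of some level below each \<open>v \<in> V\<close>. For each generator \<open>a\<close> of \<open>C\<close> take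
  the diagonal element acting as \<open>a\<close> below every \<open>v \<in> V\<close>, and one more element that acts as \<open>a\<close> far below \<open>v\<close>,
  at places chosen differently for different \<open>v\<close>. A diagonal element concentrated at the place
  chosen for \<open>v\<close> commutes with the second kind of element except at \<open>v\<close>, and so the commutators of the two
  separate the factors (\<open>marked_vertices\<close>, \<open>antichain_generators\<close>).

  It remains to see that passing from \<open>C\<close> to \<open>D\<close> does not lower the dimension. Modulo the stabilizer of level \<open>n\<close>
  the abelian group \<open>C / D\<close> has boundedly many generators of order dividing \<open>(m!) ^ n\<close>, so the loss in the
  logarithm of the index is linear in \<open>n\<close>, whereas that logarithm itself grows exponentially
  (\<open>D_mod_cover\<close>, \<open>ix_St_growth\<close>). If \<open>G\<close> is just infinite, \<open>D\<close> has finite index in \<open>G\<close> and the loss is bounded for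
  every filtration; niceness then supplies the independence of the rigid stabilizers on a level modulo the
  terms of the filtration, which for level stabilizers is evident. Both situations are instances of the
  locale \<open>balanced_filtration\<close>, in which the dimension is computed (\<open>upper_estimate\<close>, \<open>lower_estimate\<close>).
\<close>

section \<open>Transversals and finite generation in abstract groups\<close>

lemma exists_representatives:
  assumes "finite (\<theta> ` A)"
  shows "\<exists>R\<subseteq>A. finite R \<and> card R \<le> card (\<theta> ` A) \<and> (\<forall>a\<in>A. \<exists>r\<in>R. \<theta> r = \<theta> a)"
proof -
  let ?R = "inv_into A \<theta> ` \<theta> ` A"
  have "?R \<subseteq> A" by (auto intro: inv_into_into)
  moreover have "card ?R \<le> card (\<theta> ` A)" using assms by (rule card_image_le)
  moreover have "\<forall>a\<in>A. \<exists>r\<in>?R. \<theta> r = \<theta> a" by (auto simp: f_inv_into_f)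
  ultimately show ?thesis using assms by blast
qed

context group
begin

lemma subgroup_nat_pow_closed:
  assumes "subgroup H G" "h \<in> H"
  shows "h [^] (n::nat) \<in> H"
  using assms by (induction n) (auto simp: subgroup.one_closed subgroup.m_closed)

lemma finite_index_transversal:
  assumes H: "subgroup H G" and K: "subgroup K G" and KH: "K \<subseteq> H"
    and fin: "finite (rcosets\<^bsub>G\<lparr>carrier := H\<rparr>\<^esub> K)"
  shows "\<exists>T\<subseteq>H. finite T \<and> (\<forall>g\<in>H. \<exists>t\<in>T. \<exists>k\<in>K. g = k \<otimes> t)"
proof -
  have eq: "rcosets\<^bsub>G\<lparr>carrier := H\<rparr>\<^esub> K = (\<lambda>g. K #> g) ` H"
    by (auto simp: RCOSETS_def r_coset_def)
  obtain T where T: "T \<subseteq> H" "finite T" "\<forall>g\<in>H. \<exists>t\<in>T. K #> t = K #> g"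
    using exists_representatives[of "\<lambda>g. K #> g" H] fin unfolding eq by metis
  have HG: "H \<subseteq> carrier G" using H by (rule subgroup.subset)
  have "\<exists>t\<in>T. \<exists>k\<in>K. g = k \<otimes> t" if g: "g \<in> H" for g
  proof -
    obtain t where t: "t \<in> T" "K #> t = K #> g" using T(3) g by blast
    have "g \<in> K #> g" using K HG g by (meson rcos_self subsetD)
    then have "g \<in> K #> t" using t by simp
    then show ?thesis using t(1) unfolding r_coset_def by auto
  qed
  then show ?thesis using T by blast
qed

text \<open>Schreier's lemma. The rewriting \<open>t \<otimes> s = k \<otimes> t'\<close> of representative times generator
  produces finitely many \<open>k\<close>; pushing a word in the generators through these rewritings moves
  everything into the subgroup they generate, up to one representative at the end. Since the
  representatives that lie in the subgroup are added to the generators, that last one is harmless.\<close>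

lemma finite_index_finitely_generated:
  assumes S: "finite S" "S \<subseteq> carrier G" and K: "subgroup K G" and KG: "K \<subseteq> generate G S"
    and T: "finite T" "T \<subseteq> generate G S"
    and cover: "\<forall>g\<in>generate G S. \<exists>t\<in>T. \<exists>k\<in>K. g = k \<otimes> t"
  shows "\<exists>A. finite A \<and> A \<subseteq> K \<and> K = generate G A"
proof -
  define T' where "T' = insert \<one> T"
  define S' where "S' = S \<union> m_inv G ` S"
  have sub: "subgroup (generate G S) G" using S(2) by (rule generate_is_subgroup)
  have S'G: "S' \<subseteq> generate G S" unfolding S'_def by (auto intro: generate.incl generate.inv)
  have T'G: "T' \<subseteq> generate G S" using T(2) unfolding T'_def by (auto intro: generate.one)
  have "\<forall>t\<in>T'. \<forall>s\<in>S'. \<exists>p. fst p \<in> K \<and> snd p \<in> T \<and> t \<otimes> s = fst p \<otimes> snd p"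
  proof (intro ballI)
    fix t s assume "t \<in> T'" "s \<in> S'"
    then have "t \<otimes> s \<in> generate G S" using S'G T'G by (auto intro: generate.eng)
    then obtain u k where "u \<in> T" "k \<in> K" "t \<otimes> s = k \<otimes> u" using cover by blast
    then show "\<exists>p. fst p \<in> K \<and> snd p \<in> T \<and> t \<otimes> s = fst p \<otimes> snd p" by auto
  qed
  then obtain p where p: "\<And>t s. \<lbrakk>t \<in> T'; s \<in> S'\<rbrakk> \<Longrightarrow>
      fst (p t s) \<in> K \<and> snd (p t s) \<in> T \<and> t \<otimes> s = fst (p t s) \<otimes> snd (p t s)"
    by metis
  define A where "A = (\<lambda>(t, s). fst (p t s)) ` (T' \<times> S') \<union> (T' \<inter> K)"
  have finA: "finite A" using S T unfolding A_def T'_def S'_def by auto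
  have AK: "A \<subseteq> K" unfolding A_def using p by auto
  have KC: "K \<subseteq> carrier G" using K by (rule subgroup.subset)
  have AC: "A \<subseteq> carrier G" using AK KC by blast
  let ?A = "generate G A"
  have A_sub: "subgroup ?A G" using AC by (rule generate_is_subgroup)
  have A_carr: "?A \<subseteq> carrier G" using AC by (rule generate_incl)
  have T'_carr: "T' \<subseteq> carrier G" and S'_carr: "S' \<subseteq> carrier G"
    using T'G S'G sub subgroup.subset by blast+
  have step: "\<exists>k'\<in>?A. \<exists>t'\<in>T'. k \<otimes> t \<otimes> s = k' \<otimes> t'"
    if "k \<in> ?A" "t \<in> T'" "s \<in> S'" for k t s
  proof -
    have ps: "fst (p t s) \<in> A" "snd (p t s) \<in> T'" "t \<otimes> s = fst (p t s) \<otimes> snd (p t s)"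
      using p[OF that(2,3)] that unfolding A_def T'_def by force+
    have "k \<otimes> t \<otimes> s = k \<otimes> (t \<otimes> s)"
      using that A_carr T'_carr S'_carr by (simp add: m_assoc subset_iff)
    also have "\<dots> = (k \<otimes> fst (p t s)) \<otimes> snd (p t s)"
      using that ps A_carr AC T'_carr by (simp add: m_assoc subset_iff)
    finally show ?thesis using ps that by (blast intro: generate.eng generate.incl)
  qed
  have main: "\<exists>k'\<in>?A. \<exists>t'\<in>T'. k \<otimes> t \<otimes> g = k' \<otimes> t'"
    if "g \<in> generate G S" "k \<in> ?A" "t \<in> T'" for g k t
    using that
  proof (induction g arbitrary: k t rule: generate.induct)
    case one
    then have "k \<otimes> t \<otimes> \<one> = k \<otimes> t" using A_carr T'_carr by (auto simp: subset_iff)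
    then show ?case using one by blast
  next
    case (incl h) then show ?case using step S'_def by blast
  next
    case (inv h) then show ?case using step S'_def by blast
  next
    case (eng g h)
    obtain k1 t1 where 1: "k1 \<in> ?A" "t1 \<in> T'" "k \<otimes> t \<otimes> g = k1 \<otimes> t1" using eng by blast
    obtain k2 t2 where 2: "k2 \<in> ?A" "t2 \<in> T'" "k1 \<otimes> t1 \<otimes> h = k2 \<otimes> t2" using eng 1 by blast
    have "g \<in> carrier G" "h \<in> carrier G" using eng.hyps sub subgroup.subset by blast+
    then have "k \<otimes> t \<otimes> (g \<otimes> h) = k \<otimes> t \<otimes> g \<otimes> h"
      using eng.prems A_carr T'_carr by (simp add: m_assoc subset_iff)
    then show ?case using 1 2 by auto
  qed
  have "K \<subseteq> ?A"
  proof
    fix x assume x: "x \<in> K"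
    have xc: "x \<in> carrier G" using x KC by blast
    obtain k t where kt: "k \<in> ?A" "t \<in> T'" "\<one> \<otimes> \<one> \<otimes> x = k \<otimes> t"
      using main[of x \<one> \<one>] x KG T'_def generate.one by blast
    have xk: "x = k \<otimes> t" using kt xc by simp
    have kK: "k \<in> K" using kt(1) generate_subgroup_incl[OF AK K] by blast
    have "t = inv k \<otimes> x"
      using xk kt A_carr T'_carr by (simp add: subset_iff m_assoc[symmetric])
    then have "t \<in> K" using kK x K by (simp add: subgroup.m_closed subgroup.m_inv_closed)
    then have "t \<in> ?A" using kt(2) by (auto simp: A_def intro: generate.incl)
    then show "x \<in> ?A" using xk kt(1) by (auto intro: generate.eng)
  qed
  then have "K = ?A" using generate_subgroup_incl[OF AK K] by blast
  then show ?thesis using finA AK by blast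
qed

definition core_in :: "'a set \<Rightarrow> 'a set \<Rightarrow> 'a set" where
  "core_in H K = {x \<in> H. \<forall>g\<in>H. g \<otimes> x \<otimes> inv g \<in> K}"

lemma core_in_subgroup:
  assumes H: "subgroup H G" and K: "subgroup K G"
  shows "subgroup (core_in H K) G"
proof (rule subgroupI)
  have HG: "H \<subseteq> carrier G" using H by (rule subgroup.subset)
  show "core_in H K \<subseteq> carrier G" using HG by (auto simp: core_in_def)
  have "g \<otimes> \<one> \<otimes> inv g \<in> K" if "g \<in> H" for g
    using that HG subgroup.one_closed[OF K] by (simp add: subset_iff)
  then show "core_in H K \<noteq> {}"
    using subgroup.one_closed[OF H] by (auto simp: core_in_def)
  fix a assume a: "a \<in> core_in H K"
  have "g \<otimes> inv a \<otimes> inv g \<in> K" if g: "g \<in> H" for g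
  proof -
    have "inv (g \<otimes> a \<otimes> inv g) \<in> K"
      using a g K by (simp add: core_in_def subgroup.m_inv_closed)
    then show ?thesis using a g HG by (simp add: core_in_def inv_mult_group m_assoc subset_iff)
  qed
  then show "inv a \<in> core_in H K" using a H by (simp add: core_in_def subgroup.m_inv_closed)
next
  fix a b assume ab: "a \<in> core_in H K" "b \<in> core_in H K"
  have HG: "H \<subseteq> carrier G" using H by (rule subgroup.subset)
  have "g \<otimes> (a \<otimes> b) \<otimes> inv g \<in> K" if g: "g \<in> H" for g
  proof -
    have c: "a \<in> carrier G" "b \<in> carrier G" "g \<in> carrier G"
      using ab g HG by (auto simp: core_in_def)
    have "g \<otimes> (a \<otimes> b) \<otimes> inv g = (g \<otimes> a \<otimes> inv g) \<otimes> (g \<otimes> b \<otimes> inv g)"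
    proof -
      have "(g \<otimes> a \<otimes> inv g) \<otimes> (g \<otimes> b \<otimes> inv g) = g \<otimes> a \<otimes> (inv g \<otimes> g) \<otimes> (b \<otimes> inv g)"
        using c by (simp only: m_assoc m_closed inv_closed)
      then show ?thesis using c by (simp add: m_assoc)
    qed
    then show ?thesis using ab g K by (simp add: core_in_def subgroup.m_closed)
  qed
  then show "a \<otimes> b \<in> core_in H K" using ab H by (simp add: core_in_def subgroup.m_closed)
qed

lemma core_in_subset:
  assumes "subgroup H G"
  shows "core_in H K \<subseteq> K"
proof
  fix x assume x: "x \<in> core_in H K"
  then have "\<one> \<otimes> x \<otimes> inv \<one> \<in> K" using subgroup.one_closed[OF assms] by (auto simp: core_in_def)
  moreover have "x \<in> carrier G" using x subgroup.subset[OF assms] by (auto simp: core_in_def)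
  ultimately show "x \<in> K" by simp
qed

lemma core_in_conj:
  assumes H: "subgroup H G" and x: "x \<in> core_in H K" and g: "g \<in> H"
  shows "g \<otimes> x \<otimes> inv g \<in> core_in H K"
proof -
  have HG: "H \<subseteq> carrier G" using H by (rule subgroup.subset)
  have xH: "x \<in> H" using x by (simp add: core_in_def)
  have "y \<otimes> (g \<otimes> x \<otimes> inv g) \<otimes> inv y \<in> K" if y: "y \<in> H" for y
  proof -
    have "(y \<otimes> g) \<otimes> x \<otimes> inv (y \<otimes> g) \<in> K"
      using x y g H by (simp add: core_in_def subgroup.m_closed)
    then show ?thesis
      using y g xH HG by (simp add: inv_mult_group m_assoc subset_iff)
  qed
  then show ?thesis
    using xH g H by (simp add: core_in_def subgroup.m_closed subgroup.m_inv_closed)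
qed

text \<open>The core has finite index because it contains \<open>g \<otimes> inv g'\<close> as soon as \<open>g\<close> and \<open>g'\<close>
  permute the finitely many cosets of the subgroup in the same way.\<close>

lemma core_in_finite_index:
  assumes H: "subgroup H G" and K: "subgroup K G" and KH: "K \<subseteq> H"
    and T: "finite T" "T \<subseteq> H" and cover: "\<forall>g\<in>H. \<exists>t\<in>T. \<exists>k\<in>K. g = k \<otimes> t"
  shows "\<exists>R\<subseteq>H. finite R \<and> (\<forall>g\<in>H. \<exists>r\<in>R. \<exists>c\<in>core_in H K. g = c \<otimes> r)"
proof -
  have HG: "H \<subseteq> carrier G" and KG: "K \<subseteq> carrier G" using H K subgroup.subset by blast+
  define \<theta> where "\<theta> g = restrict (\<lambda>t. K #> (t \<otimes> g)) T" for g
  have cosets: "K #> g \<in> (\<lambda>t. K #> t) ` T" if "g \<in> H" for g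
  proof -
    obtain t k where tk: "t \<in> T" "k \<in> K" "g = k \<otimes> t" using cover \<open>g \<in> H\<close> by blast
    have "K #> g = (K #> k) #> t"
      using tk KG T(2) HG by (simp add: coset_mult_assoc subset_iff)
    also have "K #> k = K" using K tk(2) KG by (simp add: coset_join2 subset_iff)
    finally show ?thesis using tk(1) by blast
  qed
  have "\<theta> ` H \<subseteq> T \<rightarrow>\<^sub>E (\<lambda>t. K #> t) ` T"
    unfolding \<theta>_def using cosets T(2) H by (auto simp: subset_iff subgroup.m_closed)
  then have "finite (\<theta> ` H)" using T(1) by (meson finite_PiE finite_imageI finite_subset)
  then obtain R where R: "R \<subseteq> H" "finite R" "\<forall>g\<in>H. \<exists>r\<in>R. \<theta> r = \<theta> g"
    using exists_representatives by metis
  have "\<exists>r\<in>R. \<exists>c\<in>core_in H K. g = c \<otimes> r" if g: "g \<in> H" for g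
  proof -
    obtain r where r: "r \<in> R" "\<theta> r = \<theta> g" using R g by blast
    have rH: "r \<in> H" using r R by blast
    have c: "g \<in> carrier G" "r \<in> carrier G" using g rH HG by auto
    have "g \<otimes> inv r \<in> core_in H K" unfolding core_in_def
    proof (intro CollectI conjI ballI)
      show "g \<otimes> inv r \<in> H" using g rH H by (simp add: subgroup.m_closed subgroup.m_inv_closed)
      fix y assume y: "y \<in> H"
      obtain t k where tk: "t \<in> T" "k \<in> K" "y = k \<otimes> t" using cover y by blast
      have tc: "t \<in> carrier G" "k \<in> carrier G" using tk T(2) HG KG by auto
      have "K #> (t \<otimes> g) = K #> (t \<otimes> r)"
        using fun_cong[OF r(2), of t] tk(1) unfolding \<theta>_def by simp
      moreover have "t \<otimes> g \<in> K #> (t \<otimes> g)" using K tc c by (simp add: rcos_self)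
      ultimately obtain k' where k': "k' \<in> K" "t \<otimes> g = k' \<otimes> (t \<otimes> r)"
        unfolding r_coset_def by auto
      have k'c: "k' \<in> carrier G" using k' KG by blast
      have "y \<otimes> (g \<otimes> inv r) \<otimes> inv y = k \<otimes> (t \<otimes> g) \<otimes> inv r \<otimes> inv t \<otimes> inv k"
        using tc c tk(3) by (simp add: m_assoc inv_mult_group)
      also have "\<dots> = k \<otimes> k' \<otimes> inv k"
        unfolding k'(2) using tc c k'c by (simp add: m_assoc)
      also have "\<dots> \<in> K" using tk k' K by (simp add: subgroup.m_closed subgroup.m_inv_closed)
      finally show "y \<otimes> (g \<otimes> inv r) \<otimes> inv y \<in> K" .
    qed
    moreover have "g = (g \<otimes> inv r) \<otimes> r" using c by (simp add: m_assoc)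
    ultimately show ?thesis using r(1) by blast
  qed
  then show ?thesis using R by blast
qed

text \<open>Adjoining one more element \<open>a\<close> to a subgroup that contains all commutators: the products
  \<open>j \<otimes> a [^] n\<close> already form a subgroup, and only \<open>e\<close> exponents are needed.\<close>

lemma adjoin_element_modulo_commutators:
  assumes C: "subgroup C G" and J: "subgroup J G" and JC: "J \<subseteq> C"
    and comm: "\<And>x y. \<lbrakk>x \<in> C; y \<in> C\<rbrakk> \<Longrightarrow> x \<otimes> y \<otimes> inv x \<otimes> inv y \<in> J"
    and a: "a \<in> C" and e: "e > 0" "a [^] (e::nat) \<in> J"
  shows "subgroup {j \<otimes> a [^] n | j n. j \<in> J \<and> n < e} G" (is "subgroup ?J G")
    and "a \<in> {j \<otimes> a [^] n | j n. j \<in> J \<and> n < e}"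
    and "J \<subseteq> {j \<otimes> a [^] n | j n. j \<in> J \<and> n < e}"
proof -
  have CG: "C \<subseteq> carrier G" and JG: "J \<subseteq> carrier G" using C J subgroup.subset by blast+
  have ac: "a \<in> carrier G" using a CG by blast
  have pw: "a [^] (n::nat) \<in> C" for n using subgroup_nat_pow_closed[OF C a] .
  have conj: "x \<otimes> j \<otimes> inv x \<in> J" if "x \<in> C" "j \<in> J" for x j
  proof -
    have "x \<otimes> j \<otimes> inv x \<otimes> inv j \<otimes> j \<in> J"
      using comm[of x j] that JC J by (meson subgroup.m_closed subsetD)
    moreover have "x \<otimes> j \<otimes> inv x \<otimes> inv j \<otimes> j = x \<otimes> j \<otimes> inv x"
      using that CG JG by (simp add: subset_iff m_assoc)
    ultimately show ?thesis by simp
  qed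
  have inJ: "j \<otimes> a [^] (n::nat) \<in> ?J" if "j \<in> J" for j n
  proof -
    have "a [^] n = a [^] (e * (n div e) + n mod e)" by simp
    also have "\<dots> = (a [^] e) [^] (n div e) \<otimes> a [^] (n mod e)"
      using ac by (simp only: nat_pow_mult[symmetric] nat_pow_pow[symmetric])
    finally have "j \<otimes> a [^] n = (j \<otimes> (a [^] e) [^] (n div e)) \<otimes> a [^] (n mod e)"
      using ac that JG by (simp add: m_assoc subset_iff)
    moreover have "j \<otimes> (a [^] e) [^] (n div e) \<in> J"
      using that subgroup_nat_pow_closed[OF J e(2)] J by (simp add: subgroup.m_closed)
    ultimately show ?thesis using e(1) by (auto intro!: exI[of _ "n mod e"])
  qed
  have cl: "j \<in> J \<Longrightarrow> j \<in> carrier G" for j using JG by blast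
  show "J \<subseteq> ?J"
    using inJ[where n = 0] cl by force
  show "a \<in> ?J"
    using inJ[OF subgroup.one_closed[OF J], of 1] ac by simp
  show "subgroup ?J G"
  proof (rule subgroupI)
    show "?J \<subseteq> carrier G" using JG ac by auto
    show "?J \<noteq> {}" using \<open>a \<in> ?J\<close> by blast
  next
    fix x assume "x \<in> ?J"
    then obtain j n where x: "x = j \<otimes> a [^] n" "j \<in> J" "n < e" by blast
    let ?b = "inv (a [^] n)"
    have b: "?b = inv ((a [^] e) [^] n) \<otimes> a [^] (e * n - n)"
    proof -
      have "(a [^] e) [^] n = a [^] (e * n - n) \<otimes> a [^] n"
        using ac e(1) by (simp add: nat_pow_mult nat_pow_pow)
      then show ?thesis using ac by (simp add: inv_mult_group m_assoc)
    qed
    have "inv x = ?b \<otimes> inv j" using x cl ac by (simp add: inv_mult_group)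
    also have "\<dots> = (?b \<otimes> inv j \<otimes> inv ?b) \<otimes> ?b" using x cl ac by (simp add: m_assoc)
    also have "\<dots> = ((?b \<otimes> inv j \<otimes> inv ?b) \<otimes> inv ((a [^] e) [^] n)) \<otimes> a [^] (e * n - n)"
      using x cl ac by (subst (3) b) (simp add: m_assoc)
    also have "\<dots> \<in> ?J"
    proof (rule inJ)
      have "?b \<otimes> inv j \<otimes> inv ?b \<in> J"
        using conj[of ?b "inv j"] pw x C J by (simp add: subgroup.m_inv_closed)
      moreover have "inv ((a [^] e) [^] n) \<in> J"
        using subgroup_nat_pow_closed[OF J e(2)] J by (simp add: subgroup.m_inv_closed)
      ultimately show "(?b \<otimes> inv j \<otimes> inv ?b) \<otimes> inv ((a [^] e) [^] n) \<in> J"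
        using J by (simp add: subgroup.m_closed)
    qed
    finally show "inv x \<in> ?J" .
  next
    fix x y assume "x \<in> ?J" "y \<in> ?J"
    then obtain j k and n p :: nat where x: "x = j \<otimes> a [^] n" "j \<in> J"
      and y: "y = k \<otimes> a [^] p" "k \<in> J" by blast
    have "x \<otimes> y = (j \<otimes> (a [^] n \<otimes> k \<otimes> inv (a [^] n))) \<otimes> (a [^] n \<otimes> a [^] p)"
      using x y cl ac by (simp add: m_assoc) (simp add: m_assoc[symmetric])
    also have "\<dots> = (j \<otimes> (a [^] n \<otimes> k \<otimes> inv (a [^] n))) \<otimes> a [^] (n + p)"
      using ac by (simp add: nat_pow_mult)
    also have "\<dots> \<in> ?J" using inJ conj[OF pw y(2)] x J by (simp add: subgroup.m_closed)
    finally show "x \<otimes> y \<in> ?J" .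
  qed
qed

text \<open>An abelian group of exponent \<open>e\<close> with \<open>d\<close> generators has at most \<open>e ^ d\<close> elements, here
  for the quotient of \<open>C\<close> by a subgroup \<open>B\<close> above its derived subgroup.\<close>

lemma abelian_quotient_transversal:
  assumes C: "subgroup C G" and B: "subgroup B G" and BC: "B \<subseteq> C"
    and comm: "\<And>x y. \<lbrakk>x \<in> C; y \<in> C\<rbrakk> \<Longrightarrow> x \<otimes> y \<otimes> inv x \<otimes> inv y \<in> B"
    and e: "e > 0" "\<And>a. a \<in> C \<Longrightarrow> a [^] (e::nat) \<in> B"
    and A: "finite A" "C = generate G A"
  shows "\<exists>T\<subseteq>C. finite T \<and> card T \<le> e ^ card A \<and> (\<forall>c\<in>C. \<exists>t\<in>T. \<exists>b\<in>B. c = b \<otimes> t)"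
proof -
  have CG: "C \<subseteq> carrier G" and BG: "B \<subseteq> carrier G" using C B subgroup.subset by blast+
  have AC: "A \<subseteq> C" using A(2) by (auto intro: generate.incl)
  have "\<exists>T\<subseteq>C. finite T \<and> card T \<le> e ^ card A' \<and> subgroup {b \<otimes> t | b t. b \<in> B \<and> t \<in> T} G \<and>
      A' \<union> B \<subseteq> {b \<otimes> t | b t. b \<in> B \<and> t \<in> T}" if "A' \<subseteq> A" for A'
    using finite_subset[OF that A(1)] that
  proof (induction A' rule: finite_induct)
    case empty
    have "{b \<otimes> t | b t. b \<in> B \<and> t \<in> {\<one>}} = B" using BG by force
    then show ?case using B C
      by (intro exI[of _ "{\<one>}"]) (simp add: subgroup.one_closed)
  next
    case (insert a A')
    then obtain T where T: "T \<subseteq> C" "finite T" "card T \<le> e ^ card A'"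
      and J: "subgroup {b \<otimes> t | b t. b \<in> B \<and> t \<in> T} G"
      and AJ: "A' \<union> B \<subseteq> {b \<otimes> t | b t. b \<in> B \<and> t \<in> T}" by auto
    define J where "J = {b \<otimes> t | b t. b \<in> B \<and> t \<in> T}"
    have aC: "a \<in> C" using insert.prems AC by blast
    have JC: "J \<subseteq> C" unfolding J_def using BC T(1) C by (auto simp: subset_iff subgroup.m_closed)
    have BJ: "B \<subseteq> J" using AJ unfolding J_def by blast
    note adj = adjoin_element_modulo_commutators[OF C J[folded J_def] JC _ aC e(1)]
    have 1: "x \<otimes> y \<otimes> inv x \<otimes> inv y \<in> J" if "x \<in> C" "y \<in> C" for x y
      using comm[OF that] BJ by blast
    have 2: "a [^] e \<in> J" using e(2)[OF aC] BJ by blast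
    define T' where "T' = (\<lambda>(t, n). t \<otimes> a [^] n) ` (T \<times> {..<e})"
    have pw: "a [^] (n::nat) \<in> C" for n using subgroup_nat_pow_closed[OF C aC] .
    have eq: "{b \<otimes> t | b t. b \<in> B \<and> t \<in> T'} = {j \<otimes> a [^] n | j n. j \<in> J \<and> n < e}"
    proof -
      have as: "b \<otimes> (t \<otimes> a [^] n) = b \<otimes> t \<otimes> a [^] n" if "b \<in> B" "t \<in> T" for b t and n :: nat
        using that BG T(1) CG pw by (simp add: m_assoc subset_iff)
      show ?thesis
      proof (intro equalityI subsetI)
        fix x assume "x \<in> {b \<otimes> t | b t. b \<in> B \<and> t \<in> T'}"
        then obtain b t n where "b \<in> B" "t \<in> T" "n < e" "x = b \<otimes> (t \<otimes> a [^] n)"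
          unfolding T'_def by auto
        then show "x \<in> {j \<otimes> a [^] n | j n. j \<in> J \<and> n < e}" unfolding J_def using as by blast
      next
        fix x assume "x \<in> {j \<otimes> a [^] n | j n. j \<in> J \<and> n < e}"
        then obtain b t n where x: "b \<in> B" "t \<in> T" "n < e" "x = b \<otimes> t \<otimes> a [^] n"
          unfolding J_def by auto
        then have "t \<otimes> a [^] n \<in> T'" unfolding T'_def by auto
        moreover have "x = b \<otimes> (t \<otimes> a [^] n)" using x as by simp
        ultimately show "x \<in> {b \<otimes> t | b t. b \<in> B \<and> t \<in> T'}" using x(1) by blast
      qed
    qed
    have "card T' \<le> card (T \<times> {..<e})" unfolding T'_def using T(2) by (intro card_image_le) auto
    also have "\<dots> = card T * e" by (simp add: card_cartesian_product)
    also have "\<dots> \<le> e ^ card A' * e" using T(3) by (rule mult_right_mono) simp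
    also have "\<dots> = e ^ card (insert a A')" using insert.hyps by simp
    finally have cardT': "card T' \<le> e ^ card (insert a A')" .
    have "T' \<subseteq> C" unfolding T'_def using T(1) pw C by (auto simp: subset_iff subgroup.m_closed)
    moreover have "finite T'" unfolding T'_def using T(2) by simp
    moreover have "insert a A' \<union> B \<subseteq> {b \<otimes> t | b t. b \<in> B \<and> t \<in> T'}"
      unfolding eq using adj(2,3)[OF 1 2] AJ unfolding J_def[symmetric] by blast
    ultimately show ?case using cardT' adj(1)[OF 1 2] eq by (intro exI[of _ T']) simp
  qed
  from this[OF subset_refl] obtain T where T: "T \<subseteq> C" "finite T" "card T \<le> e ^ card A"
    and J: "subgroup {b \<otimes> t | b t. b \<in> B \<and> t \<in> T} G"
    and AJ: "A \<union> B \<subseteq> {b \<otimes> t | b t. b \<in> B \<and> t \<in> T}" by auto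
  have "C \<subseteq> {b \<otimes> t | b t. b \<in> B \<and> t \<in> T}"
    unfolding A(2) using generate_subgroup_incl[OF _ J] AJ by blast
  then show ?thesis using T by (intro exI[of _ T]) blast
qed

end

section \<open>Automorphisms of the tree as functions\<close>

declare Aut_tree_simps(1) [simp del]

abbreviation Aut :: "('a list \<Rightarrow> 'a list) set" where
  "Aut \<equiv> carrier Aut_tree"

text \<open>Elements of the group are handled as functions under composition. This is the opposite of the
  multiplication of \<open>Aut_tree\<close>, with the same subgroups and the same inverses.\<close>

abbreviation ginv :: "('a list \<Rightarrow> 'a list) \<Rightarrow> 'a list \<Rightarrow> 'a list" where
  "ginv g \<equiv> inv_into UNIV g"

interpretation Aut_group: group Aut_tree by (rule group_Aut_tree)

lemma Aut_bij: "g \<in> Aut \<Longrightarrow> bij g" and Aut_root: "g \<in> Aut \<Longrightarrow> g [] = []"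
  by (simp_all add: Aut_tree_simps(1))

lemma Aut_id [simp]: "id \<in> Aut"
  using Aut_group.one_closed by simp

lemma Aut_comp [simp]: "\<lbrakk>g \<in> Aut; h \<in> Aut\<rbrakk> \<Longrightarrow> g \<circ> h \<in> Aut"
  using Aut_group.m_closed[of h g] by simp

lemma ginv_left [simp]: "g \<in> Aut \<Longrightarrow> ginv g (g w) = w"
  by (simp add: Aut_bij bij_is_inj)

lemma ginv_right [simp]: "g \<in> Aut \<Longrightarrow> g (ginv g w) = w"
  by (simp add: Aut_bij bij_is_surj surj_f_inv_f)

lemma m_inv_Aut: "g \<in> Aut \<Longrightarrow> m_inv Aut_tree g = ginv g"
proof -
  assume g: "g \<in> Aut"
  then have "m_inv Aut_tree g \<otimes>\<^bsub>Aut_tree\<^esub> g = \<one>\<^bsub>Aut_tree\<^esub>" by (rule Aut_group.l_inv)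
  then have "g (m_inv Aut_tree g w) = w" for w by (simp add: fun_eq_iff)
  then have "m_inv Aut_tree g w = ginv g w" for w using g by (metis ginv_left)
  then show ?thesis by (simp add: fun_eq_iff)
qed

lemma Aut_ginv [simp]: "g \<in> Aut \<Longrightarrow> ginv g \<in> Aut"
  using Aut_group.inv_closed[of g] by (simp add: m_inv_Aut)

lemma ginv_comp_left [simp]: "g \<in> Aut \<Longrightarrow> ginv g \<circ> g = id"
  and ginv_comp_right [simp]: "g \<in> Aut \<Longrightarrow> g \<circ> ginv g = id"
  by (auto simp: fun_eq_iff)

lemma ginv_eqI: "\<lbrakk>g \<in> Aut; \<And>w. g (h w) = w\<rbrakk> \<Longrightarrow> ginv g = h"
  by (metis ginv_left ext)

lemma ginv_comp: "\<lbrakk>g \<in> Aut; h \<in> Aut\<rbrakk> \<Longrightarrow> ginv (g \<circ> h) = ginv h \<circ> ginv g"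
  by (rule ginv_eqI) auto

lemma ginv_ginv [simp]: "g \<in> Aut \<Longrightarrow> ginv (ginv g) = g"
  by (rule ginv_eqI) auto

lemma ginv_id [simp]: "ginv id = id"
  by (rule ginv_eqI) auto

lemma
  assumes "subgroup H Aut_tree"
  shows sub_id: "id \<in> H"
    and sub_comp: "\<lbrakk>g \<in> H; h \<in> H\<rbrakk> \<Longrightarrow> g \<circ> h \<in> H"
    and sub_ginv: "g \<in> H \<Longrightarrow> ginv g \<in> H"
    and sub_Aut: "g \<in> H \<Longrightarrow> g \<in> Aut"
proof -
  show "id \<in> H" using subgroup.one_closed[OF assms] by simp
  show "\<lbrakk>g \<in> H; h \<in> H\<rbrakk> \<Longrightarrow> g \<circ> h \<in> H" using subgroup.m_closed[OF assms, of h g] by simp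
  show A: "g \<in> H \<Longrightarrow> g \<in> Aut" for g using subgroup.subset[OF assms] by blast
  show "g \<in> H \<Longrightarrow> ginv g \<in> H" using subgroup.m_inv_closed[OF assms, of g] A by (simp add: m_inv_Aut)
qed

lemma subgroup_AutI:
  assumes "H \<subseteq> Aut" "id \<in> H" "\<And>g h. \<lbrakk>g \<in> H; h \<in> H\<rbrakk> \<Longrightarrow> g \<circ> h \<in> H" "\<And>g. g \<in> H \<Longrightarrow> ginv g \<in> H"
  shows "subgroup H Aut_tree"
  by (rule Aut_group.subgroupI) (use assms in \<open>auto simp: m_inv_Aut subset_iff\<close>)

lemma Aut_child: "g \<in> Aut \<Longrightarrow> \<exists>y. g (v @ [x]) = g v @ [y]"
  by (rule Aut_tree_child)

lemma AutI:
  assumes b: "bij g" and r: "g [] = []" and ch: "\<And>v x. \<exists>y. g (v @ [x]) = g v @ [y]"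
  shows "g \<in> Aut"
proof -
  have len: "length (g v) = length v" for v
  proof (induction v rule: rev_induct)
    case (snoc x v) then show ?case using ch[of v x] by auto
  qed (use r in simp)
  have 1: "\<exists>x. v = u @ [x]" if "g v = g u @ [x]" for u v x
  proof -
    have "v \<noteq> []" using that r by auto
    then obtain v' z where v: "v = v' @ [z]" by (metis rev_exhaust)
    then have "g v' = g u" using ch[of v' z] that by auto
    then have "v' = u" using b by (auto simp: bij_def inj_def)
    then show ?thesis using v by blast
  qed
  have "adjacent (g u) (g v) \<longleftrightarrow> adjacent u v" for u v
    unfolding adjacent_def using 1[of v u] 1[of u v] ch by metis
  then show ?thesis using b r by (simp add: Aut_tree_simps(1))
qed

lemma Aut_length: "g \<in> Aut \<Longrightarrow> length (g v) = length v"
  by (rule length_Aut_tree)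

lemma Aut_append: "g \<in> Aut \<Longrightarrow> g (v @ u) = g v @ section_at g v u"
  by (rule section_append)

lemma Aut_inj: "g \<in> Aut \<Longrightarrow> g u = g w \<longleftrightarrow> u = w"
  by (metis ginv_left)

lemma Aut_prefix_mono: "\<lbrakk>g \<in> Aut; prefix u w\<rbrakk> \<Longrightarrow> prefix (g u) (g w)"
  unfolding prefix_def by (metis Aut_append)

lemma Aut_prefix: "g \<in> Aut \<Longrightarrow> prefix (g u) (g w) \<longleftrightarrow> prefix u w"
  using Aut_prefix_mono[of g u w] Aut_prefix_mono[of "ginv g" "g u" "g w"] by auto

lemma section_comp:
  assumes "g \<in> Aut" "h \<in> Aut"
  shows "section_at (g \<circ> h) v = section_at g (h v) \<circ> section_at h v"
proof
  fix u
  have "(g \<circ> h) (v @ u) = (g \<circ> h) v @ (section_at g (h v) \<circ> section_at h v) u"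
    using assms by (simp add: Aut_append[OF assms(1)] Aut_append[OF assms(2)])
  then show "section_at (g \<circ> h) v u = (section_at g (h v) \<circ> section_at h v) u"
    using Aut_append[OF Aut_comp[OF assms], of v u] by simp
qed

lemma section_id [simp]: "section_at id v = id"
  by (simp add: section_at_def fun_eq_iff)

lemma section_Aut [simp]:
  assumes g: "g \<in> Aut"
  shows "section_at g v \<in> Aut"
proof (rule AutI)
  have 1: "section_at (ginv g) (g v) \<circ> section_at g v = id"
    using section_comp[of "ginv g" g v] g by simp
  have "section_at g (ginv g (g v)) \<circ> section_at (ginv g) (g v) = id"
    using section_comp[of g "ginv g" "g v"] g by (simp del: ginv_left)
  then have 2: "section_at g v \<circ> section_at (ginv g) (g v) = id" using g by simp
  show "bij (section_at g v)" by (rule o_bij[OF 1 2])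
  show "section_at g v [] = []" using Aut_append[OF g, of v "[]"] by simp
  fix w x
  obtain y where "g ((v @ w) @ [x]) = g (v @ w) @ [y]" using Aut_child[OF g] by blast
  then show "\<exists>y. section_at g v (w @ [x]) = section_at g v w @ [y]"
    using Aut_append[OF g, of v w] Aut_append[OF g, of v "w @ [x]"] by auto
qed

definition agree :: "nat \<Rightarrow> ('a list \<Rightarrow> 'a list) \<Rightarrow> ('a list \<Rightarrow> 'a list) \<Rightarrow> bool" where
  "agree n g h \<longleftrightarrow> (\<forall>w\<in>level n. g w = h w)"

lemma agree_refl [simp]: "agree n g g" and agree_sym: "agree n g h \<Longrightarrow> agree n h g"
  and agree_trans: "\<lbrakk>agree n g h; agree n h k\<rbrakk> \<Longrightarrow> agree n g k"
  by (auto simp: agree_def)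

lemma agree_short:
  assumes "g \<in> Aut" "h \<in> Aut" "agree n g h" "length w \<le> n"
  shows "g w = h w"
proof -
  obtain u :: "'a list" where "length u = n - length w" using Ex_list_of_length by blast
  then have "w @ u \<in> level n" using assms by (simp add: level_def)
  then have "g (w @ u) = h (w @ u)" using assms by (simp add: agree_def)
  then have "g w @ section_at g w u = h w @ section_at h w u"
    by (simp only: Aut_append[OF assms(1)] Aut_append[OF assms(2)])
  moreover have "length (g w) = length (h w)"
    by (simp only: Aut_length[OF assms(1)] Aut_length[OF assms(2)])
  ultimately show ?thesis by (metis append_eq_append_conv)
qed

lemma agree_le: "\<lbrakk>g \<in> Aut; h \<in> Aut; agree n g h; k \<le> n\<rbrakk> \<Longrightarrow> agree k g h"
  unfolding agree_def[of k] level_def by (blast intro: agree_short)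

lemma agree_comp:
  assumes "g \<in> Aut" "h \<in> Aut" "g' \<in> Aut" "h' \<in> Aut" "agree n g g'" "agree n h h'"
  shows "agree n (g \<circ> h) (g' \<circ> h')"
  unfolding agree_def
proof
  fix w :: "'a list" assume w: "w \<in> level n"
  then have "h w = h' w" using assms by (simp add: agree_def)
  moreover have "h' w \<in> level n" using w Aut_length[OF assms(4)] by (simp add: level_def)
  ultimately show "(g \<circ> h) w = (g' \<circ> h') w" using assms by (simp add: agree_def)
qed

lemma agree_ginv:
  assumes "g \<in> Aut" "h \<in> Aut" "agree n g h"
  shows "agree n (ginv g) (ginv h)"
  unfolding agree_def
proof
  fix w :: "'a list" assume w: "w \<in> level n"
  then have "ginv h w \<in> level n" using Aut_length[OF Aut_ginv[OF assms(2)]] by (simp add: level_def)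
  then have "g (ginv h w) = w" using assms by (simp add: agree_def)
  then show "ginv g w = ginv h w" using assms(1) by (metis ginv_left)
qed

lemma St_iff_agree: "g \<in> St n \<longleftrightarrow> g \<in> Aut \<and> agree n g id"
  by (simp add: St_def agree_def)

lemma finite_level [simp]: "finite (level n :: 'a::finite list set)"
  using finite_lists_length_eq[of "UNIV :: 'a set" n] unfolding level_def by simp

lemma card_level: "card (level n :: 'a::finite list set) = CARD('a) ^ n"
  using card_lists_length_eq[of "UNIV :: 'a set" n] unfolding level_def by simp

lemma finite_restrict_level:
  fixes B :: "('a::finite list \<Rightarrow> 'a list) set"
  assumes "\<And>a. a \<in> B \<Longrightarrow> a \<in> Aut"
  shows "finite ((\<lambda>a. restrict a (level n)) ` B)"
proof -
  have "(\<lambda>a. restrict a (level n)) ` B \<subseteq> level n \<rightarrow>\<^sub>E level n"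
    by (intro image_subsetI PiE_I) (simp_all add: level_def Aut_length[OF assms])
  then show ?thesis by (rule finite_subset) (simp add: finite_PiE)
qed

subsection \<open>Prescribing the action below an antichain of vertices\<close>

definition antichain :: "'a list set \<Rightarrow> bool" where
  "antichain U \<longleftrightarrow> (\<forall>u\<in>U. \<forall>v\<in>U. prefix u v \<longrightarrow> u = v)"

text \<open>The function that acts as \<open>f u\<close> on the subtree below each vertex \<open>u\<close> of the antichain \<open>U\<close>
  and fixes everything else. Infinite antichains are allowed: they give the elements of the
  closure of \<open>G\<close> from which the subgroups of prescribed dimension are generated.\<close>

definition spread :: "'a list set \<Rightarrow> ('a list \<Rightarrow> 'a list \<Rightarrow> 'a list) \<Rightarrow> 'a list \<Rightarrow> 'a list" where
  "spread U f w =
     (if \<exists>u\<in>U. prefix u w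
      then let u = THE u. u \<in> U \<and> prefix u w in u @ f u (drop (length u) w) else w)"

abbreviation lift :: "'a list \<Rightarrow> ('a list \<Rightarrow> 'a list) \<Rightarrow> 'a list \<Rightarrow> 'a list" where
  "lift v g \<equiv> spread {v} (\<lambda>_. g)"

lemma antichain_unique:
  assumes "antichain U" "u \<in> U" "v \<in> U" "prefix u w" "prefix v w"
  shows "u = v"
  using assms prefix_same_cases[of u w v] unfolding antichain_def by blast

lemma antichain_subset: "\<lbrakk>antichain U; U' \<subseteq> U\<rbrakk> \<Longrightarrow> antichain U'"
  by (auto simp: antichain_def)

lemma antichain_singleton [simp]: "antichain {v}"
  by (simp add: antichain_def)

lemma antichain_level: "antichain (level n)"
  by (auto simp: antichain_def level_def prefix_def)

lemma spread_below:
  assumes "antichain U" "u \<in> U"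
  shows "spread U f (u @ z) = u @ f u z"
proof -
  have "(THE v. v \<in> U \<and> prefix v (u @ z)) = u"
    using assms by (intro the_equality) (auto intro: antichain_unique[of U _ u "u @ z"])
  moreover have "\<exists>v\<in>U. prefix v (u @ z)" using assms(2) by (intro bexI[of _ u]) simp_all
  ultimately show ?thesis by (simp add: spread_def Let_def)
qed

lemma spread_off: "\<not> (\<exists>u\<in>U. prefix u w) \<Longrightarrow> spread U f w = w"
  unfolding spread_def by (rule if_not_P)

lemma lift_below [simp]: "lift v g (v @ z) = v @ g z"
  by (simp add: spread_below)

lemma lift_off: "\<not> prefix v w \<Longrightarrow> lift v g w = w"
  by (rule spread_off) simp

lemma spread_cases:
  obtains u z where "u \<in> U" "w = u @ z" | "\<not> (\<exists>u\<in>U. prefix u w)"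
  by (auto simp: prefix_def)

lemma spread_eqI:
  assumes "antichain U" "\<And>u z. u \<in> U \<Longrightarrow> g (u @ z) = u @ f u z"
    and "\<And>w. \<not> (\<exists>u\<in>U. prefix u w) \<Longrightarrow> g w = w"
  shows "spread U f = g"
proof
  fix w show "spread U f w = g w"
    by (rule spread_cases[of U w]) (use assms in \<open>auto simp: spread_below spread_off\<close>)
qed

lemma spread_comp:
  assumes "antichain U"
  shows "spread U f \<circ> spread U g = spread U (\<lambda>u. f u \<circ> g u)"
  by (rule spread_eqI[symmetric, OF assms]) (use assms in \<open>auto simp: spread_below spread_off\<close>)

lemma spread_id: "antichain U \<Longrightarrow> spread U (\<lambda>_. id) = id"
  by (rule spread_eqI) auto

lemma spread_cong: "\<lbrakk>antichain U; \<And>u. u \<in> U \<Longrightarrow> f u = g u\<rbrakk> \<Longrightarrow> spread U f = spread U g"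
  by (rule spread_eqI) (auto simp: spread_below spread_off)

lemma spread_subset:
  assumes U: "antichain U" and U': "U' \<subseteq> U" and f: "\<And>u. u \<in> U - U' \<Longrightarrow> f u = id"
  shows "spread U' f = spread U f"
proof (rule spread_eqI[symmetric, OF U])
  have a: "antichain U'" by (rule antichain_subset[OF U U'])
  fix u z assume u: "u \<in> U"
  show "spread U' f (u @ z) = u @ f u z"
  proof (cases "u \<in> U'")
    case True then show ?thesis using a by (simp add: spread_below)
  next
    case False
    then have "\<not> (\<exists>v\<in>U'. prefix v (u @ z))"
      using antichain_unique[OF U _ u, of _ "u @ z"] U' by auto
    then show ?thesis using f[of u] u False by (simp add: spread_off)
  qed
next
  fix w assume "\<not> (\<exists>u\<in>U. prefix u w)"
  then show "spread U' f w = w" using U' by (intro spread_off) blast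
qed

lemma spread_union:
  assumes U: "antichain (U1 \<union> U2)" and d: "U1 \<inter> U2 = {}"
  shows "spread (U1 \<union> U2) f = spread U1 f \<circ> spread U2 f"
proof -
  let ?f1 = "\<lambda>u. if u \<in> U1 then f u else id" and ?f2 = "\<lambda>u. if u \<in> U2 then f u else id"
  have a: "antichain U1" "antichain U2" using antichain_subset[OF U] by auto
  have "spread U1 f = spread U1 ?f1" by (rule spread_cong[OF a(1)]) simp
  also have "\<dots> = spread (U1 \<union> U2) ?f1" by (rule spread_subset[OF U]) auto
  finally have 1: "spread U1 f = spread (U1 \<union> U2) ?f1" .
  have "spread U2 f = spread U2 ?f2" by (rule spread_cong[OF a(2)]) simp
  also have "\<dots> = spread (U1 \<union> U2) ?f2" by (rule spread_subset[OF U]) auto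
  finally have 2: "spread U2 f = spread (U1 \<union> U2) ?f2" .
  show ?thesis unfolding 1 2 spread_comp[OF U]
    by (rule spread_cong[OF U]) (use d in auto)
qed

lemma spread_insert:
  assumes "antichain (insert v U)" "v \<notin> U"
  shows "spread (insert v U) f = lift v (f v) \<circ> spread U f"
proof -
  have "spread (insert v U) f = spread {v} f \<circ> spread U f"
    using spread_union[of "{v}" U f] assms by simp
  also have "spread {v} f = lift v (f v)" by (rule spread_cong) auto
  finally show ?thesis .
qed

lemma spread_Aut:
  assumes U: "antichain U" and f: "\<And>u. u \<in> U \<Longrightarrow> f u \<in> Aut"
  shows "spread U f \<in> Aut"
proof (rule AutI)
  have 1: "spread U (\<lambda>u. ginv (f u)) \<circ> spread U f = id"
    using spread_cong[OF U, of "\<lambda>u. ginv (f u) \<circ> f u" "\<lambda>_. id"] f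
    by (simp add: spread_comp[OF U] spread_id[OF U])
  have 2: "spread U f \<circ> spread U (\<lambda>u. ginv (f u)) = id"
    using spread_cong[OF U, of "\<lambda>u. f u \<circ> ginv (f u)" "\<lambda>_. id"] f
    by (simp add: spread_comp[OF U] spread_id[OF U])
  show "bij (spread U f)" by (rule o_bij[OF 1 2])
  show "spread U f [] = []"
  proof (cases "[] \<in> U")
    case True
    then show ?thesis using spread_below[OF U True, of f "[]"] Aut_root[OF f[OF True]] by simp
  qed (simp add: spread_off)
  fix v x
  show "\<exists>y. spread U f (v @ [x]) = spread U f v @ [y]"
  proof (cases rule: spread_cases[of U v])
    case (1 u z)
    obtain y where "f u (z @ [x]) = f u z @ [y]" using Aut_child[OF f[OF 1(1)]] by blast
    then show ?thesis using 1 spread_below[OF U 1(1), of f z] spread_below[OF U 1(1), of f "z @ [x]"]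
      by simp
  next
    case 2
    show ?thesis
    proof (cases "v @ [x] \<in> U")
      case True
      then show ?thesis using spread_below[OF U True, of f "[]"] Aut_root[OF f[OF True]] 2
        by (simp add: spread_off)
    next
      case False
      then have "\<not> (\<exists>u\<in>U. prefix u (v @ [x]))" using 2 by (auto simp: prefix_snoc)
      then show ?thesis using 2 by (simp add: spread_off)
    qed
  qed
qed

lemma ginv_spread:
  assumes U: "antichain U" and f: "\<And>u. u \<in> U \<Longrightarrow> f u \<in> Aut"
  shows "ginv (spread U f) = spread U (\<lambda>u. ginv (f u))"
proof (rule ginv_eqI[OF spread_Aut[OF U f]])
  fix w
  have "spread U f \<circ> spread U (\<lambda>u. ginv (f u)) = id"
    using spread_cong[OF U, of "\<lambda>u. f u \<circ> ginv (f u)" "\<lambda>_. id"] f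
    by (simp add: spread_comp[OF U] spread_id[OF U])
  then show "spread U f (spread U (\<lambda>u. ginv (f u)) w) = w" by (simp add: fun_eq_iff)
qed

lemma lift_Aut [simp]: "g \<in> Aut \<Longrightarrow> lift v g \<in> Aut"
  by (rule spread_Aut) auto

lemma lift_comp: "lift v g \<circ> lift v h = lift v (g \<circ> h)"
  by (simp add: spread_comp)

lemma lift_id [simp]: "lift v id = id"
  by (simp add: spread_id)

lemma ginv_lift: "g \<in> Aut \<Longrightarrow> ginv (lift v g) = lift v (ginv g)"
  by (simp add: ginv_spread)

lemma lift_root: "lift [] g = g"
  by (rule spread_eqI) auto

lemma lift_lift: "lift v (lift u g) = lift (v @ u) g"
proof (rule spread_eqI)
  fix x z assume "x \<in> {v}"
  then have x: "x = v" by simp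
  show "lift (v @ u) g (x @ z) = x @ lift u g z"
  proof (cases rule: spread_cases[of "{u}" z])
    case (1 y z') then show ?thesis using x lift_below[of "v @ u" g z'] by simp
  next
    case 2 then show ?thesis using x by (simp add: lift_off)
  qed
next
  fix w assume "\<not> (\<exists>x\<in>{v}. prefix x w)"
  then have "\<not> prefix (v @ u) w" by (auto simp: prefix_def)
  then show "lift (v @ u) g w = w" by (rule lift_off)
qed simp

text \<open>Finite antichains give products, so membership in a subgroup can be tested on the factors.\<close>

lemma spread_finite_in_subgroup:
  assumes H: "subgroup H Aut_tree" and U: "finite U" "antichain U"
    and f: "\<And>u. u \<in> U \<Longrightarrow> lift u (f u) \<in> H"
  shows "spread U f \<in> H"
  using U f
proof (induction U rule: finite_induct)
  case empty
  have e: "spread {} f = id" by (auto simp: fun_eq_iff spread_off)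
  show ?case unfolding e by (rule sub_id[OF H])
next
  case (insert v U)
  have "antichain U" using insert.prems(1) by (rule antichain_subset) auto
  then have "spread U f \<in> H" by (rule insert.IH) (rule insert.prems(2), simp)
  moreover have "lift v (f v) \<in> H" by (rule insert.prems(2)) simp
  ultimately show ?case
    unfolding spread_insert[OF insert.prems(1) insert.hyps(2)] by (intro sub_comp[OF H])
qed

lemma conj_lift:
  assumes k: "k \<in> Aut"
  shows "k \<circ> lift u g \<circ> ginv k = lift (k u) (section_at k u \<circ> g \<circ> ginv (section_at k u))"
    (is "_ = lift _ ?g")
proof -
  have "k \<circ> lift u g = lift (k u) ?g \<circ> k"
  proof
    fix w
    show "(k \<circ> lift u g) w = (lift (k u) ?g \<circ> k) w"
    proof (cases rule: spread_cases[of "{u}" w])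
      case (1 u' z)
      then show ?thesis using k by (simp add: Aut_append[OF k])
    next
      case 2
      then show ?thesis by (simp add: lift_off Aut_prefix[OF k])
    qed
  qed
  then have "k \<circ> lift u g \<circ> ginv k = lift (k u) ?g \<circ> (k \<circ> ginv k)"
    by (simp only: comp_assoc)
  then show ?thesis by (simp only: ginv_comp_right[OF k] comp_id)
qed

section \<open>The congruence topology\<close>

lemma coset_St:
  assumes "g \<in> Aut"
  shows "St n #>\<^bsub>Aut_tree\<^esub> g = {h \<in> Aut. agree n g h}"
proof (intro equalityI subsetI)
  fix h assume "h \<in> St n #>\<^bsub>Aut_tree\<^esub> g"
  then obtain s where s: "s \<in> St n" "h = g \<circ> s" by (auto simp: r_coset_def)
  then show "h \<in> {h \<in> Aut. agree n g h}" using assms by (auto simp: St_def agree_def)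
next
  fix h assume "h \<in> {h \<in> Aut. agree n g h}"
  then have h: "h \<in> Aut" "agree n g h" by auto
  have "agree n (ginv g \<circ> h) id" unfolding agree_def
  proof
    fix w :: "'a list" assume "w \<in> level n"
    then have "h w = g w" using h(2) by (simp add: agree_def)
    then show "(ginv g \<circ> h) w = id w" using assms by simp
  qed
  then have "ginv g \<circ> h \<in> St n" using assms h(1) by (simp add: St_iff_agree)
  moreover have "h = (ginv g \<circ> h) \<otimes>\<^bsub>Aut_tree\<^esub> g" using assms by (simp add: fun_eq_iff)
  ultimately show "h \<in> St n #>\<^bsub>Aut_tree\<^esub> g" unfolding r_coset_def by blast
qed

lemma openin_congruence_iff:
  "openin congruence_topology U \<longleftrightarrow> U \<subseteq> Aut \<and> (\<forall>x\<in>U. \<exists>n. {h \<in> Aut. agree n x h} \<subseteq> U)"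
proof
  let ?B = "{St n #>\<^bsub>Aut_tree\<^esub> g | n g. g \<in> Aut} :: ('a list \<Rightarrow> 'a list) set set"
  assume "openin congruence_topology U"
  then have "generate_topology_on ?B U"
    unfolding congruence_topology_def by (rule openin_topology_generated_by)
  then show "U \<subseteq> Aut \<and> (\<forall>x\<in>U. \<exists>n. {h \<in> Aut. agree n x h} \<subseteq> U)"
  proof induction
    case (Int a b)
    show ?case
    proof (intro conjI ballI)
      show "a \<inter> b \<subseteq> Aut" using Int.IH by blast
      fix x assume x: "x \<in> a \<inter> b"
      then have xA: "x \<in> Aut" using Int.IH by blast
      obtain n m where n: "{h \<in> Aut. agree n x h} \<subseteq> a" and m: "{h \<in> Aut. agree m x h} \<subseteq> b"
        using Int.IH x by blast
      have "{h \<in> Aut. agree (max n m) x h} \<subseteq> {h \<in> Aut. agree n x h} \<inter> {h \<in> Aut. agree m x h}"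
        using agree_le[OF xA] by (auto intro: max.cobounded1 max.cobounded2)
      then show "\<exists>k. {h \<in> Aut. agree k x h} \<subseteq> a \<inter> b" using n m by blast
    qed
  next
    case (UN K)
    show ?case
    proof (intro conjI ballI)
      show "\<Union>K \<subseteq> Aut" using UN.IH by blast
      fix x assume "x \<in> \<Union>K"
      then obtain k where k: "k \<in> K" "x \<in> k" by blast
      then obtain n where "{h \<in> Aut. agree n x h} \<subseteq> k" using UN.IH by blast
      then show "\<exists>n. {h \<in> Aut. agree n x h} \<subseteq> \<Union>K" using k by blast
    qed
  next
    case (Basis s)
    then obtain n g where g: "g \<in> Aut" "s = {h \<in> Aut. agree n g h}" using coset_St by blast
    have "{h \<in> Aut. agree n x h} \<subseteq> s" if "x \<in> s" for x
      using that g agree_trans by blast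
    then show ?case using g by blast
  qed simp
next
  let ?B = "{St n #>\<^bsub>Aut_tree\<^esub> g | n g. g \<in> Aut} :: ('a list \<Rightarrow> 'a list) set set"
  assume U: "U \<subseteq> Aut \<and> (\<forall>x\<in>U. \<exists>n. {h \<in> Aut. agree n x h} \<subseteq> U)"
  have "\<exists>T. openin congruence_topology T \<and> x \<in> T \<and> T \<subseteq> U" if x: "x \<in> U" for x
  proof -
    obtain n where n: "{h \<in> Aut. agree n x h} \<subseteq> U" using U x by blast
    have xA: "x \<in> Aut" using U x by blast
    have "openin congruence_topology (St n #>\<^bsub>Aut_tree\<^esub> x)"
      unfolding congruence_topology_def by (rule topology_generated_by_Basis) (use xA in blast)
    then show ?thesis using n xA coset_St[OF xA] by (intro exI[of _ "{h \<in> Aut. agree n x h}"]) auto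
  qed
  then show "openin congruence_topology U" by (subst openin_subopen) blast
qed

lemma topspace_congruence [simp]: "topspace congruence_topology = Aut"
proof
  show "topspace congruence_topology \<subseteq> Aut"
    using openin_congruence_iff[THEN iffD1, OF openin_topspace] by blast
  have "openin congruence_topology Aut" by (auto simp: openin_congruence_iff)
  then show "Aut \<subseteq> topspace congruence_topology" by (rule openin_subset)
qed

lemma closure_iff:
  "x \<in> congruence_topology closure_of A \<longleftrightarrow> x \<in> Aut \<and> (\<forall>n. \<exists>a\<in>A. a \<in> Aut \<and> agree n x a)"
proof
  assume L: "x \<in> congruence_topology closure_of A"
  then have x: "x \<in> Aut" by (simp add: in_closure_of)
  have "\<exists>a\<in>A. a \<in> Aut \<and> agree n x a" for n
  proof -
    have "openin congruence_topology {h \<in> Aut. agree n x h}"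
      unfolding openin_congruence_iff using agree_trans by blast
    moreover have "x \<in> {h \<in> Aut. agree n x h}" using x by simp
    ultimately obtain y where "y \<in> A" "y \<in> {h \<in> Aut. agree n x h}"
      using in_closure_of[THEN iffD1, OF L] by meson
    then show ?thesis by auto
  qed
  then show "x \<in> Aut \<and> (\<forall>n. \<exists>a\<in>A. a \<in> Aut \<and> agree n x a)" using x by blast
next
  assume R: "x \<in> Aut \<and> (\<forall>n. \<exists>a\<in>A. a \<in> Aut \<and> agree n x a)"
  show "x \<in> congruence_topology closure_of A"
    unfolding in_closure_of
  proof (intro conjI allI impI)
    show "x \<in> topspace congruence_topology" using R by simp
    fix T assume "x \<in> T \<and> openin congruence_topology T"
    then obtain n where "{h \<in> Aut. agree n x h} \<subseteq> T" unfolding openin_congruence_iff by blast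
    then show "\<exists>y. y \<in> A \<and> y \<in> T" using R by blast
  qed
qed

lemma subset_closure: "A \<subseteq> Aut \<Longrightarrow> A \<subseteq> congruence_topology closure_of A"
  by (rule closure_of_subset) simp

lemma closure_subgroup:
  assumes H: "subgroup H Aut_tree"
  shows "subgroup (congruence_topology closure_of H) Aut_tree"
proof (rule subgroup_AutI)
  show "congruence_topology closure_of H \<subseteq> Aut" using closure_iff by blast
  show "id \<in> congruence_topology closure_of H"
    unfolding closure_iff using sub_id[OF H] by (intro conjI allI bexI[of _ id]) auto
  fix g assume g: "g \<in> congruence_topology closure_of H"
  then have gA: "g \<in> Aut" by (simp add: closure_iff)
  have gH: "\<exists>a\<in>H. agree n g a" for n using g by (auto simp: closure_iff)
  have "\<exists>a\<in>H. a \<in> Aut \<and> agree n (ginv g) a" for n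
  proof -
    obtain a where "a \<in> H" "agree n g a" using gH by blast
    then have "ginv a \<in> H" "ginv a \<in> Aut" "agree n (ginv g) (ginv a)"
      using H gA by (auto intro: sub_ginv sub_Aut agree_ginv)
    then show ?thesis by blast
  qed
  then show "ginv g \<in> congruence_topology closure_of H" using gA by (simp add: closure_iff)
  fix h assume h: "h \<in> congruence_topology closure_of H"
  then have hA: "h \<in> Aut" by (simp add: closure_iff)
  have hH: "\<exists>a\<in>H. agree n h a" for n using h by (auto simp: closure_iff)
  have "\<exists>a\<in>H. a \<in> Aut \<and> agree n (g \<circ> h) a" for n
  proof -
    obtain a b where ab: "a \<in> H" "agree n g a" "b \<in> H" "agree n h b" using gH hH by blast
    have "a \<in> Aut" "b \<in> Aut" using ab sub_Aut[OF H] by auto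
    then have "agree n (g \<circ> h) (a \<circ> b)" "a \<circ> b \<in> Aut" using ab gA hA by (auto intro: agree_comp)
    then show ?thesis using sub_comp[OF H ab(1,3)] by blast
  qed
  then show "g \<circ> h \<in> congruence_topology closure_of H" using gA hA by (simp add: closure_iff)
qed

lemma open_contains_St_in:
  assumes "openin (subtopology congruence_topology \<Gamma>) N" "id \<in> N"
  shows "\<exists>n. St_in \<Gamma> n \<subseteq> N"
proof -
  obtain T where T: "openin congruence_topology T" "N = T \<inter> \<Gamma>"
    using assms(1) unfolding openin_subtopology by blast
  then have "id \<in> T" using assms(2) by blast
  then obtain n where "{h \<in> Aut. agree n id h} \<subseteq> T"
    using T(1) unfolding openin_congruence_iff by blast
  moreover have "x \<in> Aut \<and> agree n id x" if "x \<in> St_in \<Gamma> n" for x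
    using that agree_sym[of n x id] by (simp add: St_in_def St_iff_agree)
  moreover have "St_in \<Gamma> n \<subseteq> \<Gamma>" unfolding St_in_def by blast
  ultimately have "St_in \<Gamma> n \<subseteq> N" unfolding T(2) by blast
  then show ?thesis by blast
qed

text \<open>On any given level an infinite antichain looks like its finitely many short members.\<close>

lemma spread_in_closure:
  fixes H :: "('a::finite list \<Rightarrow> 'a list) set"
  assumes H: "subgroup H Aut_tree" and V: "antichain V" and f: "\<And>v. v \<in> V \<Longrightarrow> f v \<in> Aut"
    and lift: "\<And>v. v \<in> V \<Longrightarrow> lift v (f v) \<in> H"
  shows "spread V f \<in> congruence_topology closure_of H"
proof -
  have "\<exists>a\<in>H. a \<in> Aut \<and> agree n (spread V f) a" for n
  proof -
    let ?V = "{v \<in> V. length v \<le> n}"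
    have V': "antichain ?V" by (rule antichain_subset[OF V]) auto
    have "?V \<subseteq> (\<Union>k\<le>n. level k)" by (auto simp: level_def)
    then have "finite ?V" by (rule finite_subset) simp
    then have a: "spread ?V f \<in> H" by (rule spread_finite_in_subgroup[OF H _ V']) (simp add: lift)
    have "spread V f w = spread ?V f w" if w: "w \<in> level n" for w
    proof (cases rule: spread_cases[of V w])
      case (1 u z)
      then have "u \<in> ?V" using w by (simp add: level_def)
      then show ?thesis using spread_below[OF V 1(1)] spread_below[OF V'] 1 by simp
    next
      case 2
      then have "\<not> (\<exists>u\<in>?V. prefix u w)" by blast
      then show ?thesis using 2 by (simp add: spread_off)
    qed
    then have "agree n (spread V f) (spread ?V f)" by (simp add: agree_def)
    then show ?thesis using a sub_Aut[OF H a] by blast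
  qed
  then show ?thesis using spread_Aut[OF V f] by (simp add: closure_iff)
qed

section \<open>Rigid vertex stabilizers\<close>

lemma lift_in_rist: "lift v g \<in> \<Gamma> \<Longrightarrow> g \<in> Aut \<Longrightarrow> lift v g \<in> rist \<Gamma> v"
  using lift_below[of v g "[]"] by (simp add: rist_def lift_off Aut_root)

lemma rist_eq_lift:
  assumes "e \<in> rist \<Gamma> v" "e \<in> Aut"
  shows "e = lift v (section_at e v)"
proof (rule sym, rule spread_eqI)
  fix u z assume "u \<in> {v}"
  then show "e (u @ z) = u @ section_at e v z"
    using assms by (simp add: Aut_append[OF assms(2)] rist_def)
qed (use assms in \<open>auto simp: rist_def\<close>)

lemma rist_conj:
  assumes \<Gamma>: "subgroup \<Gamma> Aut_tree" and k: "k \<in> \<Gamma>" and e: "e \<in> rist \<Gamma> v"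
  shows "k \<circ> e \<circ> ginv k \<in> rist \<Gamma> (k v)"
proof -
  have kA: "k \<in> Aut" using sub_Aut[OF \<Gamma> k] .
  have e\<Gamma>: "e \<in> \<Gamma>" using e by (simp add: rist_def)
  have eA: "e \<in> Aut" using sub_Aut[OF \<Gamma> e\<Gamma>] .
  let ?s = "section_at k v \<circ> section_at e v \<circ> ginv (section_at k v)"
  have "k \<circ> lift v (section_at e v) \<circ> ginv k = lift (k v) ?s" by (rule conj_lift[OF kA])
  then have eq: "k \<circ> e \<circ> ginv k = lift (k v) ?s" using rist_eq_lift[OF e eA] by simp
  have "k \<circ> e \<circ> ginv k \<in> \<Gamma>" using k e\<Gamma> \<Gamma> by (intro sub_comp[OF \<Gamma>] sub_ginv[OF \<Gamma>])
  then have "lift (k v) ?s \<in> \<Gamma>" unfolding eq .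
  then show ?thesis unfolding eq using kA eA by (intro lift_in_rist) simp_all
qed

section \<open>Counting cosets\<close>

lemma card_image_factor:
  assumes "finite (\<theta> ` A)" "\<And>a b. \<lbrakk>a \<in> A; b \<in> A; \<theta> a = \<theta> b\<rbrakk> \<Longrightarrow> \<phi> a = \<phi> b"
  shows "finite (\<phi> ` A)" "card (\<phi> ` A) \<le> card (\<theta> ` A)"
proof -
  have eq: "\<phi> ` A = (\<lambda>y. \<phi> (inv_into A \<theta> y)) ` \<theta> ` A"
  proof -
    have "\<phi> (inv_into A \<theta> (\<theta> a)) = \<phi> a" if "a \<in> A" for a
      using that by (intro assms(2)) (auto intro: inv_into_into f_inv_into_f)
    then show ?thesis by (force simp: image_image)
  qed
  show "finite (\<phi> ` A)" unfolding eq using assms(1) by simp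
  show "card (\<phi> ` A) \<le> card (\<theta> ` A)" unfolding eq using assms(1) by (rule card_image_le)
qed

text \<open>Composition reverses the multiplication of \<open>Aut_tree\<close>, so these are its right cosets \<open>N #> a\<close>.\<close>

definition lcoset :: "('a list \<Rightarrow> 'a list) set \<Rightarrow> ('a list \<Rightarrow> 'a list) \<Rightarrow> ('a list \<Rightarrow> 'a list) set" where
  "lcoset N a = (\<lambda>n. a \<circ> n) ` N"

text \<open>\<open>ix N A\<close> is the number of cosets of \<open>N\<close> that meet \<open>A\<close>; for a subgroup \<open>A\<close> this is the index
  of \<open>N\<close> in \<open>A N\<close>, but the count also makes sense for arbitrary sets of group elements.\<close>

definition ix :: "('a list \<Rightarrow> 'a list) set \<Rightarrow> ('a list \<Rightarrow> 'a list) set \<Rightarrow> nat" where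
  "ix N A = card (lcoset N ` A)"

locale finite_quotient =
  fixes \<Gamma> N :: "('a::finite list \<Rightarrow> 'a list) set"
  assumes \<Gamma>: "subgroup \<Gamma> Aut_tree" and N: "subgroup N Aut_tree" and N\<Gamma>: "N \<subseteq> \<Gamma>"
    and conj: "\<lbrakk>g \<in> \<Gamma>; n \<in> N\<rbrakk> \<Longrightarrow> g \<circ> n \<circ> ginv g \<in> N"
    and St_le: "\<exists>n. St_in \<Gamma> n \<subseteq> N"
begin

lemma \<Gamma>_Aut: "g \<in> \<Gamma> \<Longrightarrow> g \<in> Aut"
  by (rule sub_Aut[OF \<Gamma>])

lemma lcoset_eq_iff:
  assumes a: "a \<in> \<Gamma>" and b: "b \<in> \<Gamma>"
  shows "lcoset N a = lcoset N b \<longleftrightarrow> ginv a \<circ> b \<in> N"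
proof
  have A: "a \<in> Aut" "b \<in> Aut" using a b \<Gamma>_Aut by auto
  assume "lcoset N a = lcoset N b"
  moreover have "b \<circ> id \<in> lcoset N b" unfolding lcoset_def using sub_id[OF N] by blast
  ultimately obtain n where n: "n \<in> N" "b = a \<circ> n" by (auto simp: lcoset_def)
  then have "ginv a \<circ> b = (ginv a \<circ> a) \<circ> n" by (simp only: comp_assoc)
  then show "ginv a \<circ> b \<in> N" using n A by simp
next
  have A: "a \<in> Aut" "b \<in> Aut" using a b \<Gamma>_Aut by auto
  assume n: "ginv a \<circ> b \<in> N" (is "?n \<in> N")
  have nA: "?n \<in> Aut" using A by simp
  have "a \<circ> ?n = (a \<circ> ginv a) \<circ> b" by (simp only: comp_assoc)
  then have b': "b = a \<circ> ?n" using A by simp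
  show "lcoset N a = lcoset N b" unfolding lcoset_def
  proof (intro equalityI subsetI)
    fix x assume "x \<in> (\<circ>) b ` N"
    then obtain m where "m \<in> N" "x = b \<circ> m" by blast
    moreover have "b \<circ> m = a \<circ> (?n \<circ> m)" using b' by (simp only: comp_assoc[symmetric])
    ultimately show "x \<in> (\<circ>) a ` N" using sub_comp[OF N n] by blast
  next
    fix x assume "x \<in> (\<circ>) a ` N"
    then obtain m where m: "m \<in> N" "x = a \<circ> m" by blast
    have "b \<circ> (ginv ?n \<circ> m) = a \<circ> (?n \<circ> ginv ?n) \<circ> m"
      using b' by (simp only: comp_assoc[symmetric])
    then have "b \<circ> (ginv ?n \<circ> m) = x" using ginv_comp_right[OF nA] m by simp
    moreover have "ginv ?n \<circ> m \<in> N" using sub_comp[OF N sub_ginv[OF N n] m(1)] .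
    ultimately show "x \<in> (\<circ>) b ` N" by blast
  qed
qed

lemma lcoset_eq_agree:
  assumes "St_in \<Gamma> n \<subseteq> N" "a \<in> \<Gamma>" "b \<in> \<Gamma>" "agree n a b"
  shows "lcoset N a = lcoset N b"
proof -
  have A: "a \<in> Aut" "b \<in> Aut" using assms \<Gamma>_Aut by auto
  have "agree n (ginv a \<circ> a) (ginv a \<circ> b)" using A assms(4) by (intro agree_comp) auto
  then have "agree n (ginv a \<circ> b) id" using A by (simp add: agree_sym)
  moreover have "ginv a \<circ> b \<in> \<Gamma>" using assms(2,3) by (intro sub_comp[OF \<Gamma>] sub_ginv[OF \<Gamma>])
  ultimately have "ginv a \<circ> b \<in> N" using assms(1) A by (auto simp: St_in_def St_iff_agree)
  then show ?thesis using assms by (simp add: lcoset_eq_iff)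
qed

lemma finite_cosets_\<Gamma>: "finite (lcoset N ` \<Gamma>)"
proof -
  obtain n where n: "St_in \<Gamma> n \<subseteq> N" using St_le by blast
  let ?\<theta> = "\<lambda>a. restrict a (level n)"
  have fin: "finite (?\<theta> ` \<Gamma>)" by (rule finite_restrict_level[OF \<Gamma>_Aut])
  show ?thesis
  proof (rule card_image_factor(1)[OF fin])
    fix a b assume ab: "a \<in> \<Gamma>" "b \<in> \<Gamma>" "?\<theta> a = ?\<theta> b"
    then have "agree n a b" unfolding agree_def by (metis restrict_apply')
    then show "lcoset N a = lcoset N b" using ab lcoset_eq_agree[OF n] by blast
  qed
qed

lemma finite_cosets: "A \<subseteq> \<Gamma> \<Longrightarrow> finite (lcoset N ` A)"
  using finite_cosets_\<Gamma> by (meson finite_subset image_mono)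

lemma ix_mono: "\<lbrakk>A \<subseteq> B; B \<subseteq> \<Gamma>\<rbrakk> \<Longrightarrow> ix N A \<le> ix N B"
  unfolding ix_def by (intro card_mono finite_cosets image_mono)

lemma ix_pos: "\<lbrakk>A \<subseteq> \<Gamma>; A \<noteq> {}\<rbrakk> \<Longrightarrow> ix N A \<ge> 1"
  unfolding ix_def using finite_cosets[of A] by (simp add: Suc_le_eq card_gt_0_iff)

lemma lcoset_comp_cong:
  assumes "a \<in> \<Gamma>" "a' \<in> \<Gamma>" "b \<in> \<Gamma>" "b' \<in> \<Gamma>" "lcoset N a = lcoset N a'" "lcoset N b = lcoset N b'"
  shows "lcoset N (a \<circ> b) = lcoset N (a' \<circ> b')"
proof -
  have A: "a \<in> Aut" "a' \<in> Aut" "b \<in> Aut" "b' \<in> Aut" using assms \<Gamma>_Aut by auto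
  have 1: "ginv a \<circ> a' \<in> N" and 2: "ginv b \<circ> b' \<in> N" using assms lcoset_eq_iff by blast+
  have "ginv b \<circ> (ginv a \<circ> a') \<circ> ginv (ginv b) \<in> N"
    using conj[OF sub_ginv[OF \<Gamma> assms(3)] 1] .
  then have "ginv b \<circ> (ginv a \<circ> a') \<circ> b \<circ> (ginv b \<circ> b') \<in> N"
    using A 2 sub_comp[OF N] by simp
  moreover have "ginv b \<circ> (ginv a \<circ> a') \<circ> b \<circ> (ginv b \<circ> b') = ginv (a \<circ> b) \<circ> (a' \<circ> b')"
    using A by (simp add: ginv_comp fun_eq_iff)
  ultimately show ?thesis
    using assms by (simp add: lcoset_eq_iff sub_comp[OF \<Gamma>])
qed

lemma ix_comp_le:
  assumes B: "B \<subseteq> \<Gamma>" and C: "C \<subseteq> \<Gamma>" and A: "\<And>a. a \<in> A \<Longrightarrow> \<exists>b\<in>B. \<exists>c\<in>C. a = b \<circ> c"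
  shows "ix N A \<le> ix N B * ix N C"
proof -
  let ?\<theta> = "\<lambda>(b, c). (lcoset N b, lcoset N c)" and ?\<phi> = "\<lambda>(b, c). lcoset N (b \<circ> c)"
  have im: "?\<theta> ` (B \<times> C) = lcoset N ` B \<times> lcoset N ` C" by auto
  have fin: "finite (?\<theta> ` (B \<times> C))" unfolding im using finite_cosets B C by blast
  have "?\<phi> p = ?\<phi> q" if "p \<in> B \<times> C" "q \<in> B \<times> C" "?\<theta> p = ?\<theta> q" for p q
  proof -
    obtain b c b' c' where pq: "p = (b, c)" "q = (b', c')" by (metis surj_pair)
    have "b \<in> \<Gamma>" "b' \<in> \<Gamma>" "c \<in> \<Gamma>" "c' \<in> \<Gamma>" using that pq B C by auto
    then have "lcoset N (b \<circ> c) = lcoset N (b' \<circ> c')"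
      by (rule lcoset_comp_cong) (use that(3) pq in auto)
    then show ?thesis using pq by simp
  qed
  note f = card_image_factor[of ?\<theta> "B \<times> C" ?\<phi>, OF fin this]
  have "lcoset N ` A \<subseteq> ?\<phi> ` (B \<times> C)" using A by force
  then have "ix N A \<le> card (?\<phi> ` (B \<times> C))" unfolding ix_def using f(1) by (intro card_mono)
  also have "\<dots> \<le> card (?\<theta> ` (B \<times> C))" by (rule f(2))
  also have "\<dots> = ix N B * ix N C" unfolding im ix_def by (rule card_cartesian_product)
  finally show ?thesis .
qed

lemma ix_le_card: "finite T \<Longrightarrow> ix N T \<le> card T"
  unfolding ix_def by (rule card_image_le)

lemma ix_conj_le:
  assumes g: "g \<in> \<Gamma>" and A: "A \<subseteq> \<Gamma>" and B: "\<And>b. b \<in> B \<Longrightarrow> ginv g \<circ> b \<circ> g \<in> A" "B \<subseteq> \<Gamma>"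
  shows "ix N B \<le> ix N A"
proof -
  let ?\<theta> = "\<lambda>b. lcoset N (ginv g \<circ> b \<circ> g)"
  have sub: "?\<theta> ` B \<subseteq> lcoset N ` A" using B by blast
  have gi: "ginv g \<in> \<Gamma>" using sub_ginv[OF \<Gamma> g] .
  have "lcoset N a = lcoset N b" if ab: "a \<in> B" "b \<in> B" "?\<theta> a = ?\<theta> b" for a b
  proof -
    have in\<Gamma>: "ginv g \<circ> a \<circ> g \<in> \<Gamma>" "ginv g \<circ> b \<circ> g \<in> \<Gamma>"
      using ab(1,2) B A by auto
    then have i: "g \<circ> (ginv g \<circ> a \<circ> g) \<in> \<Gamma>" "g \<circ> (ginv g \<circ> b \<circ> g) \<in> \<Gamma>"
      using sub_comp[OF \<Gamma> g] by auto
    have "lcoset N (g \<circ> (ginv g \<circ> a \<circ> g)) = lcoset N (g \<circ> (ginv g \<circ> b \<circ> g))"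
      by (rule lcoset_comp_cong[OF g g in\<Gamma> refl ab(3)])
    then have "lcoset N (g \<circ> (ginv g \<circ> a \<circ> g) \<circ> ginv g) = lcoset N (g \<circ> (ginv g \<circ> b \<circ> g) \<circ> ginv g)"
      by (rule lcoset_comp_cong[OF i gi gi _ refl])
    moreover have "g \<circ> (ginv g \<circ> x \<circ> g) \<circ> ginv g = x" for x
      using \<Gamma>_Aut[OF g] by (simp add: fun_eq_iff)
    ultimately show ?thesis by simp
  qed
  then have "card (lcoset N ` B) \<le> card (?\<theta> ` B)"
    by (rule card_image_factor(2)[OF finite_subset[OF sub finite_cosets[OF A]]])
  also have "\<dots> \<le> card (lcoset N ` A)" using sub finite_cosets[OF A] by (intro card_mono)
  finally show ?thesis unfolding ix_def .
qed

lemma ix_rist_conj: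
  assumes g: "g \<in> \<Gamma>"
  shows "ix N (rist \<Gamma> (g v)) = ix N (rist \<Gamma> v)"
proof (rule antisym)
  have gA: "g \<in> Aut" using \<Gamma>_Aut[OF g] .
  have sub: "rist \<Gamma> w \<subseteq> \<Gamma>" for w by (auto simp: rist_def)
  show "ix N (rist \<Gamma> (g v)) \<le> ix N (rist \<Gamma> v)"
  proof (rule ix_conj_le[OF g sub])
    fix b assume "b \<in> rist \<Gamma> (g v)"
    from rist_conj[OF \<Gamma> sub_ginv[OF \<Gamma> g] this] show "ginv g \<circ> b \<circ> g \<in> rist \<Gamma> v"
      using gA by simp
  qed (rule sub)
  show "ix N (rist \<Gamma> v) \<le> ix N (rist \<Gamma> (g v))"
  proof (rule ix_conj_le[OF sub_ginv[OF \<Gamma> g] sub])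
    fix b assume "b \<in> rist \<Gamma> v"
    from rist_conj[OF \<Gamma> g this] show "ginv (ginv g) \<circ> b \<circ> ginv g \<in> rist \<Gamma> (g v)"
      using gA by simp
  qed (rule sub)
qed

lemma ix_closure:
  assumes H: "H \<subseteq> \<Gamma>" and cl: "congruence_topology closure_of H \<subseteq> \<Gamma>"
  shows "ix N (congruence_topology closure_of H) = ix N H"
proof -
  obtain n where n: "St_in \<Gamma> n \<subseteq> N" using St_le by blast
  have "lcoset N x \<in> lcoset N ` H" if x: "x \<in> congruence_topology closure_of H" for x
  proof -
    obtain a where "a \<in> H" "agree n x a" using x by (auto simp: closure_iff)
    moreover have "x \<in> \<Gamma>" using x cl by blast
    ultimately have "lcoset N x = lcoset N a" using H lcoset_eq_agree[OF n] by blast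
    then show ?thesis using \<open>a \<in> H\<close> by blast
  qed
  moreover have "H \<subseteq> congruence_topology closure_of H"
    using H \<Gamma>_Aut by (intro subset_closure) blast
  ultimately have "lcoset N ` (congruence_topology closure_of H) = lcoset N ` H" by blast
  then show ?thesis by (simp add: ix_def)
qed

lemma subgroup_index_\<Gamma>: "subgroup_index \<Gamma> N = ix N \<Gamma>"
proof -
  have "rcosets\<^bsub>as_group \<Gamma>\<^esub> N = lcoset N ` \<Gamma>"
    by (auto simp: RCOSETS_def r_coset_def lcoset_def)
  then show ?thesis by (simp add: subgroup_index_def ix_def)
qed

lemma rcosets_product:
  assumes H: "H \<subseteq> \<Gamma>"
  shows "rcosets\<^bsub>as_group (H <#>\<^bsub>Aut_tree\<^esub> N)\<^esub> N = lcoset N ` H"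
proof -
  have "lcoset N (n \<circ> h) = lcoset N h" if "h \<in> H" "n \<in> N" for h n
  proof -
    have h: "h \<in> \<Gamma>" and n: "n \<in> \<Gamma>" using that H N\<Gamma> by auto
    have "ginv h \<circ> n \<circ> ginv (ginv h) \<in> N" by (rule conj[OF sub_ginv[OF \<Gamma> h] that(2)])
    then have "ginv h \<circ> (n \<circ> h) \<in> N" using \<Gamma>_Aut[OF h] by (simp add: comp_assoc)
    then show ?thesis using lcoset_eq_iff[OF h sub_comp[OF \<Gamma> n h]] by simp
  qed
  note absorb = this
  have eq: "rcosets\<^bsub>as_group (H <#>\<^bsub>Aut_tree\<^esub> N)\<^esub> N =
      {lcoset N (n \<circ> h) | h n. h \<in> H \<and> n \<in> N}"
    by (auto simp: RCOSETS_def r_coset_def lcoset_def set_mult_def)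
  show ?thesis unfolding eq
  proof (intro equalityI subsetI)
    fix x assume "x \<in> {lcoset N (n \<circ> h) | h n. h \<in> H \<and> n \<in> N}"
    then show "x \<in> lcoset N ` H" using absorb by auto
  next
    fix x assume "x \<in> lcoset N ` H"
    then obtain h where "h \<in> H" "x = lcoset N (id \<circ> h)" by auto
    then show "x \<in> {lcoset N (n \<circ> h) | h n. h \<in> H \<and> n \<in> N}"
      using sub_id[OF N] by blast
  qed
qed

lemma subgroup_index_product: "H \<subseteq> \<Gamma> \<Longrightarrow> subgroup_index (H <#>\<^bsub>Aut_tree\<^esub> N) N = ix N H"
  by (simp add: subgroup_index_def ix_def rcosets_product)

end

section \<open>Regular branch groups\<close>

text \<open>Commutators with respect to composition. Those with respect to the multiplication of \<open>Aut_tree\<close> are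
  \<open>comm (ginv h) (ginv g)\<close>, so the derived subgroups coincide.\<close>

definition comm :: "('a list \<Rightarrow> 'a list) \<Rightarrow> ('a list \<Rightarrow> 'a list) \<Rightarrow> 'a list \<Rightarrow> 'a list" where
  "comm g h = g \<circ> h \<circ> ginv g \<circ> ginv h"

lemma comm_Aut [simp]: "\<lbrakk>g \<in> Aut; h \<in> Aut\<rbrakk> \<Longrightarrow> comm g h \<in> Aut"
  by (simp add: comm_def)

lemma comm_in_subgroup: "\<lbrakk>subgroup H Aut_tree; g \<in> H; h \<in> H\<rbrakk> \<Longrightarrow> comm g h \<in> H"
  unfolding comm_def by (intro sub_comp sub_ginv)

text \<open>Used for conjugation, for copying an automorphism below a vertex, and for diagonal copies.\<close>

lemma generate_hom_closed:
  assumes S: "S \<subseteq> Aut" and H: "subgroup H Aut_tree"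
    and hom: "\<phi> id = id" "\<And>a b. \<lbrakk>a \<in> Aut; b \<in> Aut\<rbrakk> \<Longrightarrow> \<phi> (a \<circ> b) = \<phi> a \<circ> \<phi> b"
      "\<And>a. a \<in> Aut \<Longrightarrow> \<phi> (ginv a) = ginv (\<phi> a)"
    and SH: "\<And>s. s \<in> S \<Longrightarrow> \<phi> s \<in> H"
    and d: "d \<in> generate Aut_tree S"
  shows "\<phi> d \<in> H"
  using d
proof (induction d rule: generate.induct)
  case one
  show ?case unfolding Aut_tree_simps(3) hom(1) by (rule sub_id[OF H])
next
  case (incl h)
  then show ?case by (rule SH)
next
  case (inv h)
  then have "h \<in> Aut" using S by blast
  then show ?case using hom(3)[of h] sub_ginv[OF H SH[OF inv]] by (simp add: m_inv_Aut)
next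
  case (eng h1 h2)
  have "h1 \<in> Aut" "h2 \<in> Aut"
    using eng.hyps Aut_group.generate_incl[OF S] by auto
  then show ?case
    unfolding Aut_tree_simps(2) hom(2)[OF \<open>h2 \<in> Aut\<close> \<open>h1 \<in> Aut\<close>]
    by (intro sub_comp[OF H] eng.IH)
qed

lemma conj_comp:
  "\<lbrakk>g \<in> Aut\<rbrakk> \<Longrightarrow> g \<circ> (a \<circ> b) \<circ> ginv g = (g \<circ> a \<circ> ginv g) \<circ> (g \<circ> b \<circ> ginv g)"
  by (simp add: fun_eq_iff)

lemma conj_ginv:
  assumes "g \<in> Aut" "a \<in> Aut"
  shows "g \<circ> ginv a \<circ> ginv g = ginv (g \<circ> a \<circ> ginv g)"
  unfolding ginv_comp[OF Aut_comp[OF assms] Aut_ginv[OF assms(1)]] ginv_comp[OF assms]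
    ginv_ginv[OF assms(1)] by (simp only: comp_assoc)

lemma conj_comm:
  assumes "g \<in> Aut" "a \<in> Aut" "b \<in> Aut"
  shows "g \<circ> comm a b \<circ> ginv g = comm (g \<circ> a \<circ> ginv g) (g \<circ> b \<circ> ginv g)"
  by (simp only: comm_def conj_comp[OF assms(1), symmetric] conj_ginv[OF assms(1,2), symmetric]
      conj_ginv[OF assms(1,3), symmetric])

lemma lift_comm:
  "\<lbrakk>a \<in> Aut; b \<in> Aut\<rbrakk> \<Longrightarrow> lift v (comm a b) = comm (lift v a) (lift v b)"
  by (simp only: comm_def lift_comp ginv_lift)

definition derived_sub :: "('a list \<Rightarrow> 'a list) set \<Rightarrow> ('a list \<Rightarrow> 'a list) set" where
  "derived_sub C = generate Aut_tree {comm a b | a b. a \<in> C \<and> b \<in> C}"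

definition branch_prod ::
    "'a list set \<Rightarrow> ('a list \<Rightarrow> 'a list) set \<Rightarrow> ('a list \<Rightarrow> 'a list) set" where
  "branch_prod U B = {spread U f | f. \<forall>u\<in>U. f u \<in> B}"

text \<open>\<open>C\<close> is a normal branching subgroup of finite index, \<open>A\<close> a finite set of generators of it and \<open>T\<close> a set of
  representatives of its cosets.\<close>

locale regular_branch_group =
  fixes G C A T :: "('a::finite list \<Rightarrow> 'a list) set"
  assumes card2: "CARD('a) \<ge> 2"
    and G: "subgroup G Aut_tree"
    and sections: "g \<in> G \<Longrightarrow> section_at g v \<in> G"
    and transitive: "length u = length w \<Longrightarrow> \<exists>g\<in>G. g u = w"
    and C: "subgroup C Aut_tree" and CG: "C \<subseteq> G"
    and C_conj: "\<lbrakk>g \<in> G; c \<in> C\<rbrakk> \<Longrightarrow> g \<circ> c \<circ> ginv g \<in> C"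
    and C_lift: "c \<in> C \<Longrightarrow> lift v c \<in> C"
    and T: "finite T" "T \<subseteq> G" and cover: "g \<in> G \<Longrightarrow> \<exists>t\<in>T. \<exists>c\<in>C. g = c \<circ> t"
    and A: "finite A" "C = generate Aut_tree A" "A \<subseteq> C"

lemma branching_lift:
  assumes K: "branching_subgroup G K" and k: "k \<in> K"
  shows "lift [x] k \<in> K"
proof -
  have sK: "subgroup K Aut_tree" and psi: "(UNIV \<rightarrow> K) \<subseteq> \<psi> ` St_in K 1"
    using K by (auto simp: branching_subgroup_def)
  have "(\<lambda>y. if y = x then k else id) \<in> UNIV \<rightarrow> K" using k sub_id[OF sK] by auto
  then obtain s where s: "s \<in> St_in K 1" "\<psi> s = (\<lambda>y. if y = x then k else id)" using psi by auto
  have sA: "s \<in> Aut" and sk: "s \<in> K" and fix1: "s [y] = [y]" for y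
    using s(1) by (auto simp: St_in_def St_def level_def)
  have sec: "s (y # z) = y # (if y = x then k else id) z" for y z
    using Aut_append[OF sA, of "[y]" z] fix1[of y] fun_cong[OF s(2), of y] by (simp add: \<psi>_def)
  have "lift [x] k = s"
  proof (rule spread_eqI)
    fix u z assume "u \<in> {[x]}"
    then show "s (u @ z) = u @ k z" using sec[of x z] by simp
  next
    fix w assume w: "\<not> (\<exists>u\<in>{[x]}. prefix u w)"
    show "s w = w"
    proof (cases w)
      case Nil then show ?thesis using Aut_root[OF sA] by simp
    next
      case (Cons y z)
      then have "y \<noteq> x" using w by simp
      then show ?thesis using sec[of y z] Cons by simp
    qed
  qed simp
  then show ?thesis using sk by simp
qed

text \<open>The normal core of a branching subgroup is again branching: conjugating an element of the
  core that acts below a first-level vertex only replaces it by a conjugate acting below another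
  first-level vertex. Working with a normal branching subgroup makes all its copies below vertices
  of one level conjugate to each other.\<close>

lemma regular_branch_group_exists:
  fixes G :: "('a::finite list \<Rightarrow> 'a list) set"
  assumes card2: "CARD('a) \<ge> 2" and fg: "finitely_generated G" and rb: "regular_branch G"
  shows "\<exists>C A T. regular_branch_group G C A T"
proof -
  obtain S where S: "finite S" "S \<subseteq> Aut" "G = generate Aut_tree S"
    using fg by (auto simp: finitely_generated_def)
  have G: "subgroup G Aut_tree" and ss: "self_similar G" and lt: "level_transitive G"
    using rb by (auto simp: regular_branch_def)
  obtain K where K: "branching_subgroup G K" "finite (rcosets\<^bsub>as_group G\<^esub> K)"
    using rb by (auto simp: regular_branch_def)
  have sK: "subgroup K Aut_tree" and KG: "K \<subseteq> G" using K(1) by (auto simp: branching_subgroup_def)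
  have sec: "section_at g v \<in> G" if "g \<in> G" for g v using ss that by (simp add: self_similar_def)
  have GA: "g \<in> Aut" if "g \<in> G" for g using sub_Aut[OF G that] .
  obtain T0 where T0: "T0 \<subseteq> G" "finite T0" "\<forall>g\<in>G. \<exists>t\<in>T0. \<exists>k\<in>K. g = k \<otimes>\<^bsub>Aut_tree\<^esub> t"
    using Aut_group.finite_index_transversal[OF G sK KG K(2)] by blast
  define C where "C = Aut_group.core_in G K"
  have sC: "subgroup C Aut_tree" unfolding C_def by (rule Aut_group.core_in_subgroup[OF G sK])
  have CK: "C \<subseteq> K" unfolding C_def by (rule Aut_group.core_in_subset[OF G])
  have CG: "C \<subseteq> G" using CK KG by blast
  have C_conj: "g \<circ> c \<circ> ginv g \<in> C" if "g \<in> G" "c \<in> C" for g c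
    using Aut_group.core_in_conj[OF G, of c K "ginv g"] that GA sub_ginv[OF G] CG
    unfolding C_def[symmetric] by (simp add: m_inv_Aut comp_assoc subset_iff)
  obtain R where R: "R \<subseteq> G" "finite R" "\<forall>g\<in>G. \<exists>r\<in>R. \<exists>c\<in>C. g = c \<otimes>\<^bsub>Aut_tree\<^esub> r"
    using Aut_group.core_in_finite_index[OF G sK KG T0(2,1,3)] unfolding C_def by blast
  have "\<exists>A. finite A \<and> A \<subseteq> C \<and> C = generate Aut_tree A"
    by (rule Aut_group.finite_index_finitely_generated[OF S(1,2) sC _ R(2)])
      (use CG R S(3) in auto)
  then obtain A where A: "finite A" "A \<subseteq> C" "C = generate Aut_tree A" by blast
  have lift1: "lift [x] c \<in> C" if c: "c \<in> C" for c x
  proof -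
    have cA: "c \<in> Aut" using GA CG c by blast
    have "h \<circ> lift [x] c \<circ> ginv h \<in> K" if h: "h \<in> G" for h
    proof -
      have hA: "h \<in> Aut" using GA h .
      have "length (h [x]) = 1" using Aut_length[OF hA] by simp
      then obtain y where y: "h [x] = [y]" by (cases "h [x]") auto
      have "section_at h [x] \<circ> c \<circ> ginv (section_at h [x]) \<in> K"
        using C_conj[OF sec[OF h] c] CK by blast
      then have "lift [y] (section_at h [x] \<circ> c \<circ> ginv (section_at h [x])) \<in> K"
        by (rule branching_lift[OF K(1)])
      then show ?thesis using conj_lift[OF hA, of "[x]" c] y by simp
    qed
    note conj = this
    have "g \<otimes>\<^bsub>Aut_tree\<^esub> lift [x] c \<otimes>\<^bsub>Aut_tree\<^esub> m_inv Aut_tree g \<in> K" if g: "g \<in> G" for g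
      using conj[OF sub_ginv[OF G g]]
      unfolding Aut_tree_simps(2) m_inv_Aut[OF GA[OF g]] ginv_ginv[OF GA[OF g]] comp_assoc .
    moreover have "lift [x] c \<in> G" using branching_lift[OF K(1)] c CK KG by blast
    ultimately show ?thesis unfolding C_def Aut_group.core_in_def by blast
  qed
  have C_lift: "lift v c \<in> C" if "c \<in> C" for c v
    using that
  proof (induction v)
    case Nil then show ?case by (simp add: lift_root)
  next
    case (Cons x v)
    then show ?case using lift1[of "lift v c" x] by (simp add: lift_lift)
  qed
  have cover: "\<exists>t\<in>R. \<exists>c\<in>C. g = c \<circ> t" if g: "g \<in> G" for g
  proof -
    obtain r c where rc: "r \<in> R" "c \<in> C" "g = r \<circ> c" using R(3) g by auto
    then have rG: "r \<in> G" using R(1) by blast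
    have "g = (r \<circ> c \<circ> ginv r) \<circ> r" using rc GA[OF rG] by (simp add: fun_eq_iff)
    then show ?thesis using rc C_conj[OF rG rc(2)] by blast
  qed
  have trans: "\<exists>g\<in>G. g u = w" if "length u = length w" for u w
    using lt that by (simp add: level_transitive_def level_def)
  have "regular_branch_group G C A R"
    by (rule regular_branch_group.intro[OF card2 G sec trans sC CG C_conj C_lift R(2,1) cover A(1,3,2)])
  then show ?thesis by blast
qed

context regular_branch_group
begin

definition \<Gamma> :: "('a list \<Rightarrow> 'a list) set" where
  "\<Gamma> = congruence_topology closure_of G"

definition D :: "('a list \<Rightarrow> 'a list) set" where
  "D = derived_sub C"

lemma \<Gamma>: "subgroup \<Gamma> Aut_tree"
  unfolding \<Gamma>_def by (rule closure_subgroup[OF G])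

lemma G_Aut: "g \<in> G \<Longrightarrow> g \<in> Aut" and C_Aut: "c \<in> C \<Longrightarrow> c \<in> Aut"
  using sub_Aut[OF G] sub_Aut[OF C] by auto

lemma G\<Gamma>: "G \<subseteq> \<Gamma>"
  unfolding \<Gamma>_def by (rule subset_closure) (use G_Aut in blast)

lemma comms_C: "{comm a b | a b. a \<in> C \<and> b \<in> C} \<subseteq> C"
  using comm_in_subgroup[OF C] by blast

lemma comms_Aut: "{comm a b | a b. a \<in> C \<and> b \<in> C} \<subseteq> Aut"
  using comms_C C_Aut by blast

lemma D: "subgroup D Aut_tree"
  unfolding D_def derived_sub_def by (rule Aut_group.generate_is_subgroup[OF comms_Aut])

lemma DC: "D \<subseteq> C"
  unfolding D_def derived_sub_def by (rule Aut_group.generate_subgroup_incl[OF comms_C C])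

lemma comm_D: "\<lbrakk>a \<in> C; b \<in> C\<rbrakk> \<Longrightarrow> comm a b \<in> D"
  unfolding D_def derived_sub_def by (rule generate.incl) blast

lemma D_Aut: "d \<in> D \<Longrightarrow> d \<in> Aut"
  by (rule sub_Aut[OF D])

lemma D_conj:
  assumes g: "g \<in> G" and d: "d \<in> D"
  shows "g \<circ> d \<circ> ginv g \<in> D"
proof (rule generate_hom_closed[where \<phi> = "\<lambda>d. g \<circ> d \<circ> ginv g", OF comms_Aut D])
  have gA: "g \<in> Aut" using G_Aut[OF g] .
  show "g \<circ> id \<circ> ginv g = id" using gA by simp
  show "g \<circ> (a \<circ> b) \<circ> ginv g = (g \<circ> a \<circ> ginv g) \<circ> (g \<circ> b \<circ> ginv g)" for a b
    by (rule conj_comp[OF gA])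
  show "g \<circ> ginv a \<circ> ginv g = ginv (g \<circ> a \<circ> ginv g)" if "a \<in> Aut" for a
    by (rule conj_ginv[OF gA that])
  fix s assume "s \<in> {comm a b | a b. a \<in> C \<and> b \<in> C}"
  then obtain a b where ab: "a \<in> C" "b \<in> C" "s = comm a b" by blast
  then show "g \<circ> s \<circ> ginv g \<in> D"
    using conj_comm[OF gA C_Aut[OF ab(1)] C_Aut[OF ab(2)]] comm_D[OF C_conj C_conj] g by simp
qed (rule d[unfolded D_def derived_sub_def])

lemma D_lift:
  assumes d: "d \<in> D"
  shows "lift v d \<in> D"
proof (rule generate_hom_closed[where \<phi> = "lift v", OF comms_Aut D])
  fix s assume "s \<in> {comm a b | a b. a \<in> C \<and> b \<in> C}"
  then obtain a b where ab: "a \<in> C" "b \<in> C" "s = comm a b" by blast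
  then show "lift v s \<in> D"
    using lift_comm[OF C_Aut[OF ab(1)] C_Aut[OF ab(2)]] comm_D[OF C_lift C_lift] by simp
qed (auto simp only: lift_id lift_comp ginv_lift intro: d[unfolded D_def derived_sub_def])

lemma finite_quotient_St: "finite_quotient \<Gamma> (St_in \<Gamma> n)"
proof (rule finite_quotient.intro[OF \<Gamma>])
  show "subgroup (St_in \<Gamma> n) Aut_tree"
  proof (rule subgroup_AutI)
    show "St_in \<Gamma> n \<subseteq> Aut" "id \<in> St_in \<Gamma> n"
      using sub_id[OF \<Gamma>] by (auto simp: St_in_def St_iff_agree)
    fix g assume g: "g \<in> St_in \<Gamma> n"
    then have gA: "g \<in> Aut" "agree n g id" "g \<in> \<Gamma>" by (auto simp: St_in_def St_iff_agree)
    show "ginv g \<in> St_in \<Gamma> n"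
      using agree_ginv[OF gA(1) Aut_id gA(2)] sub_ginv[OF \<Gamma> gA(3)] gA
      by (simp add: St_in_def St_iff_agree)
    fix h assume h: "h \<in> St_in \<Gamma> n"
    then have hA: "h \<in> Aut" "agree n h id" "h \<in> \<Gamma>" by (auto simp: St_in_def St_iff_agree)
    show "g \<circ> h \<in> St_in \<Gamma> n"
      using agree_comp[OF gA(1) hA(1) Aut_id Aut_id gA(2) hA(2)] sub_comp[OF \<Gamma> gA(3) hA(3)] gA hA
      by (simp add: St_in_def St_iff_agree)
  qed
  fix g s assume g: "g \<in> \<Gamma>" and s: "s \<in> St_in \<Gamma> n"
  have gA: "g \<in> Aut" using sub_Aut[OF \<Gamma> g] .
  have s': "s \<in> \<Gamma>" "s \<in> Aut" "agree n s id" using s by (auto simp: St_in_def St_iff_agree)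
  have "agree n (g \<circ> s) (g \<circ> id)" using gA s' by (intro agree_comp) auto
  then have "agree n (g \<circ> s \<circ> ginv g) (g \<circ> id \<circ> ginv g)" using gA s' by (intro agree_comp) auto
  then have "agree n (g \<circ> s \<circ> ginv g) id" using gA by simp
  moreover have "g \<circ> s \<circ> ginv g \<in> \<Gamma>" using g s' by (intro sub_comp[OF \<Gamma>] sub_ginv[OF \<Gamma>])
  ultimately show "g \<circ> s \<circ> ginv g \<in> St_in \<Gamma> n"
    using gA s' by (simp add: St_in_def St_iff_agree)
qed (auto simp: St_in_def)

lemma branch_prod_level_G:
  assumes "B \<subseteq> C"
  shows "branch_prod (level k) B \<subseteq> G"
proof
  fix p assume "p \<in> branch_prod (level k) B"
  then obtain f where f: "p = spread (level k) f" "\<forall>u\<in>level k. f u \<in> B"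
    by (auto simp: branch_prod_def)
  have "p \<in> C" unfolding f(1)
    by (rule spread_finite_in_subgroup[OF C finite_level antichain_level])
      (use f(2) assms C_lift in blast)
  then show "p \<in> G" using CG by blast
qed

text \<open>If finitely many translates of \<open>B\<close> cover \<open>G\<close>, the same holds for the product of the copies
  of \<open>B\<close> on a level: two elements that agree on the level and whose sections there lie in the same
  translates differ by an element of this product.\<close>

lemma branch_prod_cover:
  assumes B: "subgroup B Aut_tree" and S: "finite S" "S \<subseteq> G"
    and cov: "\<And>g. g \<in> G \<Longrightarrow> \<exists>t\<in>S. \<exists>b\<in>B. g = b \<circ> t"
  shows "\<exists>R\<subseteq>G. finite R \<and> card R \<le> (CARD('a) ^ k) ^ (CARD('a) ^ k) * card S ^ (CARD('a) ^ k) \<and>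
    (\<forall>g\<in>G. \<exists>r\<in>R. \<exists>p\<in>branch_prod (level k) B. g = p \<circ> r)"
proof -
  obtain \<tau> where \<tau>: "\<And>g. g \<in> G \<Longrightarrow> \<tau> g \<in> S \<and> (\<exists>b\<in>B. g = b \<circ> \<tau> g)"
    using cov by metis
  let ?L = "level k :: 'a list set"
  define \<theta> where "\<theta> g = (restrict g ?L, restrict (\<lambda>w. \<tau> (section_at g w)) ?L)" for g
  have sub: "\<theta> ` G \<subseteq> (?L \<rightarrow>\<^sub>E ?L) \<times> (?L \<rightarrow>\<^sub>E S)"
  proof
    fix y assume "y \<in> \<theta> ` G"
    then obtain g where g: "g \<in> G" "y = \<theta> g" by blast
    have "restrict g ?L \<in> ?L \<rightarrow>\<^sub>E ?L"
      by (intro PiE_I) (simp_all add: level_def Aut_length[OF G_Aut[OF g(1)]])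
    moreover have "restrict (\<lambda>w. \<tau> (section_at g w)) ?L \<in> ?L \<rightarrow>\<^sub>E S"
      by (intro PiE_I) (simp_all add: \<tau>[OF sections[OF g(1)]])
    ultimately show "y \<in> (?L \<rightarrow>\<^sub>E ?L) \<times> (?L \<rightarrow>\<^sub>E S)" unfolding g(2) \<theta>_def by blast
  qed
  have finr: "finite ((?L \<rightarrow>\<^sub>E ?L) \<times> (?L \<rightarrow>\<^sub>E S))"
    using S(1) by (intro finite_cartesian_product finite_PiE) auto
  have fin: "finite (\<theta> ` G)" using sub finr by (rule finite_subset)
  have "card (\<theta> ` G) \<le> card ((?L \<rightarrow>\<^sub>E ?L) \<times> (?L \<rightarrow>\<^sub>E S))" using finr sub by (rule card_mono)
  also have "\<dots> = (CARD('a) ^ k) ^ (CARD('a) ^ k) * card S ^ (CARD('a) ^ k)"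
    by (simp add: card_cartesian_product card_PiE card_level)
  finally have card: "card (\<theta> ` G) \<le> (CARD('a) ^ k) ^ (CARD('a) ^ k) * card S ^ (CARD('a) ^ k)" .
  obtain R where R: "R \<subseteq> G" "finite R" "card R \<le> card (\<theta> ` G)" "\<forall>g\<in>G. \<exists>r\<in>R. \<theta> r = \<theta> g"
    using exists_representatives[OF fin] by auto
  have "\<exists>r\<in>R. \<exists>p\<in>branch_prod (level k) B. g = p \<circ> r" if g: "g \<in> G" for g
  proof -
    obtain r where r: "r \<in> R" "\<theta> r = \<theta> g" using R(4) g by blast
    have rG: "r \<in> G" using r R(1) by blast
    have gA: "g \<in> Aut" and rA: "r \<in> Aut" using g rG G_Aut by auto
    have eq: "r w = g w" "\<tau> (section_at r w) = \<tau> (section_at g w)" if "w \<in> ?L" for w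
      using fun_cong[OF arg_cong[OF r(2), of fst], of w] fun_cong[OF arg_cong[OF r(2), of snd], of w]
        that by (simp_all add: \<theta>_def)
    define f where "f w = section_at g (ginv r w) \<circ> ginv (section_at r (ginv r w))" for w
    have fB: "f w \<in> B" if w: "w \<in> ?L" for w
    proof -
      define w' where "w' = ginv r w"
      have w': "w' \<in> ?L" using w Aut_length[OF Aut_ginv[OF rA]] by (simp add: w'_def level_def)
      have sG: "section_at g w' \<in> G" and sR: "section_at r w' \<in> G"
        using sections[OF g] sections[OF rG] by auto
      obtain b where b: "b \<in> B" "section_at g w' = b \<circ> \<tau> (section_at g w')" using \<tau>[OF sG] by blast
      obtain c where c: "c \<in> B" "section_at r w' = c \<circ> \<tau> (section_at g w')"
        using \<tau>[OF sR] eq(2)[OF w'] by auto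
      have tA: "\<tau> (section_at g w') \<in> Aut" using \<tau>[OF sG] S(2) G_Aut by blast
      have cA: "c \<in> Aut" using sub_Aut[OF B c(1)] .
      have "f w = (b \<circ> \<tau> (section_at g w')) \<circ> ginv (c \<circ> \<tau> (section_at g w'))"
        unfolding f_def w'_def[symmetric] b(2)[symmetric] c(2)[symmetric] ..
      also have "\<dots> = b \<circ> ginv c" using tA cA by (simp add: ginv_comp fun_eq_iff)
      finally show ?thesis using sub_comp[OF B b(1) sub_ginv[OF B c(1)]] by simp
    qed
    have "g = spread ?L f \<circ> r"
    proof
      fix z
      show "g z = (spread ?L f \<circ> r) z"
      proof (cases rule: spread_cases[of ?L z])
        case (1 w y)
        have rw: "r w \<in> ?L" using 1(1) Aut_length[OF rA] by (simp add: level_def)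
        have "spread ?L f (r z) = r w @ f (r w) (section_at r w y)"
          using spread_below[OF antichain_level rw, of f] 1(2) by (simp add: Aut_append[OF rA])
        also have "f (r w) (section_at r w y) = section_at g w y"
          using rA by (simp add: f_def)
        also have "r w @ section_at g w y = g z"
          using eq(1)[OF 1(1)] 1(2) by (simp add: Aut_append[OF gA])
        finally show ?thesis by simp
      next
        case 2
        have len: "length z < k"
        proof (rule ccontr)
          assume "\<not> length z < k"
          then have "take k z \<in> ?L" "prefix (take k z) z" by (auto simp: level_def take_is_prefix)
          then show False using 2 by blast
        qed
        have "agree k r g" using eq(1) by (simp add: agree_def)
        then have rz: "r z = g z" using len by (intro agree_short[OF rA gA]) auto
        have "\<not> (\<exists>u\<in>?L. prefix u (r z))"
        proof
          assume "\<exists>u\<in>?L. prefix u (r z)"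
          then obtain u where "length u = k" "prefix u (r z)" by (auto simp: level_def)
          then show False using prefix_length_le[of u "r z"] len Aut_length[OF rA, of z] by simp
        qed
        then show ?thesis using rz by (simp add: spread_off)
      qed
    qed
    then show ?thesis using r(1) fB unfolding branch_prod_def by blast
  qed
  then show ?thesis using R card by (intro exI[of _ R]) auto
qed

end

context finite_quotient
begin

lemma ix_branch_prod_le:
  assumes "finite U" "antichain U" "\<And>u b. \<lbrakk>u \<in> U; b \<in> B\<rbrakk> \<Longrightarrow> b \<in> Aut \<and> lift u b \<in> \<Gamma>"
  shows "ix N (branch_prod U B) \<le> (\<Prod>u\<in>U. ix N (rist \<Gamma> u))"
  using assms
proof (induction U rule: finite_induct)
  case empty
  have e: "spread {} f = id" for f :: "'a list \<Rightarrow> 'a list \<Rightarrow> 'a list"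
    by (auto simp: fun_eq_iff spread_off)
  have "branch_prod {} B \<subseteq> {id}" unfolding branch_prod_def e by blast
  then have "ix N (branch_prod {} B) \<le> ix N {id}"
    by (rule ix_mono) (use sub_id[OF \<Gamma>] in simp)
  also have "\<dots> \<le> card {id :: 'a list \<Rightarrow> 'a list}" by (rule ix_le_card) simp
  finally show ?case by simp
next
  case (insert v U)
  have a: "antichain U" by (rule antichain_subset[OF insert.prems(1)]) auto
  have IH: "ix N (branch_prod U B) \<le> (\<Prod>u\<in>U. ix N (rist \<Gamma> u))"
    by (rule insert.IH[OF a]) (use insert.prems(2) in blast)
  have "ix N (branch_prod (insert v U) B) \<le> ix N (rist \<Gamma> v) * ix N (branch_prod U B)"
  proof (rule ix_comp_le)
    show "rist \<Gamma> v \<subseteq> \<Gamma>" by (auto simp: rist_def)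
    show "branch_prod U B \<subseteq> \<Gamma>"
    proof
      fix p assume "p \<in> branch_prod U B"
      then obtain f where f: "p = spread U f" "\<forall>u\<in>U. f u \<in> B" by (auto simp: branch_prod_def)
      show "p \<in> \<Gamma>" unfolding f(1)
        by (rule spread_finite_in_subgroup[OF \<Gamma> insert.hyps(1) a]) (use f(2) insert.prems(2) in blast)
    qed
    fix p assume "p \<in> branch_prod (insert v U) B"
    then obtain f where f: "p = spread (insert v U) f" "\<forall>u\<in>insert v U. f u \<in> B"
      by (auto simp: branch_prod_def)
    have "p = lift v (f v) \<circ> spread U f"
      unfolding f(1) by (rule spread_insert[OF insert.prems(1) insert.hyps(2)])
    moreover have "lift v (f v) \<in> rist \<Gamma> v"
      using insert.prems(2)[of v "f v"] f(2) by (intro lift_in_rist) auto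
    moreover have "spread U f \<in> branch_prod U B" unfolding branch_prod_def using f(2) by blast
    ultimately show "\<exists>b\<in>rist \<Gamma> v. \<exists>c\<in>branch_prod U B. p = b \<circ> c" by blast
  qed
  also have "\<dots> \<le> ix N (rist \<Gamma> v) * (\<Prod>u\<in>U. ix N (rist \<Gamma> u))" using IH by simp
  finally show ?case using insert.hyps by simp
qed

lemma ix_branch_prod_union_le:
  assumes fin: "finite (U1 \<union> U2)" and ac: "antichain (U1 \<union> U2)" and disj: "U1 \<inter> U2 = {}"
    and B: "\<And>u b. \<lbrakk>u \<in> U1 \<union> U2; b \<in> B\<rbrakk> \<Longrightarrow> b \<in> Aut \<and> lift u b \<in> \<Gamma>"
  shows "ix N (branch_prod (U1 \<union> U2) B) \<le> ix N (branch_prod U1 B) * ix N (branch_prod U2 B)"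
proof (rule ix_comp_le)
  have sub: "branch_prod U B \<subseteq> \<Gamma>" if U: "U \<subseteq> U1 \<union> U2" for U
  proof
    fix p assume "p \<in> branch_prod U B"
    then obtain f where f: "p = spread U f" "\<forall>u\<in>U. f u \<in> B" by (auto simp: branch_prod_def)
    show "p \<in> \<Gamma>" unfolding f(1)
      by (rule spread_finite_in_subgroup[OF \<Gamma> finite_subset[OF U fin] antichain_subset[OF ac U]])
        (use f(2) B U in blast)
  qed
  show "branch_prod U1 B \<subseteq> \<Gamma>" "branch_prod U2 B \<subseteq> \<Gamma>" using sub by auto
  fix p assume "p \<in> branch_prod (U1 \<union> U2) B"
  then obtain f where f: "p = spread (U1 \<union> U2) f" "\<forall>u\<in>U1 \<union> U2. f u \<in> B"
    by (auto simp: branch_prod_def)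
  have "p = spread U1 f \<circ> spread U2 f" unfolding f(1) by (rule spread_union[OF ac disj])
  moreover have "spread U1 f \<in> branch_prod U1 B" "spread U2 f \<in> branch_prod U2 B"
    unfolding branch_prod_def using f(2) by blast+
  ultimately show "\<exists>b\<in>branch_prod U1 B. \<exists>c\<in>branch_prod U2 B. p = b \<circ> c" by blast
qed

end

section \<open>Dimensions of subgroups supported on antichains\<close>

text \<open>For an antichain \<open>U\<close>, the proportion of the vertices of a deep level that lie below \<open>U\<close>; this is the
  dimension expected of a group acting independently and fully below the members of \<open>U\<close>.\<close>

definition weight :: "'a::finite list set \<Rightarrow> real" where
  "weight U = (\<Sum>v\<in>U. (1 / real CARD('a)) ^ length v)"

lemma card_level_below:
  assumes "length (v :: 'a::finite list) \<le> k"
  shows "card {u \<in> level k. prefix v u} = CARD('a) ^ (k - length v)"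
proof -
  have "{u \<in> level k. prefix v u} = (\<lambda>w. v @ w) ` level (k - length v)"
    using assms by (auto simp: level_def prefix_def)
  moreover have "inj_on (\<lambda>w. v @ w) (level (k - length v))" by (auto simp: inj_on_def)
  ultimately show ?thesis by (simp add: card_image card_level)
qed

lemma card_level_below_antichain:
  fixes U :: "'a::finite list set"
  assumes U: "finite U" "antichain U" and k: "\<And>v. v \<in> U \<Longrightarrow> length v \<le> k"
  shows "real (card {u \<in> level k. \<exists>v\<in>U. prefix v u}) = weight U * real CARD('a) ^ k"
proof -
  have "{u \<in> level k. \<exists>v\<in>U. prefix v u} = (\<Union>v\<in>U. {u \<in> level k. prefix v u})" by auto
  moreover have "card (\<Union>v\<in>U. {u \<in> level k. prefix v u}) = (\<Sum>v\<in>U. card {u \<in> level k. prefix v u})"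
  proof (rule card_UN_disjoint)
    show "\<forall>v\<in>U. \<forall>w\<in>U. v \<noteq> w \<longrightarrow> {u \<in> level k. prefix v u} \<inter> {u \<in> level k. prefix w u} = {}"
      using antichain_unique[OF U(2)] by blast
  qed (use U(1) in auto)
  moreover have "(\<Sum>v\<in>U. card {u \<in> level k. prefix v u}) = (\<Sum>v\<in>U. CARD('a) ^ (k - length v))"
    by (rule sum.cong[OF refl]) (simp add: card_level_below k)
  moreover have "real (CARD('a) ^ (k - length v)) =
      (1 / real CARD('a)) ^ length v * real CARD('a) ^ k" if "v \<in> U" for v
    using k[OF that] unfolding of_nat_power by (simp add: power_diff power_divide)
  ultimately show ?thesis by (simp add: weight_def sum_distrib_right)
qed

text \<open>The dimension count rests on two properties of a filtration: on every level the rigid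
  stabilizers are eventually no larger than independence modulo the filtration would allow, and the
  copies of the derived subgroup of \<open>C\<close> fill the whole group up to a factor whose logarithm is negligible.\<close>

locale balanced_filtration = regular_branch_group +
  fixes N :: "nat \<Rightarrow> ('a list \<Rightarrow> 'a list) set"
  assumes quotient: "finite_quotient \<Gamma> (N i)"
    and rist_le: "k \<ge> 1 \<Longrightarrow>
      \<forall>\<^sub>F i in sequentially. (\<Prod>v\<in>level k. ix (N i) (rist \<Gamma> v)) \<le> ix (N i) \<Gamma>"
    and derived_large: "\<exists>E. (\<lambda>i. E i / ln (real (ix (N i) \<Gamma>))) \<longlonglongrightarrow> 0 \<and>
      (\<forall>\<^sub>F i in sequentially. ln (real (ix (N i) \<Gamma>)) \<le>
         E i + ln (real (ix (N i) (branch_prod (level k) D))))"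
    and nontrivial: "\<forall>\<^sub>F i in sequentially. ix (N i) \<Gamma> \<ge> 2"
begin

lemma ix_rist_eq:
  assumes "length u = length w"
  shows "ix (N i) (rist \<Gamma> u) = ix (N i) (rist \<Gamma> w)"
proof -
  obtain g where "g \<in> G" "g u = w" using transitive[OF assms] by blast
  then show ?thesis using finite_quotient.ix_rist_conj[OF quotient, of g i u] G\<Gamma> by auto
qed

lemma rist_subset: "rist \<Gamma> v \<subseteq> \<Gamma>" and id_rist: "id \<in> rist \<Gamma> v"
  using sub_id[OF \<Gamma>] by (auto simp: rist_def)

lemma ix_rist_pos: "ix (N i) (rist \<Gamma> v) \<ge> 1"
  by (rule finite_quotient.ix_pos[OF quotient rist_subset]) (use id_rist in blast)

text \<open>All rigid stabilizers of one level have the same index, so each of them takes at most its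
  equal share of the logarithm.\<close>

lemma ln_rist_le:
  assumes "k \<ge> 1"
  shows "\<forall>\<^sub>F i in sequentially. \<forall>v\<in>level k.
    ln (real (ix (N i) (rist \<Gamma> v))) \<le> (1 / real CARD('a)) ^ k * ln (real (ix (N i) \<Gamma>))"
  using rist_le[OF assms]
proof eventually_elim
  case (elim i)
  show ?case
  proof
    fix v :: "'a list" assume v: "v \<in> level k"
    let ?r = "ix (N i) (rist \<Gamma> v)"
    have eq: "ix (N i) (rist \<Gamma> w) = ?r" if "w \<in> level k" for w
      by (rule ix_rist_eq) (use v that in \<open>simp add: level_def\<close>)
    have "(\<Prod>w\<in>level k. ix (N i) (rist \<Gamma> w)) = (\<Prod>w\<in>(level k :: 'a list set). ?r)"
      by (rule prod.cong[OF refl eq])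
    then have "?r ^ (CARD('a) ^ k) \<le> ix (N i) \<Gamma>" using elim by (simp add: card_level)
    then have "real (?r ^ (CARD('a) ^ k)) \<le> real (ix (N i) \<Gamma>)" by (simp only: of_nat_le_iff)
    moreover have "real (?r ^ (CARD('a) ^ k)) > 0" using ix_rist_pos[of i v] by simp
    ultimately have "ln (real (?r ^ (CARD('a) ^ k))) \<le> ln (real (ix (N i) \<Gamma>))"
      by (simp add: ln_mono)
    then have "real CARD('a) ^ k * ln (real ?r) \<le> ln (real (ix (N i) \<Gamma>))"
      using ix_rist_pos[of i v] by (simp add: ln_realpow)
    then show "ln (real ?r) \<le> (1 / real CARD('a)) ^ k * ln (real (ix (N i) \<Gamma>))"
      using card2 by (simp add: power_divide field_simps)
  qed
qed

lemma upper_estimate: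
  assumes U: "finite U" "\<And>u. u \<in> U \<Longrightarrow> u \<noteq> []"
    and H: "H \<noteq> {}" "H \<subseteq> \<Gamma>" and le: "\<And>i. ix (N i) H \<le> (\<Prod>u\<in>U. ix (N i) (rist \<Gamma> u))"
  shows "\<forall>\<^sub>F i in sequentially. ln (real (ix (N i) H)) \<le> weight U * ln (real (ix (N i) \<Gamma>))"
proof -
  have "\<forall>\<^sub>F i in sequentially. \<forall>k\<in>length ` U. \<forall>v\<in>level k.
      ln (real (ix (N i) (rist \<Gamma> v))) \<le> (1 / real CARD('a)) ^ k * ln (real (ix (N i) \<Gamma>))"
    by (rule eventually_ball_finite) (use U ln_rist_le in \<open>auto simp: Suc_le_eq\<close>)
  then show ?thesis
  proof eventually_elim
    case (elim i)
    have pos: "real (ix (N i) (rist \<Gamma> u)) > 0" for u using ix_rist_pos[of i u] by simp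
    have "real (ix (N i) H) \<le> (\<Prod>u\<in>U. real (ix (N i) (rist \<Gamma> u)))"
      using le[of i] unfolding of_nat_prod[symmetric] of_nat_le_iff .
    moreover have "real (ix (N i) H) > 0" using finite_quotient.ix_pos[OF quotient H(2,1), of i] by simp
    ultimately have "ln (real (ix (N i) H)) \<le> ln (\<Prod>u\<in>U. real (ix (N i) (rist \<Gamma> u)))"
      by (simp add: ln_mono)
    also have "\<dots> = (\<Sum>u\<in>U. ln (real (ix (N i) (rist \<Gamma> u))))" using U(1) pos by (intro ln_prod) auto
    also have "\<dots> \<le> (\<Sum>u\<in>U. (1 / real CARD('a)) ^ length u * ln (real (ix (N i) \<Gamma>)))"
      using elim by (intro sum_mono) (auto simp: level_def)
    also have "\<dots> = weight U * ln (real (ix (N i) \<Gamma>))" by (simp add: weight_def sum_distrib_right)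
    finally show ?case .
  qed
qed

text \<open>A lower bound obtained from upper bounds: the copies of \<open>D\<close> at a level nearly fill \<open>\<Gamma>\<close>, and those
  that do not lie below \<open>U\<close> contribute at most the share of their rigid stabilizers, so that the copies
  below \<open>U\<close>, which are contained in \<open>H\<close>, must account for the rest.\<close>

lemma lower_estimate:
  assumes U: "finite U" "antichain U" and H: "subgroup H Aut_tree" "H \<subseteq> \<Gamma>"
    and fill: "\<And>v. v \<in> U \<Longrightarrow> \<exists>t. \<forall>w\<in>level t. \<forall>d\<in>D. lift (v @ w) d \<in> H"
    and \<epsilon>: "\<epsilon> > 0"
  shows "\<forall>\<^sub>F i in sequentially. (weight U - \<epsilon>) * ln (real (ix (N i) \<Gamma>)) \<le> ln (real (ix (N i) H))"
proof -
  obtain t where t: "\<And>v w d. \<lbrakk>v \<in> U; w \<in> level (t v); d \<in> D\<rbrakk> \<Longrightarrow> lift (v @ w) d \<in> H"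
    using fill by metis
  \<comment> \<open>Deep enough that every vertex of level \<open>k\<close> below some \<open>v \<in> U\<close> is also below the level that \<open>H\<close> fills there.\<close>
  define k where "k = Suc (\<Sum>v\<in>U. length v + t v)"
  have k: "length v + t v \<le> k" if "v \<in> U" for v
    unfolding k_def using member_le_sum[of v U "\<lambda>v. length v + t v"] U(1) that by simp
  have k1: "k \<ge> 1" by (simp add: k_def)
  let ?W = "{u \<in> level k. \<exists>v\<in>U. prefix v u}" and ?W' = "{u \<in> level k. \<not> (\<exists>v\<in>U. prefix v u)}"
  let ?m = "real CARD('a)"
  have split: "level k = ?W \<union> ?W'" "?W \<inter> ?W' = {}" by auto
  have cW: "real (card ?W) = weight U * ?m ^ k"
    by (rule card_level_below_antichain[OF U]) (use k in force)
  have "card (level k :: 'a list set) = card ?W + card ?W'"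
    by (subst split(1), rule card_Un_disjoint) (auto intro: finite_subset[OF _ finite_level])
  then have cW': "real (card ?W') = ?m ^ k - weight U * ?m ^ k"
    unfolding card_level using cW by (simp only: of_nat_power[symmetric] of_nat_add)
  have acW: "antichain ?W" and acW': "antichain ?W'"
    by (auto intro: antichain_subset[OF antichain_level])
  have finW: "finite ?W" and finW': "finite ?W'" by (auto intro: finite_subset[OF _ finite_level])
  have lift_H: "lift u d \<in> H" if u: "u \<in> ?W" and d: "d \<in> D" for u d
  proof -
    obtain v w where v: "v \<in> U" "u = v @ w" using u by (auto simp: prefix_def)
    have "length u = k" using u by (simp add: level_def)
    then have "t v \<le> length w" using k[OF v(1)] v(2) by simp
    then have "take (t v) w \<in> level (t v)" by (simp add: level_def)
    then have "lift (v @ take (t v) w) (lift (drop (t v) w) d) \<in> H"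
      using v(1) D_lift[OF d] by (intro t)
    then show ?thesis by (simp add: lift_lift v(2))
  qed
  have sub: "branch_prod ?W D \<subseteq> H"
  proof
    fix p assume "p \<in> branch_prod ?W D"
    then obtain f where f: "p = spread ?W f" "\<forall>u\<in>?W. f u \<in> D" by (auto simp: branch_prod_def)
    show "p \<in> H" unfolding f(1)
      by (rule spread_finite_in_subgroup[OF H(1) finW acW], rule lift_H) (use f(2) in auto)
  qed
  have D\<Gamma>: "b \<in> Aut \<and> lift u b \<in> \<Gamma>" if "b \<in> D" for u b
    using that D_Aut D_lift DC CG G\<Gamma> by blast
  have ineq: "ix (N i) (branch_prod (level k) D) \<le> ix (N i) H * (\<Prod>u\<in>?W'. ix (N i) (rist \<Gamma> u))" for i
  proof -
    interpret q: finite_quotient \<Gamma> "N i" by (rule quotient)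
    have "ix (N i) (branch_prod (?W \<union> ?W') D) \<le> ix (N i) (branch_prod ?W D) * ix (N i) (branch_prod ?W' D)"
      by (rule q.ix_branch_prod_union_le)
        (use split finite_level antichain_level D\<Gamma> in \<open>auto simp flip: split(1)\<close>)
    also have "\<dots> \<le> ix (N i) H * (\<Prod>u\<in>?W'. ix (N i) (rist \<Gamma> u))"
      by (intro mult_mono q.ix_mono[OF sub H(2)] q.ix_branch_prod_le[OF finW' acW'] D\<Gamma>) auto
    finally show ?thesis using split(1) by simp
  qed
  obtain E where E: "(\<lambda>i. E i / ln (real (ix (N i) \<Gamma>))) \<longlonglongrightarrow> 0"
    and E_le: "\<forall>\<^sub>F i in sequentially. ln (real (ix (N i) \<Gamma>)) \<le>
         E i + ln (real (ix (N i) (branch_prod (level k) D)))"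
    using derived_large by blast
  have "\<forall>\<^sub>F i in sequentially. E i / ln (real (ix (N i) \<Gamma>)) < \<epsilon>"
    using E \<epsilon> by (rule order_tendstoD(2))
  with E_le ln_rist_le[OF k1] nontrivial show ?thesis
  proof eventually_elim
    case (elim i)
    interpret q: finite_quotient \<Gamma> "N i" by (rule quotient)
    let ?L = "ln (real (ix (N i) \<Gamma>))"
    have L: "?L > 0" using elim(3) by simp
    have posr: "real (ix (N i) (rist \<Gamma> u)) > 0" for u using ix_rist_pos[of i u] by simp
    have "H \<noteq> {}" using sub_id[OF H(1)] by blast
    then have posH: "real (ix (N i) H) > 0" using q.ix_pos[OF H(2)] by simp
    have "spread (level k) (\<lambda>_. id) \<in> branch_prod (level k) D"
      unfolding branch_prod_def using sub_id[OF D] by blast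
    then have ne: "branch_prod (level k) D \<noteq> {}" by blast
    have "branch_prod (level k) D \<subseteq> \<Gamma>" using branch_prod_level_G[OF DC] G\<Gamma> by blast
    then have posD: "real (ix (N i) (branch_prod (level k) D)) > 0"
      using q.ix_pos[OF _ ne] by simp
    have "real (ix (N i) (branch_prod (level k) D)) \<le>
        real (ix (N i) H) * (\<Prod>u\<in>?W'. real (ix (N i) (rist \<Gamma> u)))"
      using ineq[of i] unfolding of_nat_prod[symmetric] of_nat_mult[symmetric] of_nat_le_iff .
    then have "ln (real (ix (N i) (branch_prod (level k) D))) \<le>
        ln (real (ix (N i) H) * (\<Prod>u\<in>?W'. real (ix (N i) (rist \<Gamma> u))))"
      by (rule ln_mono[OF _ posD])
    also have "\<dots> = ln (real (ix (N i) H)) + ln (\<Prod>u\<in>?W'. real (ix (N i) (rist \<Gamma> u)))"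
      using posH posr by (intro ln_mult_pos prod_pos) auto
    also have "ln (\<Prod>u\<in>?W'. real (ix (N i) (rist \<Gamma> u))) = (\<Sum>u\<in>?W'. ln (real (ix (N i) (rist \<Gamma> u))))"
      using finW' posr by (intro ln_prod) auto
    also have "\<dots> \<le> (\<Sum>u\<in>?W'. (1 / ?m) ^ k * ?L)" using elim(2) by (intro sum_mono) auto
    also have "\<dots> = (?m ^ k - weight U * ?m ^ k) * ((1 / ?m) ^ k * ?L)" by (simp only: sum_constant cW')
    also have "\<dots> = (1 - weight U) * ?L" using card2 by (simp add: field_simps power_divide)
    finally have "?L \<le> E i + (ln (real (ix (N i) H)) + (1 - weight U) * ?L)" using elim(1) by simp
    moreover have "E i \<le> \<epsilon> * ?L" using elim(4) L by (simp add: field_simps)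
    ultimately show ?case by (simp add: algebra_simps)
  qed
qed

text \<open>The terms of the filtration are open, so the dimension of the closure is read off from the coset
  counts of \<open>H\<close> itself.\<close>

lemma hdim_eq:
  assumes H: "subgroup H Aut_tree" "H \<subseteq> \<Gamma>"
    and up: "\<And>\<epsilon>. \<epsilon> > 0 \<Longrightarrow> \<exists>U. finite U \<and> (\<forall>u\<in>U. u \<noteq> []) \<and> weight U \<le> \<alpha> + \<epsilon> \<and>
      (\<forall>i. ix (N i) H \<le> (\<Prod>u\<in>U. ix (N i) (rist \<Gamma> u)))"
    and low: "\<And>\<epsilon>. \<epsilon> > 0 \<Longrightarrow> \<exists>U. finite U \<and> antichain U \<and> \<alpha> - \<epsilon> \<le> weight U \<and>
      (\<forall>v\<in>U. \<exists>t. \<forall>w\<in>level t. \<forall>d\<in>D. lift (v @ w) d \<in> H)"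
  shows "hdim \<Gamma> N (congruence_topology closure_of H) = ereal \<alpha>"
proof -
  let ?L = "\<lambda>i. ln (real (ix (N i) \<Gamma>))" and ?H = "\<lambda>i. ln (real (ix (N i) H))"
  have "H \<noteq> {}" using sub_id[OF H(1)] by blast
  have "(\<lambda>i. ?H i / ?L i) \<longlonglongrightarrow> \<alpha>"
  proof (rule order_tendstoI)
    fix a assume a: "a < \<alpha>"
    define \<epsilon> where "\<epsilon> = (\<alpha> - a) / 3"
    have \<epsilon>: "\<epsilon> > 0" "a < \<alpha> - \<epsilon> - \<epsilon>" using a by (auto simp: \<epsilon>_def field_simps)
    obtain U where U: "finite U" "antichain U" "\<alpha> - \<epsilon> \<le> weight U"
      "\<forall>v\<in>U. \<exists>t. \<forall>w\<in>level t. \<forall>d\<in>D. lift (v @ w) d \<in> H" using low[OF \<epsilon>(1)] by blast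
    have "\<forall>\<^sub>F i in sequentially. (weight U - \<epsilon>) * ?L i \<le> ?H i"
      by (rule lower_estimate[OF U(1,2) H _ \<epsilon>(1)]) (use U(4) in blast)
    with nontrivial show "\<forall>\<^sub>F i in sequentially. a < ?H i / ?L i"
    proof eventually_elim
      case (elim i)
      have L: "?L i > 0" using elim(1) by simp
      have "a < weight U - \<epsilon>" using U(3) \<epsilon> by simp
      also have "\<dots> \<le> ?H i / ?L i" using elim(2) L by (simp add: pos_le_divide_eq)
      finally show ?case .
    qed
  next
    fix a assume a: "\<alpha> < a"
    define \<epsilon> where "\<epsilon> = (a - \<alpha>) / 2"
    have \<epsilon>: "\<epsilon> > 0" "\<alpha> + \<epsilon> < a" using a by (auto simp: \<epsilon>_def field_simps)
    obtain U where U: "finite U" "\<forall>u\<in>U. u \<noteq> []" "weight U \<le> \<alpha> + \<epsilon>"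
      "\<forall>i. ix (N i) H \<le> (\<Prod>u\<in>U. ix (N i) (rist \<Gamma> u))" using up[OF \<epsilon>(1)] by blast
    have "\<forall>\<^sub>F i in sequentially. ?H i \<le> weight U * ?L i"
      by (rule upper_estimate[OF U(1) _ \<open>H \<noteq> {}\<close> H(2)]) (use U(2,4) in blast)+
    with nontrivial show "\<forall>\<^sub>F i in sequentially. ?H i / ?L i < a"
    proof eventually_elim
      case (elim i)
      have L: "?L i > 0" using elim(1) by simp
      have "?H i / ?L i \<le> weight U" using elim(2) L by (simp add: pos_divide_le_eq)
      also have "\<dots> < a" using U(3) \<epsilon> by simp
      finally show ?case .
    qed
  qed
  then have lim: "(\<lambda>i. ereal (?H i / ?L i)) \<longlonglongrightarrow> ereal \<alpha>" by simp
  have cl: "congruence_topology closure_of H \<subseteq> \<Gamma>"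
    using H(2) unfolding \<Gamma>_def by (rule closure_of_minimal) (rule closedin_closure_of)
  have "subgroup_index (congruence_topology closure_of H <#>\<^bsub>Aut_tree\<^esub> N i) (N i) = ix (N i) H" for i
    using finite_quotient.subgroup_index_product[OF quotient cl] finite_quotient.ix_closure[OF quotient H(2) cl]
    by metis
  then have "hdim \<Gamma> N (congruence_topology closure_of H) = liminf (\<lambda>i. ereal (?H i / ?L i))"
    unfolding hdim_def by (simp add: finite_quotient.subgroup_index_\<Gamma>[OF quotient])
  also have "\<dots> = ereal \<alpha>" using lim by (intro lim_imp_Liminf) auto
  finally show ?thesis .
qed

end

section \<open>Finitely generated subgroups supported on infinite antichains\<close>

lemma comm_id [simp]: "h \<in> Aut \<Longrightarrow> comm id h = id" "h \<in> Aut \<Longrightarrow> comm h id = id"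
  by (simp_all add: comm_def)

lemma spread_comm:
  assumes V: "antichain V" and f: "\<And>v. v \<in> V \<Longrightarrow> f v \<in> Aut" and g: "\<And>v. v \<in> V \<Longrightarrow> g v \<in> Aut"
  shows "comm (spread V f) (spread V g) = spread V (\<lambda>v. comm (f v) (g v))"
proof -
  have 1: "ginv (spread V f) = spread V (\<lambda>u. ginv (f u))" by (rule ginv_spread[OF V f])
  have 2: "ginv (spread V g) = spread V (\<lambda>u. ginv (g u))" by (rule ginv_spread[OF V g])
  show ?thesis unfolding comm_def 1 2 spread_comp[OF V] ..
qed

lemma lift_eq_spread:
  assumes "antichain V" "v \<in> V"
  shows "lift v y = spread V (\<lambda>w. if w = v then y else id)"
proof -
  have "lift v y = spread {v} (\<lambda>w. if w = v then y else id)" by (rule spread_cong) auto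
  also have "\<dots> = spread V (\<lambda>w. if w = v then y else id)"
    by (rule spread_subset[OF assms(1)]) (use assms(2) in auto)
  finally show ?thesis .
qed

lemma conj_lift_by_spread:
  assumes V: "antichain V" "v \<in> V" and k: "k \<in> Aut"
  shows "spread V (\<lambda>_. k) \<circ> lift v y \<circ> ginv (spread V (\<lambda>_. k)) = lift v (k \<circ> y \<circ> ginv k)"
proof -
  have e: "ginv (spread V (\<lambda>_. k)) = spread V (\<lambda>_. ginv k)" by (rule ginv_spread[OF V(1) k])
  show ?thesis
    unfolding e lift_eq_spread[OF V] spread_comp[OF V(1)]
    by (rule spread_cong[OF V(1)]) (use k in auto)
qed

lemma branch_prodI: "(\<And>u. u \<in> U \<Longrightarrow> f u \<in> B) \<Longrightarrow> spread U f \<in> branch_prod U B"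
  unfolding branch_prod_def by blast

lemma branch_prod_subgroup:
  assumes V: "antichain V" and B: "subgroup B Aut_tree"
  shows "subgroup (branch_prod V B) Aut_tree"
proof (rule subgroup_AutI)
  show "branch_prod V B \<subseteq> Aut"
  proof
    fix p assume "p \<in> branch_prod V B"
    then obtain f where f: "p = spread V f" "\<forall>u\<in>V. f u \<in> B" by (auto simp: branch_prod_def)
    show "p \<in> Aut" unfolding f(1) by (rule spread_Aut[OF V sub_Aut[OF B]]) (use f(2) in blast)
  qed
  show "id \<in> branch_prod V B"
    unfolding branch_prod_def
    by (rule CollectI, rule exI[of _ "\<lambda>_. id"]) (intro conjI ballI spread_id[OF V, symmetric] sub_id[OF B])
  fix p assume "p \<in> branch_prod V B"
  then obtain f where f: "p = spread V f" "\<forall>u\<in>V. f u \<in> B" by (auto simp: branch_prod_def)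
  have fA: "f u \<in> Aut" if "u \<in> V" for u using sub_Aut[OF B] f(2) that by blast
  have e: "ginv (spread V f) = spread V (\<lambda>u. ginv (f u))" by (rule ginv_spread[OF V fA])
  show "ginv p \<in> branch_prod V B"
    unfolding f(1) e by (rule branch_prodI, rule sub_ginv[OF B]) (use f(2) in blast)
  fix q assume "q \<in> branch_prod V B"
  then obtain g where g: "q = spread V g" "\<forall>u\<in>V. g u \<in> B" by (auto simp: branch_prod_def)
  show "p \<circ> q \<in> branch_prod V B"
    unfolding f(1) g(1) spread_comp[OF V]
    by (rule branch_prodI, rule sub_comp[OF B]) (use f(2) g(2) in blast)+
qed

lemma comm_comp_left:
  assumes "g \<in> Aut" "g' \<in> Aut" "h \<in> Aut"
  shows "comm (g \<circ> g') h = (g \<circ> comm g' h \<circ> ginv g) \<circ> comm g h"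
proof -
  have "ginv (g \<circ> g') = ginv g' \<circ> ginv g" by (rule ginv_comp[OF assms(1,2)])
  then show ?thesis using assms by (simp add: comm_def fun_eq_iff)
qed

lemma comm_ginv_left:
  assumes "g \<in> Aut" "h \<in> Aut"
  shows "comm (ginv g) h = ginv g \<circ> ginv (comm g h) \<circ> g"
proof -
  have "ginv (comm g h) = h \<circ> g \<circ> ginv h \<circ> ginv g"
    by (rule ginv_eqI) (use assms in \<open>simp_all add: comm_def\<close>)
  then show ?thesis using assms by (simp add: comm_def fun_eq_iff)
qed

lemma prefix_take: "prefix u w \<Longrightarrow> u = take (length u) w"
  by (auto simp: prefix_def)

lemma prefix_replicate: "n \<le> m \<Longrightarrow> prefix (replicate n x) (replicate m x)"
  using replicate_add[of n "m - n" x] by (simp add: prefix_def)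

context regular_branch_group
begin

text \<open>Finitely many images of a ray that agree down to a sufficiently deep level agree forever.\<close>

lemma ray_images_separate:
  "\<exists>n0. \<forall>t\<in>T. \<forall>t'\<in>T. t (replicate n0 x) = t' (replicate n0 x) \<longrightarrow>
     (\<forall>n. t (replicate n x) = t' (replicate n x))"
proof -
  have "\<forall>p. \<exists>k. (\<exists>n. (fst p :: 'a list \<Rightarrow> 'a list) (replicate n x) \<noteq> snd p (replicate n x)) \<longrightarrow>
      fst p (replicate k x) \<noteq> snd p (replicate k x)" by blast
  from choice[OF this] obtain k where
    k: "\<And>p. (\<exists>n. (fst p :: 'a list \<Rightarrow> 'a list) (replicate n x) \<noteq> snd p (replicate n x)) \<Longrightarrow>
      fst p (replicate (k p) x) \<noteq> snd p (replicate (k p) x)" by blast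
  define n0 where "n0 = (\<Sum>p\<in>T \<times> T. k p)"
  have "t (replicate n x) = t' (replicate n x)"
    if t: "t \<in> T" "t' \<in> T" "t (replicate n0 x) = t' (replicate n0 x)" for t t' n
  proof (rule ccontr)
    assume "t (replicate n x) \<noteq> t' (replicate n x)"
    then have ne: "t (replicate (k (t, t')) x) \<noteq> t' (replicate (k (t, t')) x)"
      using k[of "(t, t')"] by auto
    have tA: "t \<in> Aut" "t' \<in> Aut" using t T(2) G_Aut by auto
    have "k (t, t') \<le> n0"
      unfolding n0_def using member_le_sum[of "(t, t')" "T \<times> T" k] T(1) t by simp
    then have p: "prefix (replicate (k (t, t')) x) (replicate n0 x)" by (rule prefix_replicate)
    have "t (replicate (k (t, t')) x) = t' (replicate (k (t, t')) x)"
      using prefix_take[OF Aut_prefix_mono[OF tA(1) p]] prefix_take[OF Aut_prefix_mono[OF tA(2) p]]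
        t(3) by (simp add: Aut_length[OF tA(1)] Aut_length[OF tA(2)])
    then show False using ne by simp
  qed
  then show ?thesis by blast
qed

text \<open>An infinite supply of pairwise incomparable finite sets of vertices, each of which meets every
  orbit of \<open>C\<close> on its level. The representatives \<open>t\<close> of the cosets of \<open>C\<close> turn a single vertex \<open>u\<close> into
  such a set because the whole group is transitive. Taking \<open>u\<close> to hang off a fixed ray far down, the
  images hang off the finitely many image rays, below the levels where these rays split.\<close>

lemma marked_vertices:
  "\<exists>U \<tau>. (\<forall>n::nat. U n \<subseteq> level (\<tau> n)) \<and> antichain (\<Union>n. U n) \<and> (\<forall>n n'. n \<noteq> n' \<longrightarrow> U n \<inter> U n' = {}) \<and>
     (\<forall>n. \<forall>w\<in>level (\<tau> n). \<exists>c\<in>C. \<exists>p\<in>U n. c p = w)"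
proof -
  have "\<exists>x y :: 'a. x \<noteq> y" using card2 card_le_Suc0_iff_eq[of "UNIV :: 'a set"] by fastforce
  then obtain x y :: 'a where xy: "x \<noteq> y" by blast
  obtain n0 where n0: "\<And>t t' n. \<lbrakk>t \<in> T; t' \<in> T; t (replicate n0 x) = t' (replicate n0 x)\<rbrakk> \<Longrightarrow>
      t (replicate n x) = t' (replicate n x)" using ray_images_separate[of x] by blast
  define u where "u n = replicate (n + n0) x @ [y]" for n
  define U where "U n = (\<lambda>t. t (u n)) ` T" for n
  define \<tau> where "\<tau> n = Suc (n + n0)" for n
  have TA: "t \<in> Aut" if "t \<in> T" for t using T(2) G_Aut that by blast
  have lev: "U n \<subseteq> level (\<tau> n)" for n
    by (auto simp: U_def level_def \<tau>_def u_def Aut_length[OF TA])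
  have no: False if t: "t \<in> T" "t' \<in> T" and n: "n < n'" and p: "prefix (t (u n)) (t' (u n'))" for t t' n n'
  proof -
    let ?s = "\<lambda>k. replicate k x"
    have p1: "prefix (?s (Suc (n + n0))) (u n')"
      unfolding u_def using n prefix_replicate[of "Suc (n + n0)" "n' + n0" x] by (simp add: prefix_prefix)
    have eq: "t (u n) = t' (?s (Suc (n + n0)))"
      using prefix_take[OF p] prefix_take[OF Aut_prefix_mono[OF TA[OF t(2)] p1]]
      by (simp add: Aut_length[OF TA[OF t(1)]] Aut_length[OF TA[OF t(2)]] u_def)
    have p2: "prefix (?s n0) (u n)"
      unfolding u_def using prefix_replicate[of n0 "n + n0" x] by (simp add: prefix_prefix)
    have p3: "prefix (?s n0) (?s (Suc (n + n0)))" by (rule prefix_replicate) simp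
    have "t (?s n0) = t' (?s n0)"
      using prefix_take[OF Aut_prefix_mono[OF TA[OF t(1)] p2]]
        prefix_take[OF Aut_prefix_mono[OF TA[OF t(2)] p3]] eq
      by (simp add: Aut_length[OF TA[OF t(1)]] Aut_length[OF TA[OF t(2)]])
    then have "t (?s (Suc (n + n0))) = t' (?s (Suc (n + n0)))" by (rule n0[OF t])
    then have "?s (Suc (n + n0)) = u n" using eq Aut_inj[OF TA[OF t(1)]] by metis
    then have "last (?s (Suc (n + n0))) = last (u n)" by simp
    then show False using xy by (simp add: u_def del: replicate_Suc)
  qed
  have len: "length p = \<tau> n" if "p \<in> U n" for p n using lev that by (auto simp: level_def)
  have ac: "antichain (\<Union>n. U n)" unfolding antichain_def
  proof (intro ballI impI)
    fix p p' assume "p \<in> (\<Union>n. U n)" "p' \<in> (\<Union>n. U n)" and pr: "prefix p p'"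
    then obtain n n' where nn: "p \<in> U n" "p' \<in> U n'" by blast
    then obtain t t' where t: "t \<in> T" "t' \<in> T" "p = t (u n)" "p' = t' (u n')" by (auto simp: U_def)
    have "n \<le> n'" using prefix_length_le[OF pr] len[OF nn(1)] len[OF nn(2)] by (simp add: \<tau>_def)
    moreover have "\<not> n < n'" using no[OF t(1,2)] pr t(3,4) by blast
    ultimately have "length p = length p'" using len[OF nn(1)] len[OF nn(2)] by simp
    then show "p = p'" using prefix_take[OF pr] by simp
  qed
  have disj: "U n \<inter> U n' = {}" if "n \<noteq> n'" for n n'
    using len[of _ n] len[of _ n'] that by (force simp: \<tau>_def)
  have orb: "\<exists>c\<in>C. \<exists>p\<in>U n. c p = w" if w: "w \<in> level (\<tau> n)" for w n
  proof -
    have "length (u n) = length w" using w by (simp add: u_def level_def \<tau>_def)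
    then obtain g where g: "g \<in> G" "g (u n) = w" using transitive by blast
    then obtain t c where tc: "t \<in> T" "c \<in> C" "g = c \<circ> t" using cover by blast
    then have "c (t (u n)) = w" using g(2) by simp
    then show ?thesis using tc by (auto simp: U_def)
  qed
  show ?thesis
    by (rule exI[of _ U], rule exI[of _ \<tau>]) (intro conjI allI impI ballI lev ac disj orb)
qed

lemma branch_prod_closure:
  assumes V: "antichain V"
  shows "branch_prod V C \<subseteq> \<Gamma>"
proof
  fix p assume "p \<in> branch_prod V C"
  then obtain f where f: "p = spread V f" "\<forall>v\<in>V. f v \<in> C" by (auto simp: branch_prod_def)
  show "p \<in> \<Gamma>" unfolding f(1) \<Gamma>_def
    by (rule spread_in_closure[OF G V]) (use f(2) C_Aut C_lift CG in blast)+
qed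

text \<open>The generators are the diagonal copies of the generators of \<open>C\<close> along the antichain \<open>V\<close>, and, for
  each generator \<open>a\<close>, the element that acts below each \<open>v \<in> V\<close> as copies of \<open>a\<close> at marked vertices, with
  different marks for different \<open>v\<close>. A diagonal element supported below a mark \<open>u\<close> of \<open>v\<close> commutes with
  all other copies of \<open>a\<close>; the commutator of the two is therefore concentrated below \<open>v @ u\<close>, and such
  commutators generate a copy of the derived subgroup \<open>D\<close>. Conjugating by the diagonal moves it to all
  vertices of the level of the mark, as every orbit of \<open>C\<close> contains a mark.\<close>

lemma antichain_generators:
  assumes V: "antichain V"
  shows "\<exists>S. finite S \<and> card S \<le> 2 * card A \<and> generate Aut_tree S \<subseteq> branch_prod V C \<and> S \<subseteq> Aut \<and>
    (\<forall>v\<in>V. \<exists>t. \<forall>w\<in>level t. \<forall>d\<in>D. lift (v @ w) d \<in> generate Aut_tree S)"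
proof -
  obtain U \<tau> where marks: "\<forall>n::nat. U n \<subseteq> level (\<tau> n)" and ac: "antichain (\<Union>n. U n)"
    and marks': "\<forall>n n'. n \<noteq> n' \<longrightarrow> U n \<inter> U n' = {}"
      "\<forall>n. \<forall>w\<in>level (\<tau> n). \<exists>c\<in>C. \<exists>p\<in>U n. c p = w"
    using marked_vertices by (elim exE conjE) (rule that)
  have lev: "U n \<subseteq> level (\<tau> n)" for n using marks by (rule spec)
  have disj: "U n \<inter> U n' = {}" if "n \<noteq> n'" for n n' using marks'(1) that by iprover
  have orb: "\<exists>c\<in>C. \<exists>p\<in>U n. c p = w" if "w \<in> level (\<tau> n)" for n w
    by (rule bspec[OF spec[OF marks'(2)] that])
  obtain \<iota> :: "'a list \<Rightarrow> nat" where \<iota>: "inj \<iota>" using ex_inj by blast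
  let ?W = "\<Union>n. U n"
  have acU: "antichain (U n)" for n by (rule antichain_subset[OF ac]) blast
  have finU: "finite (U n)" for n using finite_subset[OF lev finite_level] .
  define diag where "diag g = spread V (\<lambda>_. g)" for g :: "'a list \<Rightarrow> 'a list"
  define mark where "mark a = spread V (\<lambda>v. spread (U (\<iota> v)) (\<lambda>_. a))" for a :: "'a list \<Rightarrow> 'a list"
  define S where "S = diag ` A \<union> mark ` A"
  let ?H = "generate Aut_tree S"
  have markC: "spread (U n) (\<lambda>_. a) \<in> C" if "a \<in> C" for a n
    by (rule spread_finite_in_subgroup[OF C finU acU C_lift[OF that]])
  have S_sub: "S \<subseteq> branch_prod V C"
  proof -
    have "diag a \<in> branch_prod V C" "mark a \<in> branch_prod V C" if "a \<in> A" for a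
    proof -
      have a: "a \<in> C" using A(3) that by blast
      show "diag a \<in> branch_prod V C" unfolding diag_def by (rule branch_prodI) (rule a)
      show "mark a \<in> branch_prod V C" unfolding mark_def by (rule branch_prodI) (rule markC[OF a])
    qed
    then show ?thesis unfolding S_def by blast
  qed
  have sgP: "subgroup (branch_prod V C) Aut_tree" by (rule branch_prod_subgroup[OF V C])
  have SA: "S \<subseteq> Aut" using S_sub sub_Aut[OF sgP] by blast
  have H: "subgroup ?H Aut_tree" by (rule Aut_group.generate_is_subgroup[OF SA])
  have H_sub: "?H \<subseteq> branch_prod V C" by (rule Aut_group.generate_subgroup_incl[OF S_sub sgP])
  have AA: "A \<subseteq> Aut" using A(3) C_Aut by blast
  have diag_H: "diag g \<in> ?H" if g: "g \<in> C" for g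
  proof (rule generate_hom_closed[where \<phi> = diag, OF AA H])
    show "diag id = id" unfolding diag_def by (rule spread_id[OF V])
    show "diag (a \<circ> b) = diag a \<circ> diag b" for a b unfolding diag_def spread_comp[OF V] ..
    show "diag (ginv a) = ginv (diag a)" if "a \<in> Aut" for a
      unfolding diag_def by (rule ginv_spread[OF V that, symmetric])
    show "diag a \<in> ?H" if "a \<in> A" for a by (rule generate.incl) (use that in \<open>auto simp: S_def\<close>)
    show "g \<in> generate Aut_tree A" using g A(2) by simp
  qed
  have mark_H: "mark a \<in> ?H" if "a \<in> A" for a
    by (rule generate.incl) (use that in \<open>auto simp: S_def\<close>)
  have conj_H: "lift v (k \<circ> y \<circ> ginv k) \<in> ?H" if "v \<in> V" "k \<in> C" "lift v y \<in> ?H" for v k y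
  proof -
    have "diag k \<circ> lift v y \<circ> ginv (diag k) \<in> ?H"
      using diag_H[OF that(2)] that(3) by (intro sub_comp[OF H] sub_ginv[OF H])
    then show ?thesis
      unfolding diag_def conj_lift_by_spread[OF V that(1) C_Aut[OF that(2)]] .
  qed
  have comm_mark: "comm (spread (U n) (\<lambda>_. a)) (lift u h) = (if u \<in> U n then lift u (comm a h) else id)"
    if a: "a \<in> Aut" and h: "h \<in> Aut" and u: "u \<in> ?W" for a h u n
  proof -
    let ?f = "\<lambda>p. if p \<in> U n then a else id" and ?g = "\<lambda>p. if p = u then h else id"
    have "spread (U n) (\<lambda>_. a) = spread (U n) ?f" by (rule spread_cong[OF acU]) simp
    also have "\<dots> = spread ?W ?f" by (rule spread_subset[OF ac]) auto
    finally have 1: "spread (U n) (\<lambda>_. a) = spread ?W ?f" .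
    have "comm (spread ?W ?f) (spread ?W ?g) = spread ?W (\<lambda>p. comm (?f p) (?g p))"
      by (rule spread_comm[OF ac]) (use a h in auto)
    also have "\<dots> = (if u \<in> U n then spread ?W (\<lambda>p. if p = u then comm a h else id) else spread ?W (\<lambda>_. id))"
      using a h by (auto intro!: spread_cong[OF ac])
    finally show ?thesis
      unfolding 1 lift_eq_spread[OF ac u] spread_id[OF ac] .
  qed
  \<comment> \<open>The commutator of a marking element with a diagonal element below \<open>u\<close> survives only at the \<open>v\<close> marked by \<open>u\<close>.\<close>
  have base: "lift (v @ u) (comm a h) \<in> ?H" if v: "v \<in> V" and u: "u \<in> U (\<iota> v)" and a: "a \<in> A" and h: "h \<in> C"
    for v u a h
  proof -
    have aA: "a \<in> Aut" and hA: "h \<in> Aut" using a AA C_Aut[OF h] by auto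
    have uW: "u \<in> ?W" using u by blast
    have "comm (mark a) (diag (lift u h)) \<in> ?H"
      using mark_H[OF a] diag_H[OF C_lift[OF h]] by (rule comm_in_subgroup[OF H])
    also have "comm (mark a) (diag (lift u h)) = spread V (\<lambda>w. comm (spread (U (\<iota> w)) (\<lambda>_. a)) (lift u h))"
      unfolding mark_def diag_def by (rule spread_comm[OF V]) (use hA aA spread_Aut[OF acU] in auto)
    also have "\<dots> = spread V (\<lambda>w. if w = v then lift u (comm a h) else id)"
    proof (rule spread_cong[OF V])
      fix w assume "w \<in> V"
      have "u \<in> U (\<iota> w) \<longleftrightarrow> w = v" using disj[of "\<iota> w" "\<iota> v"] u inj_eq[OF \<iota>, of w v] by blast
      then show "comm (spread (U (\<iota> w)) (\<lambda>_. a)) (lift u h) = (if w = v then lift u (comm a h) else id)"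
        using comm_mark[OF aA hA uW, of "\<iota> w"] by simp
    qed
    also have "\<dots> = lift v (lift u (comm a h))" by (rule lift_eq_spread[OF V v, symmetric])
    also have "\<dots> = lift (v @ u) (comm a h)" by (rule lift_lift)
    finally show ?thesis .
  qed
  \<comment> \<open>For fixed \<open>h\<close> the elements \<open>g\<close> with this property form a subgroup, because \<open>?H\<close> allows conjugation below \<open>v @ u\<close>.\<close>
  have comms: "lift (v @ u) (comm g h) \<in> ?H" if v: "v \<in> V" and u: "u \<in> U (\<iota> v)" and g: "g \<in> C" and h: "h \<in> C"
    for v u g h
  proof -
    have conj: "lift (v @ u) (k \<circ> y \<circ> ginv k) \<in> ?H" if k: "k \<in> C" and y: "lift (v @ u) y \<in> ?H" for k y
    proof -
      have "lift v (lift u k \<circ> lift u y \<circ> ginv (lift u k)) \<in> ?H"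
        by (rule conj_H[OF v C_lift[OF k]]) (use y in \<open>simp add: lift_lift\<close>)
      then show ?thesis unfolding ginv_lift[OF C_Aut[OF k]] lift_comp lift_lift .
    qed
    let ?X = "{g \<in> C. lift (v @ u) (comm g h) \<in> ?H}"
    have hA: "h \<in> Aut" using C_Aut[OF h] .
    have "subgroup ?X Aut_tree"
    proof (rule subgroup_AutI)
      show "?X \<subseteq> Aut" using C_Aut by blast
      show "id \<in> ?X" using sub_id[OF C] sub_id[OF H] hA by simp
      fix a assume a: "a \<in> ?X"
      then have aC: "a \<in> C" "a \<in> Aut" and aH: "lift (v @ u) (comm a h) \<in> ?H" using C_Aut by auto
      have "ginv (lift (v @ u) (comm a h)) \<in> ?H" using sub_ginv[OF H aH] .
      then have "lift (v @ u) (ginv (comm a h)) \<in> ?H"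
        unfolding ginv_lift[OF comm_Aut[OF aC(2) hA]] .
      from conj[OF sub_ginv[OF C aC(1)] this] have "lift (v @ u) (comm (ginv a) h) \<in> ?H"
        unfolding comm_ginv_left[OF aC(2) hA] ginv_ginv[OF aC(2)] .
      then show "ginv a \<in> ?X" using sub_ginv[OF C aC(1)] by simp
      fix b assume b: "b \<in> ?X"
      then have bC: "b \<in> C" "b \<in> Aut" and bH: "lift (v @ u) (comm b h) \<in> ?H" using C_Aut by auto
      have "lift (v @ u) (a \<circ> comm b h \<circ> ginv a) \<circ> lift (v @ u) (comm a h) \<in> ?H"
        by (rule sub_comp[OF H conj[OF aC(1) bH] aH])
      then have "lift (v @ u) (comm (a \<circ> b) h) \<in> ?H"
        unfolding lift_comp comm_comp_left[OF aC(2) bC(2) hA] .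
      then show "a \<circ> b \<in> ?X" using sub_comp[OF C aC(1) bC(1)] by simp
    qed
    moreover have "A \<subseteq> ?X" using base[OF v u _ h] A(3) by blast
    ultimately have "generate Aut_tree A \<subseteq> ?X" by (intro Aut_group.generate_subgroup_incl)
    then show ?thesis using g A(2) by blast
  qed
  have D_mark: "lift (v @ u) d \<in> ?H" if v: "v \<in> V" and u: "u \<in> U (\<iota> v)" and d: "d \<in> D" for v u d
  proof (rule generate_hom_closed[where \<phi> = "lift (v @ u)", OF comms_Aut H])
    show "lift (v @ u) id = id" by simp
    show "lift (v @ u) (a \<circ> b) = lift (v @ u) a \<circ> lift (v @ u) b" for a b unfolding lift_comp ..
    show "lift (v @ u) (ginv a) = ginv (lift (v @ u) a)" if "a \<in> Aut" for a
      unfolding ginv_lift[OF that] ..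
    show "lift (v @ u) s \<in> ?H" if "s \<in> {comm a b | a b. a \<in> C \<and> b \<in> C}" for s
      using that comms[OF v u] by blast
  qed (rule d[unfolded D_def derived_sub_def])
  \<comment> \<open>The diagonal copy of \<open>c\<close> moves the mark \<open>p\<close> to \<open>w\<close> and twists \<open>d\<close> by a section of \<open>c\<close>, which normality of \<open>D\<close> undoes.\<close>
  have fill: "lift (v @ w) d \<in> ?H" if v: "v \<in> V" and w: "w \<in> level (\<tau> (\<iota> v))" and d: "d \<in> D" for v w d
  proof -
    obtain c p where cp: "c \<in> C" "p \<in> U (\<iota> v)" "c p = w" using orb[OF w] by blast
    have cA: "c \<in> Aut" using C_Aut[OF cp(1)] .
    let ?s = "section_at c p"
    have s: "?s \<in> G" "?s \<in> Aut" using sections[of c p] CG cp(1) G_Aut by auto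
    have "ginv ?s \<circ> d \<circ> ginv (ginv ?s) \<in> D" by (rule D_conj[OF sub_ginv[OF G s(1)] d])
    then have d': "ginv ?s \<circ> d \<circ> ?s \<in> D" unfolding ginv_ginv[OF s(2)] .
    have "lift v (lift p (ginv ?s \<circ> d \<circ> ?s)) \<in> ?H"
      unfolding lift_lift by (rule D_mark[OF v cp(2) d'])
    from conj_H[OF v cp(1) this]
    have "lift v (lift w (?s \<circ> (ginv ?s \<circ> d \<circ> ?s) \<circ> ginv ?s)) \<in> ?H"
      unfolding conj_lift[OF cA] cp(3) .
    moreover have "?s \<circ> (ginv ?s \<circ> d \<circ> ?s) \<circ> ginv ?s = d" using s(2) by (simp add: fun_eq_iff)
    ultimately show ?thesis by (simp only: lift_lift)
  qed
  have "finite S" unfolding S_def using A(1) by simp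
  moreover have "card S \<le> 2 * card A"
  proof -
    have "card S \<le> card (diag ` A) + card (mark ` A)" unfolding S_def by (rule card_Un_le)
    also have "\<dots> \<le> card A + card A" by (intro add_mono card_image_le A(1))
    finally show ?thesis by simp
  qed
  ultimately show ?thesis using H_sub SA fill by blast
qed

end

section \<open>Every number between zero and one is a dimension\<close>

text \<open>The digits of \<open>\<alpha>\<close> in base \<open>m\<close>, chosen greedily with remainder at most \<open>m ^ (- j)\<close>. The remainder may be equal
  to that bound, so \<open>1\<close> gets the digits \<open>m - 1\<close>.\<close>

lemma base_expansion:
  fixes \<alpha> :: real
  assumes m: "(m::nat) \<ge> 1" and \<alpha>: "0 \<le> \<alpha>" "\<alpha> \<le> 1"
  shows "\<exists>d::nat \<Rightarrow> nat. (\<forall>n. d n < m) \<and>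
    (\<forall>j. (\<Sum>n<j. real (d n) * (1 / real m) ^ Suc n) \<le> \<alpha> \<and>
         \<alpha> \<le> (\<Sum>n<j. real (d n) * (1 / real m) ^ Suc n) + (1 / real m) ^ j)"
proof -
  let ?q = "1 / real m"
  have "\<exists>s :: nat \<Rightarrow> real. s 0 = 0 \<and> (\<forall>n. (s n \<le> \<alpha> \<and> \<alpha> \<le> s n + ?q ^ n) \<and>
      (\<exists>d<m. s (Suc n) = s n + real d * ?q ^ Suc n))"
  proof -
    have "\<exists>s :: nat \<Rightarrow> real. \<forall>n. ((s n \<le> \<alpha> \<and> \<alpha> \<le> s n + ?q ^ n) \<and> (n = 0 \<longrightarrow> s n = 0)) \<and>
        (\<exists>d<m. s (Suc n) = s n + real d * ?q ^ Suc n)"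
    proof (rule dependent_nat_choice[where P = "\<lambda>n s. (s \<le> \<alpha> \<and> \<alpha> \<le> s + ?q ^ n) \<and> (n = 0 \<longrightarrow> s = 0)"
          and Q = "\<lambda>n s s'. \<exists>d<m. s' = s + real d * ?q ^ Suc n"])
      show "\<exists>x. (x \<le> \<alpha> \<and> \<alpha> \<le> x + ?q ^ 0) \<and> (0 = (0::nat) \<longrightarrow> x = 0)" using \<alpha> by auto
    next
      fix x :: real and n :: nat
      assume x: "(x \<le> \<alpha> \<and> \<alpha> \<le> x + ?q ^ n) \<and> (n = 0 \<longrightarrow> x = 0)"
      define r where "r = (\<alpha> - x) * real m ^ Suc n"
      \<comment> \<open>The cut-off at \<open>m - 1\<close> takes effect when the remainder attains its bound, which happens for \<open>\<alpha> = 1\<close>.\<close>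
      define d where "d = min (nat \<lfloor>r\<rfloor>) (m - 1)"
      have qm: "?q ^ Suc n * real m ^ Suc n = 1" using m by (simp add: power_divide)
      have r0: "0 \<le> r" unfolding r_def using x by simp
      have "(\<alpha> - x) * real m ^ Suc n \<le> ?q ^ n * real m ^ Suc n" using x by (intro mult_right_mono) auto
      then have rm: "r \<le> real m" unfolding r_def using m by (simp add: power_divide)
      have dm: "d < m" using m by (simp add: d_def)
      have "real d \<le> real (nat \<lfloor>r\<rfloor>)" by (simp add: d_def)
      also have "\<dots> \<le> r" using r0 by simp
      finally have dr: "real d \<le> r" .
      have rd: "r \<le> real d + 1"
      proof (cases "nat \<lfloor>r\<rfloor> \<le> m - 1")
        case True
        then have "real d = of_int \<lfloor>r\<rfloor>" using r0 by (simp add: d_def min_def)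
        then show ?thesis by linarith
      next
        case False
        then have "d = m - 1" by (simp add: d_def min_def)
        then show ?thesis using rm m by (simp add: of_nat_diff)
      qed
      have \<alpha>r: "\<alpha> = x + r * ?q ^ Suc n"
      proof -
        have "r * ?q ^ Suc n = (\<alpha> - x) * (?q ^ Suc n * real m ^ Suc n)"
          unfolding r_def by (simp only: ac_simps)
        then show ?thesis unfolding qm by simp
      qed
      have qp: "?q ^ Suc n \<ge> 0" by simp
      have "x + real d * ?q ^ Suc n \<le> \<alpha>"
        using mult_right_mono[OF dr qp] \<alpha>r by linarith
      moreover have "\<alpha> \<le> x + real d * ?q ^ Suc n + ?q ^ Suc n"
        using mult_right_mono[OF rd qp] \<alpha>r by (simp only: distrib_right mult_1)
      ultimately show "\<exists>y. ((y \<le> \<alpha> \<and> \<alpha> \<le> y + ?q ^ Suc n) \<and> (Suc n = 0 \<longrightarrow> y = 0)) \<and>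
          (\<exists>d<m. y = x + real d * ?q ^ Suc n)" using dm by blast
    qed
    then show ?thesis by blast
  qed
  then obtain s :: "nat \<Rightarrow> real" where s: "s 0 = 0" "\<And>n. s n \<le> \<alpha> \<and> \<alpha> \<le> s n + ?q ^ n"
      "\<forall>n. \<exists>d<m. s (Suc n) = s n + real d * ?q ^ Suc n" by blast
  from choice[OF s(3)] obtain d where d: "\<And>n. d n < m" "\<And>n. s (Suc n) = s n + real (d n) * ?q ^ Suc n"
    by blast
  have sum: "(\<Sum>n<j. real (d n) * ?q ^ Suc n) = s j" for j
  proof (induction j)
    case (Suc j)
    show ?case unfolding sum.lessThan_Suc Suc.IH d(2) ..
  qed (simp add: s(1))
  show ?thesis by (rule exI[of _ d]) (intro conjI allI, rule d(1), unfold sum, use s(2) in auto)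
qed

text \<open>The antichain for the digits \<open>d\<close>: at each vertex of the ray \<open>x x x \<dots>\<close>, as many children off the
  ray as the digit says.\<close>

definition comb :: "'a \<Rightarrow> (nat \<Rightarrow> 'a set) \<Rightarrow> nat set \<Rightarrow> 'a list set" where
  "comb x Y J = {replicate n x @ [y] | n y. n \<in> J \<and> y \<in> Y n}"

lemma comb_prefix:
  assumes x: "\<forall>n. x \<notin> Y n" and y: "y \<in> Y n" and z: "z \<in> Y k"
    and p: "prefix (replicate n x @ [y]) (replicate k x @ [z])"
  shows "n = k \<and> y = z"
proof -
  have len: "n \<le> k" using prefix_length_le[OF p] by simp
  obtain zs where zs: "replicate k x @ [z] = (replicate n x @ [y]) @ zs" using p by (auto simp: prefix_def)
  have e: "y = (replicate k x @ [z]) ! n" unfolding zs by (simp add: nth_append)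
  have "n = k"
  proof (rule ccontr)
    assume "n \<noteq> k"
    then have "y = x" using e len by (simp add: nth_append)
    then show False using x y by blast
  qed
  then show ?thesis using e by (simp add: nth_append)
qed

lemma antichain_comb:
  assumes "\<forall>n. x \<notin> Y n"
  shows "antichain (comb x Y J)"
  unfolding antichain_def
proof (intro ballI impI)
  fix u v assume "u \<in> comb x Y J" "v \<in> comb x Y J" and p: "prefix u v"
  then obtain n y k z where uv: "u = replicate n x @ [y]" "v = replicate k x @ [z]"
    and yz: "y \<in> Y n" "z \<in> Y k"
    unfolding comb_def by blast
  have "n = k \<and> y = z" using p unfolding uv by (rule comb_prefix[OF assms yz])
  then show "u = v" unfolding uv by simp
qed

lemma comb_lessThan: "comb x Y {..<j} = (\<lambda>(n, y). replicate n x @ [y]) ` (SIGMA n:{..<j}. Y n)"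
  by (auto simp: comb_def)

lemma finite_comb: "finite (comb x Y {..<j} :: 'a::finite list set)"
  unfolding comb_lessThan by (intro finite_imageI finite_SigmaI) auto

lemma weight_comb:
  assumes x: "\<forall>n. (x :: 'a::finite) \<notin> Y n"
  shows "weight (comb x Y {..<j}) = (\<Sum>n<j. real (card (Y n)) * (1 / real CARD('a)) ^ Suc n)"
proof -
  let ?f = "\<lambda>(n, y). replicate n x @ [y]"
  have inj: "inj_on ?f (SIGMA n:{..<j}. Y n)"
  proof (rule inj_onI)
    fix p q assume pq: "p \<in> (SIGMA n:{..<j}. Y n)" "q \<in> (SIGMA n:{..<j}. Y n)" "?f p = ?f q"
    obtain n y k z where e: "p = (n, y)" "q = (k, z)" by (metis surj_pair)
    have y: "y \<in> Y n" "z \<in> Y k" using pq(1,2) unfolding e by auto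
    have "replicate n x @ [y] = replicate k x @ [z]" using pq(3) unfolding e prod.case .
    then have "prefix (replicate n x @ [y]) (replicate k x @ [z])" by (metis prefix_order.refl)
    then have "n = k \<and> y = z" by (rule comb_prefix[OF x y])
    then show "p = q" unfolding e by simp
  qed
  have "weight (comb x Y {..<j}) = (\<Sum>p\<in>(SIGMA n:{..<j}. Y n). (1 / real CARD('a)) ^ length (?f p))"
    unfolding weight_def comb_lessThan by (simp only: sum.reindex[OF inj] comp_def)
  also have "\<dots> = (\<Sum>p\<in>(SIGMA n:{..<j}. Y n). case p of (n, y) \<Rightarrow> (1 / real CARD('a)) ^ Suc n)"
    by (rule sum.cong) auto
  also have "\<dots> = (\<Sum>n<j. \<Sum>y\<in>Y n. (1 / real CARD('a)) ^ Suc n)"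
    by (rule sum.Sigma[symmetric]) auto
  finally show ?thesis by simp
qed

context balanced_filtration
begin

text \<open>An element supported on the whole antichain is a product of its parts below the first few
  vertices and one element below the remaining ray vertex.\<close>

lemma ix_comb_le:
  assumes x: "\<forall>n. x \<notin> Y n" and H: "H \<subseteq> branch_prod (comb x Y UNIV) C"
  shows "ix (N i) H \<le> (\<Prod>u\<in>insert (replicate j x) (comb x Y {..<j}). ix (N i) (rist \<Gamma> u))"
proof -
  interpret q: finite_quotient \<Gamma> "N i" by (rule quotient)
  let ?V = "comb x Y {..<j}" and ?R = "comb x Y {j..}" and ?r = "replicate j x"
  have un: "comb x Y UNIV = ?V \<union> ?R" unfolding comb_def by (auto simp: not_less)
  have ac: "antichain (?V \<union> ?R)" using antichain_comb[OF x, of UNIV] unfolding un .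
  have disj: "?V \<inter> ?R = {}"
  proof -
    have "False" if "v \<in> ?V" "v \<in> ?R" for v using that by (auto simp: comb_def)
    then show ?thesis by blast
  qed
  have acV: "antichain ?V" and acR: "antichain ?R" using antichain_subset[OF ac] by auto
  have finV: "finite ?V" by (rule finite_comb)
  have below: "prefix ?r v \<and> v \<noteq> ?r" if v: "v \<in> ?R" for v
  proof -
    obtain n y where ny: "v = replicate n x @ [y]" "n \<ge> j" "y \<in> Y n" using v by (auto simp: comb_def)
    have "prefix ?r v" unfolding ny(1) by (rule prefix_prefix[OF prefix_replicate[OF ny(2)]])
    moreover have "length v \<noteq> length ?r" using ny by simp
    ultimately show ?thesis by metis
  qed
  have rV: "?r \<notin> ?V"
  proof
    assume "?r \<in> ?V"
    then obtain n y where ny: "?r = replicate n x @ [y]" "y \<in> Y n" by (auto simp: comb_def)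
    have "y \<in> set ?r" unfolding ny(1) by simp
    then have "y = x" by simp
    then show False using ny(2) x by blast
  qed
  have lift\<Gamma>: "b \<in> Aut \<and> lift u b \<in> \<Gamma>" if "b \<in> C" for u b
    using that C_Aut C_lift CG G\<Gamma> by blast
  have "ix (N i) H \<le> ix (N i) (rist \<Gamma> ?r) * ix (N i) (branch_prod ?V C)"
  proof (rule q.ix_comp_le)
    show "rist \<Gamma> ?r \<subseteq> \<Gamma>" by (rule rist_subset)
    show "branch_prod ?V C \<subseteq> \<Gamma>" by (rule branch_prod_closure[OF acV])
    fix h assume "h \<in> H"
    then have "h \<in> branch_prod (?V \<union> ?R) C" using H un by auto
    then obtain f where f: "h = spread (?R \<union> ?V) f" "\<forall>v\<in>?V \<union> ?R. f v \<in> C"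
      by (auto simp: branch_prod_def Un_commute)
    have hs: "h = spread ?R f \<circ> spread ?V f"
      unfolding f(1) by (rule spread_union) (use ac disj in \<open>auto simp: Un_commute\<close>)
    have "spread ?R f \<in> branch_prod ?R C" by (rule branch_prodI) (use f(2) in blast)
    then have R\<Gamma>: "spread ?R f \<in> \<Gamma>" using branch_prod_closure[OF acR] by blast
    have "spread ?R f \<in> rist \<Gamma> ?r"
      unfolding rist_def
    proof (intro CollectI conjI allI impI R\<Gamma>)
      show "spread ?R f ?r = ?r"
      proof (rule spread_off, rule notI)
        assume "\<exists>u\<in>?R. prefix u ?r"
        then obtain u where u: "u \<in> ?R" "prefix u ?r" by blast
        then show False using below[OF u(1)] by (metis prefix_order.antisym)
      qed
      fix w assume w: "\<not> prefix ?r w"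
      show "spread ?R f w = w"
      proof (rule spread_off, rule notI)
        assume "\<exists>u\<in>?R. prefix u w"
        then obtain u where u: "u \<in> ?R" "prefix u w" by blast
        then show False using below[OF u(1)] w by (metis prefix_order.trans)
      qed
    qed
    moreover have "spread ?V f \<in> branch_prod ?V C" by (rule branch_prodI) (use f(2) in blast)
    ultimately show "\<exists>b\<in>rist \<Gamma> ?r. \<exists>c\<in>branch_prod ?V C. h = b \<circ> c" using hs by blast
  qed
  also have "\<dots> \<le> ix (N i) (rist \<Gamma> ?r) * (\<Prod>u\<in>?V. ix (N i) (rist \<Gamma> u))"
    by (intro mult_le_mono2 q.ix_branch_prod_le[OF finV acV lift\<Gamma>])
  also have "\<dots> = (\<Prod>u\<in>insert ?r ?V. ix (N i) (rist \<Gamma> u))" using finV rV by simp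
  finally show ?thesis .
qed

text \<open>Cutting the comb at height \<open>j\<close> gives weights that approach \<open>\<alpha>\<close> from below, and adding the ray vertex where
  it is cut accounts for everything left out.\<close>

theorem dimension_attained:
  assumes \<alpha>: "0 \<le> \<alpha>" "\<alpha> \<le> 1"
  shows "\<exists>S. finite S \<and> card S \<le> 2 * card A \<and> S \<subseteq> Aut \<and> generate Aut_tree S \<subseteq> \<Gamma> \<and>
    hdim \<Gamma> N (congruence_topology closure_of (generate Aut_tree S)) = ereal \<alpha>"
proof -
  let ?m = "CARD('a)" and ?q = "1 / real CARD('a)"
  have q: "0 < ?q" "?q < 1" using card2 by auto
  have m1: "?m \<ge> 1" using card2 by simp
  obtain d where d: "\<forall>n. d n < ?m"
    and d\<alpha>: "\<forall>j. (\<Sum>n<j. real (d n) * ?q ^ Suc n) \<le> \<alpha> \<and> \<alpha> \<le> (\<Sum>n<j. real (d n) * ?q ^ Suc n) + ?q ^ j"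
    using base_expansion[OF m1 \<alpha>] by blast
  obtain x :: 'a where True by blast
  have "\<forall>n. \<exists>Z. Z \<subseteq> UNIV - {x} \<and> card Z = d n"
  proof
    fix n
    have "d n < ?m" using d by blast
    then have "d n \<le> card (UNIV - {x})" by (simp add: card_Diff_singleton)
    then show "\<exists>Z. Z \<subseteq> UNIV - {x} \<and> card Z = d n" by (rule obtain_subset_with_card_n) blast
  qed
  from choice[OF this] obtain Y where Y: "\<And>n. Y n \<subseteq> UNIV - {x}" "\<And>n. card (Y n) = d n" by blast
  have xY: "\<forall>n. x \<notin> Y n" using Y(1) by blast
  let ?V = "comb x Y UNIV" and ?Vj = "\<lambda>j. comb x Y {..<j}"
  have acV: "antichain ?V" by (rule antichain_comb[OF xY])
  have w: "weight (?Vj j) = (\<Sum>n<j. real (d n) * ?q ^ Suc n)" for j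
    using weight_comb[OF xY, of j] Y(2) by simp
  obtain S where S: "finite S" "card S \<le> 2 * card A" "generate Aut_tree S \<subseteq> branch_prod ?V C" "S \<subseteq> Aut"
    "\<forall>v\<in>?V. \<exists>t. \<forall>w\<in>level t. \<forall>d\<in>D. lift (v @ w) d \<in> generate Aut_tree S"
    using antichain_generators[OF acV] by (elim exE conjE) (rule that)
  let ?H = "generate Aut_tree S"
  have H: "subgroup ?H Aut_tree" by (rule Aut_group.generate_is_subgroup[OF S(4)])
  have H\<Gamma>: "?H \<subseteq> \<Gamma>" using S(3) branch_prod_closure[OF acV] by blast
  have small: "\<exists>j\<ge>1. ?q ^ j < \<epsilon>" if e: "\<epsilon> > 0" for \<epsilon> :: real
  proof -
    obtain j where j: "?q ^ j < \<epsilon>" using real_arch_pow_inv[OF e q(2)] by blast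
    have "?q ^ Suc j \<le> ?q ^ j" using q by (intro power_decreasing) auto
    then show ?thesis using j by (intro exI[of _ "Suc j"]) auto
  qed
  have "hdim \<Gamma> N (congruence_topology closure_of ?H) = ereal \<alpha>"
  proof (rule hdim_eq[OF H H\<Gamma>])
    fix \<epsilon> :: real assume "\<epsilon> > 0"
    then obtain j where j: "j \<ge> 1" "?q ^ j < \<epsilon>" using small by blast
    let ?U = "insert (replicate j x) (?Vj j)"
    have "weight ?U \<le> ?q ^ j + weight (?Vj j)"
      unfolding weight_def using finite_comb[of x Y j] by (cases "replicate j x \<in> ?Vj j") (auto simp: insert_absorb)
    also have "\<dots> \<le> \<alpha> + \<epsilon>" unfolding w using d\<alpha> j(2) by (smt (verit))
    finally have wU: "weight ?U \<le> \<alpha> + \<epsilon>" .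
    have ne: "\<forall>u\<in>?U. u \<noteq> []" using j(1) by (auto simp: comb_def)
    show "\<exists>U. finite U \<and> (\<forall>u\<in>U. u \<noteq> []) \<and> weight U \<le> \<alpha> + \<epsilon> \<and>
      (\<forall>i. ix (N i) ?H \<le> (\<Prod>u\<in>U. ix (N i) (rist \<Gamma> u)))"
      by (rule exI[of _ ?U]) (intro conjI allI ne wU ix_comb_le[OF xY S(3)], simp add: finite_comb)
  next
    fix \<epsilon> :: real assume "\<epsilon> > 0"
    then obtain j where j: "?q ^ j < \<epsilon>" using small by blast
    have ac: "antichain (?Vj j)" by (rule antichain_comb[OF xY])
    have sub: "?Vj j \<subseteq> ?V" by (auto simp: comb_def)
    have wl: "\<alpha> - \<epsilon> \<le> weight (?Vj j)" unfolding w using d\<alpha> j by (smt (verit))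
    show "\<exists>U. finite U \<and> antichain U \<and> \<alpha> - \<epsilon> \<le> weight U \<and>
      (\<forall>v\<in>U. \<exists>t. \<forall>w\<in>level t. \<forall>d\<in>D. lift (v @ w) d \<in> ?H)"
      by (rule exI[of _ "?Vj j"]) (intro conjI finite_comb ac wl ballI bspec[OF S(5)] subsetD[OF sub])
  qed
  then show ?thesis using S H\<Gamma> by blast
qed

end

section \<open>The level-stabilizer filtration\<close>

lemma card_restrict_eq:
  assumes "finite ((\<lambda>a. restrict a L) ` A)" "\<And>a b. \<lbrakk>a \<in> A; b \<in> A\<rbrakk> \<Longrightarrow> \<phi> a = \<phi> b \<longleftrightarrow> restrict a L = restrict b L"
  shows "card (\<phi> ` A) = card ((\<lambda>a. restrict a L) ` A)"
proof (rule antisym)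
  have f: "finite (\<phi> ` A)"
    by (rule card_image_factor(1)[OF assms(1)]) (use assms(2) in blast)
  show "card (\<phi> ` A) \<le> card ((\<lambda>a. restrict a L) ` A)"
    by (rule card_image_factor(2)[OF assms(1)]) (use assms(2) in blast)
  show "card ((\<lambda>a. restrict a L) ` A) \<le> card (\<phi> ` A)"
    by (rule card_image_factor(2)[OF f]) (use assms(2) in blast)
qed

lemma restrict_eq_iff_agree:
  fixes a b :: "'a list \<Rightarrow> 'a list"
  shows "restrict a (level n) = restrict b (level n) \<longleftrightarrow> agree n a b"
proof
  assume e: "restrict a (level n) = restrict b (level n)"
  show "agree n a b" unfolding agree_def
  proof
    fix w :: "'a list" assume "w \<in> level n"
    then show "a w = b w" using fun_cong[OF e, of w] by simp
  qed
next
  assume "agree n a b"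
  then show "restrict a (level n) = restrict b (level n)" unfolding agree_def by (intro restrict_ext) blast
qed

lemma nat_pow_Aut: "g [^]\<^bsub>Aut_tree\<^esub> (k::nat) = g ^^ k"
proof (induction k)
  case (Suc k)
  then show ?case by (simp only: Aut_group.nat_pow_Suc Aut_tree_simps(2) funpow.simps)
next
  case 0
  show ?case by (simp only: Aut_group.nat_pow_0 Aut_tree_simps(3) funpow.simps)
qed

lemma funpow_fixed_mult: "(g ^^ d) w = w \<Longrightarrow> (g ^^ (d * k)) w = w"
proof (induction k)
  case (Suc k)
  have "g ^^ (d * Suc k) = g ^^ d \<circ> g ^^ (d * k)" by (simp add: funpow_add)
  then show ?case using Suc by simp
qed simp

text \<open>An automorphism that fixes a level permutes the children of each vertex of it, so its power
  with exponent \<open>m!\<close> fixes the next level.\<close>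

lemma fact_power_fixes_next_level:
  fixes g :: "'a::finite list \<Rightarrow> 'a list"
  assumes g: "g \<in> Aut" and triv: "agree n g id"
  shows "agree (Suc n) (g ^^ fact CARD('a)) id"
  unfolding agree_def
proof
  fix w :: "'a list" assume w: "w \<in> level (Suc n)"
  obtain v x where vx: "w = v @ [x]"
    using w by (cases w rule: rev_cases) (auto simp: level_def)
  have v: "v \<in> level n" using w vx by (simp add: level_def)
  have gv: "g v = v" using triv v by (simp add: agree_def)
  let ?K = "(\<lambda>y. v @ [y]) ` (UNIV :: 'a set)"
  have K: "(g ^^ i) w \<in> ?K" for i
  proof (induction i)
    case (Suc i)
    then obtain y where y: "(g ^^ i) w = v @ [y]" by blast
    obtain z where "g (v @ [y]) = g v @ [z]" using Aut_child[OF g] by blast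
    then have "(g ^^ Suc i) w = v @ [z]" using y gv by simp
    then show ?case by blast
  qed (use vx in simp)
  have "\<not> inj_on (\<lambda>i. (g ^^ i) w) {..CARD('a)}"
  proof
    assume "inj_on (\<lambda>i. (g ^^ i) w) {..CARD('a)}"
    then have "card {..CARD('a)} \<le> card ?K" by (rule card_inj_on_le) (use K in auto)
    also have "\<dots> \<le> CARD('a)" by (rule card_image_le) simp
    finally show False by simp
  qed
  then obtain i j where ij: "i \<le> CARD('a)" "j \<le> CARD('a)" "i < j" "(g ^^ i) w = (g ^^ j) w"
    unfolding inj_on_def by (metis atMost_iff nat_neq_iff)
  have "g ^^ j = g ^^ i \<circ> g ^^ (j - i)" using ij(3) by (simp add: funpow_add[symmetric])
  then have e: "(g ^^ i) ((g ^^ (j - i)) w) = (g ^^ i) w" using ij(4) by simp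
  have "inj (g ^^ i)" by (rule inj_fn) (rule bij_is_inj[OF Aut_bij[OF g]])
  then have fw: "(g ^^ (j - i)) w = w" using e by (rule injD)
  have "(j - i) dvd fact CARD('a)" by (rule dvd_fact) (use ij in auto)
  then obtain q where "fact CARD('a) = (j - i) * q" by (elim dvdE)
  then show "(g ^^ fact CARD('a)) w = id w" using funpow_fixed_mult[OF fw, of q] by simp
qed

lemma fact_power_fixes_level:
  fixes g :: "'a::finite list \<Rightarrow> 'a list"
  assumes g: "g \<in> Aut"
  shows "agree n (g ^^ (fact CARD('a) ^ n)) id"
proof (induction n)
  case 0
  have "(g ^^ 1) [] = []" using Aut_root[OF g] by simp
  then show ?case by (simp add: agree_def level_def)
next
  case (Suc n)
  have gp: "g ^^ k \<in> Aut" for k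
    using Aut_group.nat_pow_closed[OF g, of k] unfolding nat_pow_Aut .
  have "g ^^ (fact CARD('a) ^ Suc n) = (g ^^ (fact CARD('a) ^ n)) ^^ fact CARD('a)"
    unfolding funpow_mult power_Suc by (simp only: mult.commute)
  then show ?case using fact_power_fixes_next_level[OF gp Suc] by metis
qed

context regular_branch_group
begin

lemma ix_St_in:
  assumes B: "B \<subseteq> \<Gamma>"
  shows "ix (St_in \<Gamma> n) B = card ((\<lambda>a. restrict a (level n)) ` B)"
  unfolding ix_def
proof (rule card_restrict_eq)
  interpret q: finite_quotient \<Gamma> "St_in \<Gamma> n" by (rule finite_quotient_St)
  show "finite ((\<lambda>a. restrict a (level n)) ` B)"
    by (rule finite_restrict_level) (use B q.\<Gamma>_Aut in blast)
  fix a b assume "a \<in> B" "b \<in> B"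
  then have ab: "a \<in> \<Gamma>" "b \<in> \<Gamma>" and abA: "a \<in> Aut" "b \<in> Aut" using B q.\<Gamma>_Aut by auto
  show "lcoset (St_in \<Gamma> n) a = lcoset (St_in \<Gamma> n) b \<longleftrightarrow> restrict a (level n) = restrict b (level n)"
    unfolding restrict_eq_iff_agree
  proof
    assume "lcoset (St_in \<Gamma> n) a = lcoset (St_in \<Gamma> n) b"
    then have "ginv a \<circ> b \<in> St_in \<Gamma> n" using q.lcoset_eq_iff[OF ab] by blast
    then have "agree n (ginv a \<circ> b) id" by (simp add: St_in_def St_iff_agree)
    then have "agree n (a \<circ> (ginv a \<circ> b)) (a \<circ> id)" using abA by (intro agree_comp) auto
    moreover have "a \<circ> (ginv a \<circ> b) = b" using abA by (simp add: fun_eq_iff)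
    ultimately show "agree n a b" using agree_sym by (metis comp_id)
  qed (rule q.lcoset_eq_agree[OF subset_refl ab])
qed

text \<open>Modulo level stabilizers, independence of the actions below the vertices of an antichain is exact.\<close>

lemma prod_ix_St_le:
  assumes U: "finite U" "antichain U" and B: "\<And>u. u \<in> U \<Longrightarrow> B u \<subseteq> rist \<Gamma> u" and E: "E \<subseteq> \<Gamma>"
    and glue: "\<And>e. (\<And>u. u \<in> U \<Longrightarrow> e u \<in> B u) \<Longrightarrow> spread U (\<lambda>u. section_at (e u) u) \<in> E"
  shows "(\<Prod>u\<in>U. ix (St_in \<Gamma> n) (B u)) \<le> ix (St_in \<Gamma> n) E"
proof -
  interpret q: finite_quotient \<Gamma> "St_in \<Gamma> n" by (rule finite_quotient_St)
  let ?\<rho> = "\<lambda>a. restrict a (level n)"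
  have B\<Gamma>: "B u \<subseteq> \<Gamma>" if "u \<in> U" for u using B[OF that] by (auto simp: rist_def)
  have finE: "finite (?\<rho> ` E)" by (rule finite_restrict_level) (use E q.\<Gamma>_Aut in blast)
  let ?e = "\<lambda>c u. inv_into (B u) ?\<rho> (c u)"
  let ?F = "\<lambda>c. spread U (\<lambda>u. section_at (?e c u) u)"
  let ?P = "PiE U (\<lambda>u. ?\<rho> ` B u)"
  have eB: "?e c u \<in> B u" "?\<rho> (?e c u) = c u" if "c \<in> ?P" "u \<in> U" for c u
  proof -
    have "c u \<in> ?\<rho> ` B u" using that by (rule PiE_mem)
    then show "?e c u \<in> B u" "?\<rho> (?e c u) = c u" by (rule inv_into_into, rule f_inv_into_f)
  qed
  have key: "?F c (u @ z) = ?e c u (u @ z)" if "c \<in> ?P" "u \<in> U" for c u z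
  proof -
    have e: "?e c u \<in> rist \<Gamma> u" using eB(1)[OF that] B[OF that(2)] by blast
    then have "?e c u \<in> Aut" using q.\<Gamma>_Aut by (auto simp: rist_def)
    moreover have "?e c u u = u" using e by (simp add: rist_def)
    ultimately show ?thesis using spread_below[OF U(2) that(2)] Aut_append[of "?e c u" u z] by metis
  qed
  have "inj_on (\<lambda>c. ?\<rho> (?F c)) ?P"
  proof (rule inj_onI)
    fix c c' assume c: "c \<in> ?P" "c' \<in> ?P" and eq: "?\<rho> (?F c) = ?\<rho> (?F c')"
    have ag: "?F c w = ?F c' w" if "w \<in> level n" for w
      using fun_cong[OF eq, of w] that by simp
    show "c = c'"
    proof (rule PiE_ext[OF c])
      fix u assume u: "u \<in> U"
      have "?\<rho> (?e c u) = ?\<rho> (?e c' u)"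
      proof (rule restrict_ext)
        fix w :: "'a list" assume w: "w \<in> level n"
        show "?e c u w = ?e c' u w"
        proof (cases "prefix u w")
          case True
          then obtain z where z: "w = u @ z" by (auto simp: prefix_def)
          show ?thesis using ag[OF w] unfolding z key[OF c(1) u] key[OF c(2) u] .
        next
          case False
          have "?e c u \<in> rist \<Gamma> u" "?e c' u \<in> rist \<Gamma> u" using eB(1) c u B[OF u] by blast+
          then show ?thesis using False by (simp add: rist_def)
        qed
      qed
      then show "c u = c' u" using eB(2)[OF c(1) u] eB(2)[OF c(2) u] by metis
    qed
  qed
  moreover have "(\<lambda>c. ?\<rho> (?F c)) ` ?P \<subseteq> ?\<rho> ` E"
  proof
    fix y assume "y \<in> (\<lambda>c. ?\<rho> (?F c)) ` ?P"
    then obtain c where c: "c \<in> ?P" "y = ?\<rho> (?F c)" by blast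
    have "?F c \<in> E" by (rule glue) (rule eB(1)[OF c(1)])
    then show "y \<in> ?\<rho> ` E" using c(2) by blast
  qed
  ultimately have "card ?P \<le> card (?\<rho> ` E)" using finE by (rule card_inj_on_le)
  moreover have "card ?P = (\<Prod>u\<in>U. card (?\<rho> ` B u))" by (rule card_PiE[OF U(1)])
  moreover have "(\<Prod>u\<in>U. card (?\<rho> ` B u)) = (\<Prod>u\<in>U. ix (St_in \<Gamma> n) (B u))"
    by (rule prod.cong[OF refl]) (rule ix_St_in[OF B\<Gamma>, symmetric])
  ultimately show ?thesis using ix_St_in[OF E] by metis
qed

lemma rist_le_St: "(\<Prod>v\<in>level k. ix (St_in \<Gamma> n) (rist \<Gamma> v)) \<le> ix (St_in \<Gamma> n) \<Gamma>"
proof (rule prod_ix_St_le[OF finite_level antichain_level subset_refl subset_refl])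
  fix e assume e: "\<And>u. u \<in> level k \<Longrightarrow> e u \<in> rist \<Gamma> u"
  show "spread (level k) (\<lambda>u. section_at (e u) u) \<in> \<Gamma>"
  proof (rule spread_finite_in_subgroup[OF \<Gamma> finite_level antichain_level])
    fix u :: "'a list" assume u: "u \<in> level k"
    have "e u \<in> \<Gamma>" using e[OF u] by (simp add: rist_def)
    then show "lift u (section_at (e u) u) \<in> \<Gamma>"
      using rist_eq_lift[OF e[OF u] sub_Aut[OF \<Gamma>]] by metis
  qed
qed

lemma infinite_G: "infinite G"
proof
  assume fin: "finite G"
  define n where "n = card G"
  obtain w :: "'a list" where w: "length w = n" using Ex_list_of_length by blast
  have "level n \<subseteq> (\<lambda>g. g w) ` G"
  proof
    fix u :: "'a list" assume "u \<in> level n"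
    then obtain g where "g \<in> G" "g w = u" using transitive[of w u] w by (auto simp: level_def)
    then show "u \<in> (\<lambda>g. g w) ` G" by blast
  qed
  then have "card (level n :: 'a list set) \<le> card ((\<lambda>g. g w) ` G)" using fin by (intro card_mono) auto
  also have "\<dots> \<le> n" unfolding n_def by (rule card_image_le[OF fin])
  finally have "CARD('a) ^ n \<le> n" by (simp add: card_level)
  moreover have "n < 2 ^ n" by (rule less_exp)
  moreover have "(2::nat) ^ n \<le> CARD('a) ^ n" using card2 by (rule power_mono) simp
  ultimately show False by linarith
qed

lemma C_moves: "\<exists>c\<in>C. \<exists>w. c w \<noteq> w"
proof (rule ccontr)
  assume "\<not> ?thesis"
  then have "c = id" if "c \<in> C" for c using that by (auto simp: fun_eq_iff)
  then have "G \<subseteq> T" using cover by fastforce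
  then show False using T(1) infinite_G finite_subset by blast
qed

lemma C\<Gamma>: "C \<subseteq> \<Gamma>"
  using CG G\<Gamma> by blast

text \<open>Two different first-level vertices carry independent copies of \<open>C\<close>.\<close>

lemma ix_St_C_step: "ix (St_in \<Gamma> n) C ^ 2 \<le> ix (St_in \<Gamma> (Suc n)) C"
proof -
  interpret q: finite_quotient \<Gamma> "St_in \<Gamma> n" by (rule finite_quotient_St)
  interpret q': finite_quotient \<Gamma> "St_in \<Gamma> (Suc n)" by (rule finite_quotient_St)
  let ?I = "ix (St_in \<Gamma> n) C"
  have lift_sub: "lift v ` C \<subseteq> \<Gamma>" for v using C_lift C\<Gamma> by blast
  have le: "?I \<le> ix (St_in \<Gamma> (Suc n)) (lift v ` C)" if v: "v \<in> level 1" for v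
  proof -
    let ?\<theta> = "\<lambda>a. restrict (lift v a) (level (Suc n))"
    have im: "(\<lambda>a. restrict a (level (Suc n))) ` lift v ` C = ?\<theta> ` C" by (simp only: image_image)
    have fin: "finite (?\<theta> ` C)"
      unfolding im[symmetric] by (rule finite_restrict_level) (use lift_sub q.\<Gamma>_Aut in blast)
    have "card ((\<lambda>a. restrict a (level n)) ` C) \<le> card (?\<theta> ` C)"
    proof (rule card_image_factor(2)[OF fin])
      fix a b :: "'a list \<Rightarrow> 'a list" assume e: "?\<theta> a = ?\<theta> b"
      show "restrict a (level n) = restrict b (level n)"
      proof (rule restrict_ext)
        fix w :: "'a list" assume "w \<in> level n"
        then have "v @ w \<in> level (Suc n)" using v by (simp add: level_def)
        then have "lift v a (v @ w) = lift v b (v @ w)" using fun_cong[OF e, of "v @ w"] by simp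
        then show "a w = b w" by simp
      qed
    qed
    then show ?thesis unfolding ix_St_in[OF C\<Gamma>] ix_St_in[OF lift_sub] im .
  qed
  have "?I ^ CARD('a) = (\<Prod>v\<in>(level 1 :: 'a list set). ?I)" by (simp add: card_level)
  also have "\<dots> \<le> (\<Prod>v\<in>level 1. ix (St_in \<Gamma> (Suc n)) (lift v ` C))" by (rule prod_mono) (simp add: le)
  also have "\<dots> \<le> ix (St_in \<Gamma> (Suc n)) C"
  proof (rule prod_ix_St_le[OF finite_level antichain_level _ C\<Gamma>])
    show "lift v ` C \<subseteq> rist \<Gamma> v" for v using lift_sub lift_in_rist C_Aut by blast
    fix e assume e: "\<And>u. u \<in> level 1 \<Longrightarrow> e u \<in> lift u ` C"
    show "spread (level 1) (\<lambda>u. section_at (e u) u) \<in> C"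
    proof (rule spread_finite_in_subgroup[OF C finite_level antichain_level])
      fix u :: "'a list" assume u: "u \<in> level 1"
      obtain c where c: "c \<in> C" "e u = lift u c" using e[OF u] by blast
      have "lift u c \<in> \<Gamma>" using C_lift[OF c(1)] C\<Gamma> by blast
      then have "e u \<in> rist \<Gamma> u" unfolding c(2) by (rule lift_in_rist[OF _ C_Aut[OF c(1)]])
      moreover have "e u \<in> Aut" using c C_Aut by simp
      ultimately have "lift u (section_at (e u) u) = e u" using rist_eq_lift by metis
      then show "lift u (section_at (e u) u) \<in> C" using c C_lift by simp
    qed
  qed
  finally have "?I ^ CARD('a) \<le> ix (St_in \<Gamma> (Suc n)) C" .
  moreover have "?I \<ge> 1" by (rule q.ix_pos[OF C\<Gamma>]) (use sub_id[OF C] in blast)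
  then have "?I ^ 2 \<le> ?I ^ CARD('a)" by (rule power_increasing[OF card2])
  ultimately show ?thesis by linarith
qed

text \<open>Each level at least squares the number of actions of \<open>C\<close>, which is at least two once some element moves.\<close>

lemma ix_St_growth: "\<exists>n0. \<forall>j. ix (St_in \<Gamma> (n0 + j)) \<Gamma> \<ge> 2 ^ 2 ^ j"
proof -
  obtain c w where cw: "c \<in> C" "c w \<noteq> w" using C_moves by blast
  define n0 where "n0 = length w"
  have "ix (St_in \<Gamma> (n0 + j)) C \<ge> 2 ^ 2 ^ j" for j
  proof (induction j)
    case 0
    interpret q: finite_quotient \<Gamma> "St_in \<Gamma> n0" by (rule finite_quotient_St)
    have wl: "w \<in> level n0" by (simp add: n0_def level_def)
    have "lcoset (St_in \<Gamma> n0) c \<noteq> lcoset (St_in \<Gamma> n0) id"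
    proof
      assume "lcoset (St_in \<Gamma> n0) c = lcoset (St_in \<Gamma> n0) id"
      then have "ginv c \<circ> id \<in> St_in \<Gamma> n0"
        using q.lcoset_eq_iff[of c id] cw(1) C\<Gamma> sub_id[OF \<Gamma>] by blast
      then have "ginv c w = w" using wl by (simp add: St_in_def St_def)
      then show False using cw(2) ginv_right[OF C_Aut[OF cw(1)], of w] by simp
    qed
    then have "card {lcoset (St_in \<Gamma> n0) c, lcoset (St_in \<Gamma> n0) id} = 2" by simp
    moreover have "{lcoset (St_in \<Gamma> n0) c, lcoset (St_in \<Gamma> n0) id} \<subseteq> lcoset (St_in \<Gamma> n0) ` C"
      using cw(1) sub_id[OF C] by blast
    ultimately have "2 \<le> ix (St_in \<Gamma> n0) C"
      unfolding ix_def using card_mono[OF q.finite_cosets[OF C\<Gamma>]] by metis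
    then show ?case by simp
  next
    case (Suc j)
    have "(2 ^ 2 ^ j) ^ 2 \<le> ix (St_in \<Gamma> (n0 + j)) C ^ 2" using Suc by (rule power_mono) simp
    also have "\<dots> \<le> ix (St_in \<Gamma> (Suc (n0 + j))) C" by (rule ix_St_C_step)
    finally show ?case by (simp add: power_mult[symmetric] mult.commute)
  qed
  moreover have "ix (St_in \<Gamma> n) C \<le> ix (St_in \<Gamma> n) \<Gamma>" for n
    by (rule finite_quotient.ix_mono[OF finite_quotient_St C\<Gamma> subset_refl])
  ultimately show ?thesis by (meson order_trans)
qed

lemma linear_over_ln_ix_St:
  "(\<lambda>n. (a + b * real n) / ln (real (ix (St_in \<Gamma> n) \<Gamma>))) \<longlonglongrightarrow> 0"
proof -
  obtain n0 where n0: "\<And>j. ix (St_in \<Gamma> (n0 + j)) \<Gamma> \<ge> 2 ^ 2 ^ j" using ix_St_growth by blast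
  let ?L = "\<lambda>j. ln (real (ix (St_in \<Gamma> (j + n0)) \<Gamma>))"
  have L: "2 ^ j * ln 2 \<le> ?L j" for j
  proof -
    have "real (2 ^ 2 ^ j) \<le> real (ix (St_in \<Gamma> (j + n0)) \<Gamma>)"
      using n0[of j] by (simp only: of_nat_le_iff add.commute)
    then have "ln (real (2 ^ 2 ^ j)) \<le> ?L j" by (rule ln_mono) simp
    then show ?thesis by (simp add: ln_realpow)
  qed
  let ?g = "\<lambda>j. (\<bar>a\<bar> + \<bar>b\<bar> * real n0) / ln 2 * (1 / 2) ^ j + \<bar>b\<bar> / ln 2 * (real j * (1 / 2) ^ j)"
  have "?g \<longlonglongrightarrow> (\<bar>a\<bar> + \<bar>b\<bar> * real n0) / ln 2 * 0 + \<bar>b\<bar> / ln 2 * 0"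
    by (intro tendsto_add tendsto_mult tendsto_const LIMSEQ_realpow_zero powser_times_n_limit_0) auto
  then have lim: "?g \<longlonglongrightarrow> 0" by simp
  have "(\<lambda>j. (a + b * real (j + n0)) / ?L j) \<longlonglongrightarrow> 0"
  proof (rule tendsto_0_le[where K = 1, OF lim], rule always_eventually, rule allI)
    fix j
    have p: "(0::real) < 2 ^ j * ln 2" by simp
    then have Lp: "0 < ?L j" using L[of j] by linarith
    have "norm ((a + b * real (j + n0)) / ?L j) = \<bar>a + b * real (j + n0)\<bar> / ?L j"
      using Lp by simp
    also have "\<dots> \<le> \<bar>a + b * real (j + n0)\<bar> / (2 ^ j * ln 2)"
      using L[of j] by (rule divide_left_mono) (simp, rule mult_pos_pos[OF Lp p])
    also have "\<dots> \<le> (\<bar>a\<bar> + \<bar>b\<bar> * real (j + n0)) / (2 ^ j * ln 2)"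
    proof (rule divide_right_mono)
      have "\<bar>a + b * real (j + n0)\<bar> \<le> \<bar>a\<bar> + \<bar>b * real (j + n0)\<bar>" by (rule abs_triangle_ineq)
      then show "\<bar>a + b * real (j + n0)\<bar> \<le> \<bar>a\<bar> + \<bar>b\<bar> * real (j + n0)" by (simp add: abs_mult)
    qed (use p in simp)
    also have "\<dots> = ?g j" by (simp add: field_simps power_divide)
    also have "\<dots> \<le> norm (?g j) * 1" by simp
    finally show "norm ((a + b * real (j + n0)) / ?L j) \<le> norm (?g j) * 1" .
  qed
  then show ?thesis by (rule LIMSEQ_offset)
qed

text \<open>A bound for what the copies of \<open>B\<close> at level \<open>k\<close> miss in \<open>\<Gamma>\<close>. As \<open>G\<close> is dense, it meets every coset that
  \<open>\<Gamma>\<close> meets, and \<open>branch_prod_cover\<close> applies.\<close>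

lemma ix_le_branch_prod:
  assumes q: "finite_quotient \<Gamma> N" and B: "subgroup B Aut_tree" "B \<subseteq> C" and S: "finite S" "S \<subseteq> G"
    and cov: "\<And>g. g \<in> G \<Longrightarrow> \<exists>t\<in>S. \<exists>b\<in>B. g = b \<circ> t"
  shows "ix N \<Gamma> \<le> ix N (branch_prod (level k) B) *
    ((CARD('a) ^ k) ^ (CARD('a) ^ k) * card S ^ (CARD('a) ^ k))"
proof -
  interpret q: finite_quotient \<Gamma> N by (rule q)
  obtain R where R: "R \<subseteq> G" "finite R"
    "card R \<le> (CARD('a) ^ k) ^ (CARD('a) ^ k) * card S ^ (CARD('a) ^ k)"
    "\<forall>g\<in>G. \<exists>r\<in>R. \<exists>p\<in>branch_prod (level k) B. g = p \<circ> r"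
    using branch_prod_cover[OF B(1) S cov, of k] by blast
  have "ix N \<Gamma> = ix N G"
    using q.ix_closure[OF G\<Gamma>] unfolding \<Gamma>_def by simp
  also have "\<dots> \<le> ix N (branch_prod (level k) B) * ix N R"
  proof (rule q.ix_comp_le)
    show "branch_prod (level k) B \<subseteq> \<Gamma>" using branch_prod_level_G[OF B(2)] G\<Gamma> by blast
    show "R \<subseteq> \<Gamma>" using R(1) G\<Gamma> by blast
    show "\<exists>b\<in>branch_prod (level k) B. \<exists>c\<in>R. g = b \<circ> c" if "g \<in> G" for g using R(4) that by blast
  qed
  also have "\<dots> \<le> ix N (branch_prod (level k) B) *
    ((CARD('a) ^ k) ^ (CARD('a) ^ k) * card S ^ (CARD('a) ^ k))"
    by (rule mult_le_mono2) (rule order_trans[OF q.ix_le_card[OF R(2)] R(3)])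
  finally show ?thesis .
qed

text \<open>The elements of \<open>C\<close> that act on level \<open>n\<close> like elements of \<open>D\<close>. This enlarges \<open>D\<close> to a subgroup of finite
  index without changing its action on the level.\<close>

definition D_mod :: "nat \<Rightarrow> ('a list \<Rightarrow> 'a list) set" where
  "D_mod n = {c \<in> C. \<exists>d\<in>D. agree n c d}"

lemma D_mod_subgroup: "subgroup (D_mod n) Aut_tree"
proof (rule subgroup_AutI)
  show "D_mod n \<subseteq> Aut" using C_Aut by (auto simp: D_mod_def)
  show "id \<in> D_mod n" unfolding D_mod_def using sub_id[OF C] sub_id[OF D] agree_refl by blast
  fix g assume "g \<in> D_mod n"
  then obtain d where g: "g \<in> C" "d \<in> D" "agree n g d" by (auto simp: D_mod_def)
  have "agree n (ginv g) (ginv d)" by (rule agree_ginv[OF C_Aut[OF g(1)] D_Aut[OF g(2)] g(3)])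
  then show "ginv g \<in> D_mod n" unfolding D_mod_def using sub_ginv[OF C g(1)] sub_ginv[OF D g(2)] by blast
  fix h assume "h \<in> D_mod n"
  then obtain e where h: "h \<in> C" "e \<in> D" "agree n h e" by (auto simp: D_mod_def)
  have "agree n (g \<circ> h) (d \<circ> e)"
    by (rule agree_comp[OF C_Aut[OF g(1)] C_Aut[OF h(1)] D_Aut[OF g(2)] D_Aut[OF h(2)] g(3) h(3)])
  then show "g \<circ> h \<in> D_mod n"
    unfolding D_mod_def using sub_comp[OF C g(1) h(1)] sub_comp[OF D g(2) h(2)] by blast
qed

lemma D_le_D_mod: "D \<subseteq> D_mod n"
  unfolding D_mod_def using DC agree_refl by blast

text \<open>The quotient of \<open>C\<close> by \<open>D_mod n\<close> is abelian, generated by the images of \<open>A\<close>, and of exponent dividing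
  \<open>(m!) ^ n\<close>.\<close>

lemma D_mod_cover:
  "\<exists>S\<subseteq>G. finite S \<and> card S \<le> (fact CARD('a) ^ n) ^ card A * card T \<and>
     (\<forall>g\<in>G. \<exists>t\<in>S. \<exists>b\<in>D_mod n. g = b \<circ> t)"
proof -
  have D_mod_C: "D_mod n \<subseteq> C" by (auto simp: D_mod_def)
  have comm: "x \<otimes>\<^bsub>Aut_tree\<^esub> y \<otimes>\<^bsub>Aut_tree\<^esub> m_inv Aut_tree x \<otimes>\<^bsub>Aut_tree\<^esub> m_inv Aut_tree y \<in> D_mod n"
    if "x \<in> C" "y \<in> C" for x y
  proof -
    have "comm (ginv y) (ginv x) \<in> D" using comm_D sub_ginv[OF C] that by blast
    moreover have "x \<otimes>\<^bsub>Aut_tree\<^esub> y \<otimes>\<^bsub>Aut_tree\<^esub> m_inv Aut_tree x \<otimes>\<^bsub>Aut_tree\<^esub> m_inv Aut_tree y = comm (ginv y) (ginv x)"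
      unfolding comm_def Aut_tree_simps(2) m_inv_Aut[OF C_Aut[OF that(1)]] m_inv_Aut[OF C_Aut[OF that(2)]]
        ginv_ginv[OF C_Aut[OF that(1)]] ginv_ginv[OF C_Aut[OF that(2)]] by (simp only: comp_assoc)
    ultimately show ?thesis using D_le_D_mod by auto
  qed
  have pow: "a [^]\<^bsub>Aut_tree\<^esub> (fact CARD('a) ^ n :: nat) \<in> D_mod n" if a: "a \<in> C" for a
  proof -
    have "a [^]\<^bsub>Aut_tree\<^esub> (fact CARD('a) ^ n :: nat) \<in> C" by (rule Aut_group.subgroup_nat_pow_closed[OF C a])
    moreover have "agree n (a [^]\<^bsub>Aut_tree\<^esub> (fact CARD('a) ^ n :: nat)) id"
      unfolding nat_pow_Aut by (rule fact_power_fixes_level[OF C_Aut[OF a]])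
    ultimately show ?thesis unfolding D_mod_def using sub_id[OF D] by blast
  qed
  have "(0::nat) < fact CARD('a) ^ n" by simp
  then obtain T' where T': "T' \<subseteq> C" "finite T'" "card T' \<le> (fact CARD('a) ^ n) ^ card A"
    "\<forall>c\<in>C. \<exists>t\<in>T'. \<exists>b\<in>D_mod n. c = b \<otimes>\<^bsub>Aut_tree\<^esub> t"
    using Aut_group.abelian_quotient_transversal[OF C D_mod_subgroup D_mod_C comm _ pow A(1,2)] by blast
  let ?S = "(\<lambda>(t', t). t' \<circ> t) ` (T' \<times> T)"
  have "card ?S \<le> card (T' \<times> T)" by (rule card_image_le) (use T'(2) T(1) in simp)
  also have "\<dots> \<le> (fact CARD('a) ^ n) ^ card A * card T"
    unfolding card_cartesian_product by (rule mult_le_mono1[OF T'(3)])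
  finally have card: "card ?S \<le> (fact CARD('a) ^ n) ^ card A * card T" .
  have sub: "?S \<subseteq> G"
  proof
    fix s assume "s \<in> ?S"
    then obtain t' t where "t' \<in> T'" "t \<in> T" "s = t' \<circ> t" by auto
    then show "s \<in> G" using sub_comp[OF G, of t' t] T'(1) CG T(2) by blast
  qed
  have fin: "finite ?S" using T'(2) T(1) by simp
  have "\<exists>t\<in>?S. \<exists>b\<in>D_mod n. g = b \<circ> t" if g: "g \<in> G" for g
  proof -
    obtain t c where tc: "t \<in> T" "c \<in> C" "g = c \<circ> t" using cover[OF g] by blast
    obtain t' b where tb: "t' \<in> T'" "b \<in> D_mod n" "c = t' \<circ> b"
      using T'(4) tc(2) unfolding Aut_tree_simps(2) by blast
    have t'C: "t' \<in> C" and bC: "b \<in> C" using tb T'(1) D_mod_C by auto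
    note t'A = C_Aut[OF t'C] and bA = C_Aut[OF bC]
    have "comm t' b \<circ> b \<in> D_mod n"
      using comm_D[OF t'C bC] D_le_D_mod tb(2) by (intro sub_comp[OF D_mod_subgroup]) auto
    moreover have "g = (comm t' b \<circ> b) \<circ> (t' \<circ> t)"
      unfolding tc(3) tb(3) comm_def using t'A bA by (simp add: fun_eq_iff)
    moreover have "t' \<circ> t \<in> ?S" using tb(1) tc(1) by force
    ultimately show ?thesis by blast
  qed
  then show ?thesis using sub fin card by (intro exI[of _ ?S]) blast
qed

lemma ix_branch_prod_D_mod:
  "ix (St_in \<Gamma> n) (branch_prod (level k) (D_mod n)) \<le> ix (St_in \<Gamma> n) (branch_prod (level k) D)"
proof -
  interpret q: finite_quotient \<Gamma> "St_in \<Gamma> n" by (rule finite_quotient_St)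
  have D_mod_C: "D_mod n \<subseteq> C" by (auto simp: D_mod_def)
  have sub: "branch_prod (level k) B \<subseteq> \<Gamma>" if "B \<subseteq> C" for B
    using branch_prod_level_G[OF that] G\<Gamma> by blast
  have "lcoset (St_in \<Gamma> n) p \<in> lcoset (St_in \<Gamma> n) ` branch_prod (level k) D"
    if p: "p \<in> branch_prod (level k) (D_mod n)" for p
  proof -
    obtain f where f: "p = spread (level k) f" "\<forall>u\<in>level k. f u \<in> D_mod n"
      using p by (auto simp: branch_prod_def)
    have "\<forall>u\<in>level k. \<exists>d. d \<in> D \<and> agree n (f u) d" using f(2) unfolding D_mod_def by blast
    then obtain \<delta> where \<delta>: "\<forall>u\<in>level k. \<delta> u \<in> D \<and> agree n (f u) (\<delta> u)"
      using bchoice[of "level k" "\<lambda>u d. d \<in> D \<and> agree n (f u) d"] by blast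
    have p': "spread (level k) \<delta> \<in> branch_prod (level k) D" by (rule branch_prodI) (use \<delta> in blast)
    have "agree n p (spread (level k) \<delta>)" unfolding agree_def
    proof
      fix w :: "'a list" assume w: "w \<in> level n"
      show "p w = spread (level k) \<delta> w"
      proof (cases rule: spread_cases[of "level k" w])
        case (1 u z)
        have fu: "f u \<in> Aut" using f(2) 1(1) D_mod_C C_Aut by blast
        have du: "\<delta> u \<in> Aut" "agree n (f u) (\<delta> u)" using \<delta> 1(1) D_Aut by auto
        have "length z \<le> n" using w 1(2) by (simp add: level_def)
        then have "f u z = \<delta> u z" by (rule agree_short[OF fu du])
        then show ?thesis unfolding f(1) 1(2) spread_below[OF antichain_level 1(1)] by simp
      next
        case 2
        show ?thesis unfolding f(1) spread_off[OF 2] ..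
      qed
    qed
    then have "lcoset (St_in \<Gamma> n) p = lcoset (St_in \<Gamma> n) (spread (level k) \<delta>)"
      using p p' sub[OF D_mod_C] sub[OF DC] by (intro q.lcoset_eq_agree[OF subset_refl]) auto
    then show ?thesis using p' by blast
  qed
  then have "lcoset (St_in \<Gamma> n) ` branch_prod (level k) (D_mod n) \<subseteq>
      lcoset (St_in \<Gamma> n) ` branch_prod (level k) D" by blast
  then show ?thesis unfolding ix_def by (intro card_mono q.finite_cosets[OF sub[OF DC]])
qed

lemma ix_branch_prod_D_pos:
  assumes "finite_quotient \<Gamma> N"
  shows "ix N (branch_prod (level k) D) \<ge> 1"
proof (rule finite_quotient.ix_pos[OF assms])
  show "branch_prod (level k) D \<subseteq> \<Gamma>" using branch_prod_level_G[OF DC] G\<Gamma> by blast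
  have "spread (level k) (\<lambda>_. id) \<in> branch_prod (level k) D"
    by (rule branch_prodI) (rule sub_id[OF D])
  then show "branch_prod (level k) D \<noteq> {}" by blast
qed

lemma T_nonempty: "card T \<ge> 1"
proof -
  obtain t where "t \<in> T" using cover[OF sub_id[OF G]] by blast
  then show ?thesis using T(1) by (simp add: Suc_le_eq card_gt_0_iff) blast
qed

text \<open>Passing from \<open>\<Gamma>\<close> to the copies of \<open>D\<close> at level \<open>k\<close> costs at most a term linear in \<open>n\<close>, against a logarithm
  that grows exponentially in \<open>n\<close>.\<close>

theorem St_in_balanced: "balanced_filtration G C A T (St_in \<Gamma>)"
proof (rule balanced_filtration.intro[OF regular_branch_group_axioms balanced_filtration_axioms.intro])
  show "finite_quotient \<Gamma> (St_in \<Gamma> n)" for n by (rule finite_quotient_St)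
  show "\<forall>\<^sub>F n in sequentially. (\<Prod>v\<in>level k. ix (St_in \<Gamma> n) (rist \<Gamma> v)) \<le> ix (St_in \<Gamma> n) \<Gamma>" for k
    by (rule always_eventually) (intro allI rist_le_St)
  obtain n0 where n0: "\<And>j. ix (St_in \<Gamma> (n0 + j)) \<Gamma> \<ge> 2 ^ 2 ^ j" using ix_St_growth by blast
  show "\<forall>\<^sub>F n in sequentially. 2 \<le> ix (St_in \<Gamma> n) \<Gamma>"
    unfolding eventually_sequentially
  proof (intro exI[of _ n0] allI impI)
    fix n assume "n0 \<le> n"
    then have "2 ^ 2 ^ (n - n0) \<le> ix (St_in \<Gamma> n) \<Gamma>" using n0[of "n - n0"] by simp
    moreover have "(2::nat) ^ 1 \<le> 2 ^ 2 ^ (n - n0)" by (rule power_increasing) auto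
    ultimately show "2 \<le> ix (St_in \<Gamma> n) \<Gamma>" by simp
  qed
  fix k
  define M where "M = (CARD('a) ^ k) ^ (CARD('a) ^ k)"
  define a where "a = ln (real M) + real (CARD('a) ^ k) * ln (real (card T))"
  define b where "b = real (CARD('a) ^ k) * (real (card A) * ln (real (fact CARD('a))))"
  have M1: "M \<ge> 1" unfolding M_def using card2 by (simp add: Suc_le_eq)
  have le: "ln (real (ix (St_in \<Gamma> n) \<Gamma>)) \<le>
      (a + b * real n) + ln (real (ix (St_in \<Gamma> n) (branch_prod (level k) D)))" for n
  proof -
    interpret q: finite_quotient \<Gamma> "St_in \<Gamma> n" by (rule finite_quotient_St)
    let ?e = "(fact CARD('a) ^ n) ^ card A * card T"
    obtain S where S: "S \<subseteq> G" "finite S" "card S \<le> ?e" "\<forall>g\<in>G. \<exists>t\<in>S. \<exists>b\<in>D_mod n. g = b \<circ> t"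
      using D_mod_cover[of n] by blast
    have "ix (St_in \<Gamma> n) \<Gamma> \<le> ix (St_in \<Gamma> n) (branch_prod (level k) (D_mod n)) * (M * card S ^ (CARD('a) ^ k))"
      unfolding M_def
      by (rule ix_le_branch_prod[OF finite_quotient_St D_mod_subgroup _ S(2,1)])
        (use S(4) in \<open>auto simp: D_mod_def\<close>)
    also have "\<dots> \<le> ix (St_in \<Gamma> n) (branch_prod (level k) D) * (M * ?e ^ (CARD('a) ^ k))"
      by (intro mult_mono ix_branch_prod_D_mod power_mono S(3)) auto
    finally have "real (ix (St_in \<Gamma> n) \<Gamma>) \<le>
        real (ix (St_in \<Gamma> n) (branch_prod (level k) D) * (M * ?e ^ (CARD('a) ^ k)))"
      by (rule of_nat_mono)
    moreover have "ix (St_in \<Gamma> n) \<Gamma> \<ge> 1" by (rule q.ix_pos) (use sub_id[OF \<Gamma>] in auto)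
    ultimately have "ln (real (ix (St_in \<Gamma> n) \<Gamma>)) \<le>
        ln (real (ix (St_in \<Gamma> n) (branch_prod (level k) D) * (M * ?e ^ (CARD('a) ^ k))))"
      by (intro ln_mono) auto
    also have "\<dots> = ln (real (ix (St_in \<Gamma> n) (branch_prod (level k) D))) +
        (ln (real M) + real (CARD('a) ^ k) * ((real (card A) * (real n * ln (real (fact CARD('a))))) + ln (real (card T))))"
    proof -
      have pD: "real (ix (St_in \<Gamma> n) (branch_prod (level k) D)) > 0"
        using ix_branch_prod_D_pos[OF finite_quotient_St, of n k] by simp
      have pM: "real M > 0" and pT: "real (card T) > 0" using M1 T_nonempty by simp_all
      have pF: "real (fact CARD('a)) > 0" by simp
      show ?thesis unfolding of_nat_mult of_nat_power
        using pD pM pT pF by (simp add: ln_mult_pos ln_realpow)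
    qed
    also have "\<dots> = (a + b * real n) + ln (real (ix (St_in \<Gamma> n) (branch_prod (level k) D)))"
      by (simp add: a_def b_def algebra_simps)
    finally show ?thesis .
  qed
  show "\<exists>E. (\<lambda>n. E n / ln (real (ix (St_in \<Gamma> n) \<Gamma>))) \<longlonglongrightarrow> 0 \<and>
      (\<forall>\<^sub>F n in sequentially. ln (real (ix (St_in \<Gamma> n) \<Gamma>)) \<le>
         E n + ln (real (ix (St_in \<Gamma> n) (branch_prod (level k) D))))"
    by (rule exI[of _ "\<lambda>n. a + b * real n"])
      (intro conjI linear_over_ln_ix_St always_eventually allI le)
qed

end

section \<open>Nice filtrations of just infinite groups\<close>

lemma normal_as_group_iff:
  assumes "subgroup H Aut_tree"
  shows "K \<lhd> as_group H \<longleftrightarrow>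
    subgroup K Aut_tree \<and> K \<subseteq> H \<and> (\<forall>g\<in>H. \<forall>n\<in>K. g \<circ> n \<circ> ginv g \<in> K)"
proof -
  interpret H: group "as_group H" by (rule Aut_group.subgroup_imp_group[OF assms])
  have inv: "m_inv (as_group H) g = ginv g" if "g \<in> H" for g
    using Aut_group.m_inv_consistent[OF assms that] m_inv_Aut[OF sub_Aut[OF assms that]] by simp
  have sub: "subgroup K (as_group H) \<longleftrightarrow> subgroup K Aut_tree \<and> K \<subseteq> H"
    using Aut_group.incl_subgroup[OF assms] Aut_group.subgroup_incl[OF _ assms]
      subgroup.subset[of K "as_group H"] by auto
  have "(\<forall>x\<in>H. \<forall>n\<in>K. x \<otimes>\<^bsub>as_group H\<^esub> n \<otimes>\<^bsub>as_group H\<^esub> m_inv (as_group H) x \<in> K) \<longleftrightarrow>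
      (\<forall>g\<in>H. \<forall>n\<in>K. g \<circ> n \<circ> ginv g \<in> K)"
  proof -
    have 1: "x \<otimes>\<^bsub>as_group H\<^esub> n \<otimes>\<^bsub>as_group H\<^esub> m_inv (as_group H) x = ginv x \<circ> n \<circ> ginv (ginv x)"
      if x: "x \<in> H" for x n
      unfolding inv[OF x] ginv_ginv[OF sub_Aut[OF assms x]] by (simp add: comp_assoc)
    have 2: "(\<forall>x\<in>H. P (ginv x)) \<longleftrightarrow> (\<forall>x\<in>H. P x)" for P
      using sub_ginv[OF assms] ginv_ginv[OF sub_Aut[OF assms]] by metis
    show ?thesis using 1 2[of "\<lambda>g. \<forall>n\<in>K. g \<circ> n \<circ> ginv g \<in> K"] by simp
  qed
  then show ?thesis unfolding H.normal_inv_iff sub by simp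
qed

lemma filtration_finite_quotient:
  fixes \<Gamma> :: "('a::finite list \<Rightarrow> 'a list) set"
  assumes \<Gamma>: "subgroup \<Gamma> Aut_tree" and N: "filtration \<Gamma> N"
  shows "finite_quotient \<Gamma> (N i)"
proof -
  have normal: "N i \<lhd> as_group \<Gamma>" and op: "openin (subtopology congruence_topology \<Gamma>) (N i)"
    using N by (auto simp: filtration_def)
  have n: "subgroup (N i) Aut_tree" "N i \<subseteq> \<Gamma>" "\<forall>g\<in>\<Gamma>. \<forall>n\<in>N i. g \<circ> n \<circ> ginv g \<in> N i"
    using normal unfolding normal_as_group_iff[OF \<Gamma>] by auto
  show ?thesis
    by (rule finite_quotient.intro[OF \<Gamma> n(1,2)])
      (use n(3) open_contains_St_in[OF op sub_id[OF n(1)]] in auto)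
qed

text \<open>The terms of a filtration eventually separate any given finite set of elements.\<close>

lemma filtration_ix_unbounded:
  fixes \<Gamma> :: "('a::finite list \<Rightarrow> 'a list) set"
  assumes \<Gamma>: "subgroup \<Gamma> Aut_tree" "infinite \<Gamma>" and N: "filtration \<Gamma> N"
  shows "\<forall>\<^sub>F i in sequentially. k \<le> ix (N i) \<Gamma>"
proof -
  obtain F where F: "F \<subseteq> \<Gamma>" "finite F" "card F = k"
    using infinite_arbitrarily_large[OF \<Gamma>(2), of k] by blast
  have dec: "decseq N" and triv: "(\<Inter>i. N i) = {id}" using N by (auto simp: filtration_def)
  have "\<forall>\<^sub>F i in sequentially. ginv (fst p) \<circ> snd p \<notin> N i"
    if p: "p \<in> {p \<in> F \<times> F. fst p \<noteq> snd p}" for p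
  proof -
    have A: "fst p \<in> Aut" "snd p \<in> Aut" using p F(1) sub_Aut[OF \<Gamma>(1)] by auto
    have "ginv (fst p) \<circ> snd p \<noteq> id"
    proof
      assume e: "ginv (fst p) \<circ> snd p = id"
      have "snd p = (fst p \<circ> ginv (fst p)) \<circ> snd p" using A by simp
      also have "\<dots> = fst p \<circ> (ginv (fst p) \<circ> snd p)" by (simp only: comp_assoc)
      also have "\<dots> = fst p" unfolding e by simp
      finally show False using p by simp
    qed
    then obtain j where "ginv (fst p) \<circ> snd p \<notin> N j" using triv by blast
    then have "ginv (fst p) \<circ> snd p \<notin> N i" if "i \<ge> j" for i
      using dec that unfolding decseq_def by blast
    then show ?thesis unfolding eventually_sequentially by blast
  qed
  then have "\<forall>\<^sub>F i in sequentially. \<forall>p\<in>{p \<in> F \<times> F. fst p \<noteq> snd p}. ginv (fst p) \<circ> snd p \<notin> N i"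
    by (intro eventually_ball_finite) (use F(2) in auto)
  then show ?thesis
  proof eventually_elim
    case (elim i)
    interpret q: finite_quotient \<Gamma> "N i" by (rule filtration_finite_quotient[OF \<Gamma>(1) N])
    have "inj_on (lcoset (N i)) F"
    proof (rule inj_onI)
      fix a b assume ab: "a \<in> F" "b \<in> F" "lcoset (N i) a = lcoset (N i) b"
      then have "ginv a \<circ> b \<in> N i" using q.lcoset_eq_iff[of a b] F(1) by blast
      then show "a = b" using elim ab(1,2) by fastforce
    qed
    then have "k = card (lcoset (N i) ` F)" using F(3) by (simp add: card_image)
    also have "\<dots> \<le> ix (N i) \<Gamma>"
      unfolding ix_def using F(1) by (intro card_mono q.finite_cosets_\<Gamma> image_mono)
    finally show ?case .
  qed
qed

text \<open>Counting the elements on both sides of the isomorphism of a nice filtration.\<close>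

lemma nice_filtration_prod:
  assumes \<Gamma>: "subgroup \<Gamma> Aut_tree" and N: "nice_filtration (\<Gamma> :: ('a::finite list \<Rightarrow> 'a list) set) N"
    and k: "k \<ge> 1"
  shows "\<forall>\<^sub>F i in sequentially. (\<Prod>v\<in>level k. ix (N i) (rist \<Gamma> v)) \<le> ix (N i) \<Gamma>"
proof -
  have fil: "filtration \<Gamma> N" using N by (simp add: nice_filtration_def)
  have "\<forall>\<^sub>F i in sequentially. as_group (Rist \<Gamma> k <#>\<^bsub>Aut_tree\<^esub> N i) Mod N i \<cong>
        product_group (level k) (\<lambda>v. as_group (rist \<Gamma> v <#>\<^bsub>Aut_tree\<^esub> N i) Mod N i)"
    using N k unfolding nice_filtration_def by blast
  then show ?thesis
  proof eventually_elim
    case (elim i)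
    interpret q: finite_quotient \<Gamma> "N i" by (rule filtration_finite_quotient[OF \<Gamma> fil])
    have sub: "rist \<Gamma> v \<subseteq> \<Gamma>" for v by (auto simp: rist_def)
    have Sub: "Rist \<Gamma> k \<subseteq> \<Gamma>" unfolding Rist_def
      by (rule Aut_group.generate_subgroup_incl[OF _ \<Gamma>]) (use sub in blast)
    obtain h where "bij_betw h (carrier (as_group (Rist \<Gamma> k <#>\<^bsub>Aut_tree\<^esub> N i) Mod N i))
        (carrier (product_group (level k) (\<lambda>v. as_group (rist \<Gamma> v <#>\<^bsub>Aut_tree\<^esub> N i) Mod N i)))"
      using elim unfolding is_iso_def iso_def by blast
    then have "card (lcoset (N i) ` Rist \<Gamma> k) = card (PiE (level k) (\<lambda>v. lcoset (N i) ` rist \<Gamma> v))"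
      using bij_betw_same_card by (fastforce simp: FactGroup_def q.rcosets_product[OF Sub] q.rcosets_product[OF sub])
    then have "(\<Prod>v\<in>level k. ix (N i) (rist \<Gamma> v)) = ix (N i) (Rist \<Gamma> k)"
      unfolding ix_def by (simp add: card_PiE)
    also have "\<dots> \<le> ix (N i) \<Gamma>" by (rule q.ix_mono[OF Sub subset_refl])
    finally show ?case .
  qed
qed

context regular_branch_group
begin

text \<open>An element of \<open>C\<close> that moves \<open>v\<close> does not commute with its own copy below \<open>v\<close>.\<close>

lemma D_nontrivial: "D \<noteq> {id}"
proof
  assume D1: "D = {id}"
  obtain c v where cv: "c \<in> C" "c v \<noteq> v" using C_moves by blast
  have cA: "c \<in> Aut" using C_Aut[OF cv(1)] .
  let ?l = "lift v c"
  have lA: "?l \<in> Aut" using cA by simp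
  have "comm c ?l = id" using comm_D[OF cv(1) C_lift[OF cv(1)], of v] D1 by blast
  then have e: "c \<circ> ?l \<circ> ginv c \<circ> ginv ?l = id" by (simp only: comm_def)
  have "c \<circ> ?l \<circ> ginv c = (c \<circ> ?l \<circ> ginv c \<circ> ginv ?l) \<circ> ?l"
    using lA by (simp only: comp_assoc ginv_comp_left comp_id)
  then have e': "c \<circ> ?l \<circ> ginv c = ?l" unfolding e by simp
  have "\<not> prefix (c v) (v @ v)"
  proof
    assume "prefix (c v) (v @ v)"
    then have "c v = take (length v) (v @ v)" using prefix_take Aut_length[OF cA, of v] by metis
    then show False using cv(2) by simp
  qed
  then have "(c \<circ> ?l \<circ> ginv c) (v @ v) = v @ v" unfolding conj_lift[OF cA] by (rule lift_off)
  then have "v @ c v = v @ v" unfolding e' lift_below .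
  then show False using cv(2) by simp
qed

lemma just_infinite_D_cover:
  assumes "just_infinite G"
  shows "\<exists>S\<subseteq>G. finite S \<and> (\<forall>g\<in>G. \<exists>t\<in>S. \<exists>d\<in>D. g = d \<circ> t)"
proof -
  have DG: "D \<subseteq> G" using DC CG by blast
  have "D \<lhd> as_group G"
    unfolding normal_as_group_iff[OF G] using D DG D_conj by blast
  then have "finite (carrier (as_group G Mod D))"
    using assms D_nontrivial unfolding just_infinite_def Aut_tree_simps(3) by blast
  then have "finite (rcosets\<^bsub>as_group G\<^esub> D)" by (simp add: FactGroup_def)
  then obtain S where S: "S \<subseteq> G" "finite S" "\<forall>g\<in>G. \<exists>t\<in>S. \<exists>d\<in>D. g = d \<otimes>\<^bsub>Aut_tree\<^esub> t"
    using Aut_group.finite_index_transversal[OF G D DG] by blast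
  have "\<exists>t\<in>S. \<exists>d\<in>D. g = d \<circ> t" if g: "g \<in> G" for g
  proof -
    obtain t d where td: "t \<in> S" "d \<in> D" "g = t \<circ> d" using S(3) g unfolding Aut_tree_simps(2) by blast
    have tG: "t \<in> G" using td(1) S(1) by blast
    have "g = (t \<circ> d \<circ> ginv t) \<circ> t" using G_Aut[OF tG] td(3) by (simp add: fun_eq_iff)
    then show ?thesis using D_conj[OF tG td(2)] td(1) by blast
  qed
  then show ?thesis using S by blast
qed

text \<open>In a just infinite group \<open>D\<close> has finite index, so that at every level its copies miss \<open>\<Gamma>\<close> by a bounded factor
  only, whereas the indices of the filtration tend to infinity.\<close>

theorem nice_filtration_balanced:
  assumes ji: "just_infinite G" and N: "nice_filtration \<Gamma> N"
  shows "balanced_filtration G C A T N"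
proof (rule balanced_filtration.intro[OF regular_branch_group_axioms balanced_filtration_axioms.intro])
  have fil: "filtration \<Gamma> N" using N by (simp add: nice_filtration_def)
  have fq: "finite_quotient \<Gamma> (N i)" for i by (rule filtration_finite_quotient[OF \<Gamma> fil])
  then show "finite_quotient \<Gamma> (N i)" for i .
  show "\<forall>\<^sub>F i in sequentially. (\<Prod>v\<in>level k. ix (N i) (rist \<Gamma> v)) \<le> ix (N i) \<Gamma>" if "k \<ge> 1" for k
    by (rule nice_filtration_prod[OF \<Gamma> N that])
  have "infinite \<Gamma>" using infinite_G G\<Gamma> finite_subset by blast
  note unbounded = filtration_ix_unbounded[OF \<Gamma> this fil]
  show "\<forall>\<^sub>F i in sequentially. 2 \<le> ix (N i) \<Gamma>" by (rule unbounded)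
  fix k
  obtain S where S: "S \<subseteq> G" "finite S" "\<forall>g\<in>G. \<exists>t\<in>S. \<exists>d\<in>D. g = d \<circ> t"
    using just_infinite_D_cover[OF ji] by blast
  define M where "M = (CARD('a) ^ k) ^ (CARD('a) ^ k) * card S ^ (CARD('a) ^ k)"
  have le: "ix (N i) \<Gamma> \<le> ix (N i) (branch_prod (level k) D) * M" for i
    unfolding M_def by (rule ix_le_branch_prod[OF fq D DC S(2,1)]) (use S(3) in blast)
  have pos: "ix (N i) \<Gamma> \<ge> 1" for i
    by (rule finite_quotient.ix_pos[OF fq]) (use sub_id[OF \<Gamma>] in auto)
  have M0: "M > 0" using le[of 0] pos[of 0] by (cases "M = 0") auto
  have ln_le: "ln (real (ix (N i) \<Gamma>)) \<le> ln (real M) + ln (real (ix (N i) (branch_prod (level k) D)))" for i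
  proof -
    have "real (ix (N i) \<Gamma>) \<le> real (ix (N i) (branch_prod (level k) D) * M)"
      using le[of i] by (rule of_nat_mono)
    then have "ln (real (ix (N i) \<Gamma>)) \<le> ln (real (ix (N i) (branch_prod (level k) D) * M))"
      using pos[of i] by (intro ln_mono) auto
    also have "\<dots> = ln (real (ix (N i) (branch_prod (level k) D))) + ln (real M)"
      unfolding of_nat_mult using M0 ix_branch_prod_D_pos[OF fq, of i k] by (intro ln_mult_pos) auto
    finally show ?thesis by simp
  qed
  have "filterlim (\<lambda>i. ln (real (ix (N i) \<Gamma>))) at_top sequentially"
    unfolding filterlim_at_top
  proof
    fix Z :: real
    show "\<forall>\<^sub>F i in sequentially. Z \<le> ln (real (ix (N i) \<Gamma>))"
      using unbounded[of "nat \<lceil>exp Z\<rceil>"]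
    proof eventually_elim
      case (elim i)
      have "exp Z \<le> real (nat \<lceil>exp Z\<rceil>)" by (rule real_nat_ceiling_ge)
      also have "\<dots> \<le> real (ix (N i) \<Gamma>)" using elim by (rule of_nat_mono)
      finally have "ln (exp Z) \<le> ln (real (ix (N i) \<Gamma>))" by (rule ln_mono) simp
      then show ?case by simp
    qed
  qed
  then have "(\<lambda>i. ln (real M) / ln (real (ix (N i) \<Gamma>))) \<longlonglongrightarrow> 0"
    by (rule tendsto_divide_0[OF tendsto_const filterlim_at_top_imp_at_infinity])
  then show "\<exists>E. (\<lambda>i. E i / ln (real (ix (N i) \<Gamma>))) \<longlonglongrightarrow> 0 \<and>
      (\<forall>\<^sub>F i in sequentially. ln (real (ix (N i) \<Gamma>)) \<le>
         E i + ln (real (ix (N i) (branch_prod (level k) D))))"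
    by (intro exI[of _ "\<lambda>i. ln (real M)"] conjI always_eventually allI ln_le)
qed

end

section \<open>The Hausdorff spectra\<close>

lemma hdim_range:
  assumes fq: "\<And>i. finite_quotient \<Gamma> (N i)" and H: "closed_subgroup H" "H \<subseteq> \<Gamma>"
  shows "hdim \<Gamma> N H \<in> {0..1}"
proof -
  let ?r = "\<lambda>i. ln (real (subgroup_index (H <#>\<^bsub>Aut_tree\<^esub> N i) (N i))) / ln (real (subgroup_index \<Gamma> (N i)))"
  have r: "0 \<le> ?r i \<and> ?r i \<le> 1" for i
  proof -
    interpret q: finite_quotient \<Gamma> "N i" by (rule fq)
    have "H \<noteq> {}" using H(1) sub_id[of H] by (auto simp: closed_subgroup_def)
    then have 1: "1 \<le> ix (N i) H" by (rule q.ix_pos[OF H(2)])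
    have 2: "ix (N i) H \<le> ix (N i) \<Gamma>" by (rule q.ix_mono[OF H(2) subset_refl])
    have 0: "0 \<le> ln (real (ix (N i) H))" using 1 by simp
    have "ln (real (ix (N i) H)) \<le> ln (real (ix (N i) \<Gamma>))" using 1 2 by simp
    then show ?thesis
      unfolding q.subgroup_index_product[OF H(2)] q.subgroup_index_\<Gamma> using 0
      by (auto simp: divide_le_eq_1)
  qed
  have "0 \<le> hdim \<Gamma> N H" unfolding hdim_def
    by (rule Liminf_bounded, rule always_eventually) (use r in simp)
  moreover have "hdim \<Gamma> N H \<le> limsup (\<lambda>i. ereal (?r i))"
    unfolding hdim_def by (rule Liminf_le_Limsup) simp
  moreover have "limsup (\<lambda>i. ereal (?r i)) \<le> 1"
    by (rule Limsup_bounded, rule always_eventually) (use r in simp)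
  ultimately show ?thesis by auto
qed

context balanced_filtration
begin

theorem full_spectra:
  assumes b: "2 * card A \<le> b"
  shows "hspec_gen b \<Gamma> N = {0..1} \<and> hspec_fg \<Gamma> N = {0..1} \<and> hspec \<Gamma> N = {0..1}"
proof -
  have 1: "hspec_gen b \<Gamma> N \<subseteq> hspec_fg \<Gamma> N" unfolding hspec_gen_def hspec_fg_def by blast
  have 2: "hspec_fg \<Gamma> N \<subseteq> hspec \<Gamma> N" unfolding hspec_fg_def hspec_def by blast
  have 3: "hspec \<Gamma> N \<subseteq> {0..1}"
  proof
    fix x assume "x \<in> hspec \<Gamma> N"
    then obtain H where "x = hdim \<Gamma> N H" "closed_subgroup H" "H \<subseteq> \<Gamma>" unfolding hspec_def by blast
    then show "x \<in> {0..1}" using hdim_range[where \<Gamma> = \<Gamma> and N = N and H = H] quotient by simp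
  qed
  have "{0..1} \<subseteq> hspec_gen b \<Gamma> N"
  proof
    fix x :: ereal assume x: "x \<in> {0..1}"
    then obtain \<alpha> where \<alpha>: "x = ereal \<alpha>" "0 \<le> \<alpha>" "\<alpha> \<le> 1" by (cases x) auto
    obtain S where S: "finite S" "card S \<le> 2 * card A" "S \<subseteq> Aut" "generate Aut_tree S \<subseteq> \<Gamma>"
      "hdim \<Gamma> N (congruence_topology closure_of (generate Aut_tree S)) = ereal \<alpha>"
      using dimension_attained[OF \<alpha>(2,3)] by blast
    let ?H = "congruence_topology closure_of (generate Aut_tree S)"
    have cl: "closed_subgroup ?H"
      unfolding closed_subgroup_def
      using closure_subgroup[OF Aut_group.generate_is_subgroup[OF S(3)]] closedin_closure_of by blast
    have sub: "?H \<subseteq> \<Gamma>"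
      using S(4) unfolding \<Gamma>_def by (rule closure_of_minimal) (rule closedin_closure_of)
    have "S \<subseteq> generate Aut_tree S" by (auto intro: generate.incl)
    also have "\<dots> \<subseteq> ?H" by (rule subset_closure) (rule Aut_group.generate_incl[OF S(3)])
    finally have "top_generated_by ?H S" by (simp add: top_generated_by_def)
    moreover have "card S \<le> b" using S(2) b by linarith
    ultimately show "x \<in> hspec_gen b \<Gamma> N"
      unfolding hspec_gen_def \<alpha>(1) S(5)[symmetric] using cl sub S(1) by blast
  qed
  then show ?thesis using 1 2 3 by blast
qed

end

theorem theorem2:
  fixes G :: "('a::finite list \<Rightarrow> 'a list) set"
  assumes "CARD('a) \<ge> 2"
    and "finitely_generated G"
    and "regular_branch G"
  defines "\<Gamma> \<equiv> congruence_topology closure_of G"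
  shows "\<exists>b::nat. b \<ge> 2 \<and>
    hspec_gen b \<Gamma> (St_in \<Gamma>) = {0..1} \<and>
    hspec_fg \<Gamma> (St_in \<Gamma>) = {0..1} \<and>
    hspec \<Gamma> (St_in \<Gamma>) = {0..1} \<and>
    (just_infinite G \<longrightarrow>
      (\<forall>N. nice_filtration \<Gamma> N \<longrightarrow>
        hspec_gen b \<Gamma> N = {0..1} \<and>
        hspec_fg \<Gamma> N = {0..1} \<and>
        hspec \<Gamma> N = {0..1}))"
proof -
  obtain C A T where "regular_branch_group G C A T"
    using regular_branch_group_exists[OF assms(1-3)] by blast
  then interpret R: regular_branch_group G C A T .
  have \<Gamma>: "\<Gamma> = R.\<Gamma>" unfolding \<Gamma>_def R.\<Gamma>_def ..
  let ?b = "max 2 (2 * card A)"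
  have b: "2 * card A \<le> ?b" by simp
  have level: "hspec_gen ?b \<Gamma> (St_in \<Gamma>) = {0..1} \<and> hspec_fg \<Gamma> (St_in \<Gamma>) = {0..1} \<and>
      hspec \<Gamma> (St_in \<Gamma>) = {0..1}"
    unfolding \<Gamma> by (rule balanced_filtration.full_spectra[OF R.St_in_balanced b])
  have nice: "hspec_gen ?b \<Gamma> N = {0..1} \<and> hspec_fg \<Gamma> N = {0..1} \<and> hspec \<Gamma> N = {0..1}"
    if "just_infinite G" "nice_filtration \<Gamma> N" for N
    using balanced_filtration.full_spectra[OF R.nice_filtration_balanced[OF that(1) that(2)[unfolded \<Gamma>]] b]
    unfolding \<Gamma> .
  show ?thesis
    by (rule exI[of _ ?b]) (use level nice in auto)
qed

end
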